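(* Let $\pi_1:V_1\to X_1$ and $\pi_2:V_2\to X_2$ be two finite-dimensional diffeological vector pseudo-bundles, let $(\tilde f,f)$ be a gluing between them ($f:X_1\supseteq Y\to f(Y)\subseteq X_2$, and $\tilde f:\pi_1^{-1}(Y)\to\pi_2^{-1}(f(Y))$ not necessarily a diffeomorphism), and let $g_1$ and $g_2$ be pseudo-metrics on $V_1$ and $V_2$ compatible with this gluing. Let $\tilde F^{C\ell}$ be the map between the restrictions of the Clifford algebra pseudo-bundles induced by $\tilde f$, and let $\tilde g$ be the pseudo-metric on $V_1\cup_{\tilde f}V_2$ induced by $g_1$ and $g_2$. Then there is a diffeomorphism of pseudo-bundles over $X_1\cup_fX_2$ $$\Phi^{C\ell}:C\ell(V_1,g_1)\cup_{\tilde F^{C\ell}}C\ell(V_2,g_2)\to C\ell(V_1\cup_{\tilde f}V_2,\tilde g).$$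
   Context: **Diffeology.** A diffeology on a set $X$ is a collection of maps $U\to X$ (plots), $U$ open in $\mathbb R^n$, $n\in\mathbb N$, containing all constant maps, closed under precomposition with smooth maps between domains, and such that any map that is locally a plot is a plot. A map is smooth if its composition with every plot is a plot; a diffeomorphism is a smooth bijection with smooth inverse. Subset diffeology: plots with range in the subset. Product diffeology: componentwise plots. Disjoint union diffeology: maps locally given by plots of one component. Quotient (pushforward) diffeology along a surjection $\pi$: maps locally of the form $\pi\circ p$, $p$ a plot. A diffeological vector space is a real vector space with a diffeology for which addition and scalar multiplication are smooth ($\mathbb R$ having the standard diffeology, i.e. all usual smooth maps). Its diffeological dual is the space of smooth linear functionals. **Pseudo-bundles.** A diffeological vector pseudo-bundle is a smooth surjection $\pi:V\to X$ of diffeological spaces with a real vector space structure on each fibre $\pi^{-1}(x)$ such that fibrewise addition $V\times_XV\to V$, fibrewise scalar multiplication $\mathbb R\times V\to V$ and the zero section $X\to V$ are smooth. It is finite-dimensional if all fibres are (fibre dimensions may vary). A diffeomorphism of pseudo-bundles over the same base $X$ is a diffeomorphism of the total spaces, linear on fibres, covering the identity of $X$. The dual pseudo-bundle $V^*=\bigcup_x(\pi^{-1}(x))^*$ (diffeological duals) has as plots those $p:U\to V^*$ such that for every plot $q:U'\to V$ the map $(u,u')\mapsto p(u)(q(u'))$ is smooth on $\{(u,u'):\ p(u)\text{ and }q(u')\text{ lie over the same point of }X\}\subseteq U\times U'$ with the subset diffeology. The tensor product of pseudo-bundles over $X$ is the union of the tensor products of the fibres; its plots are the maps that locally, over a plot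 of $X$, are finite sums of pointwise tensor products of plots of the factors covering that same plot of $X$ (the zero section over the plot being the empty sum). **Pseudo-metrics.** A pseudo-metric on $\pi:V\to X$ is a smooth section $g:X\to V^*\otimes V^*$ such that each $g(x)$ is a positive semi-definite symmetric bilinear form on $\pi^{-1}(x)$ of rank $\dim((\pi^{-1}(x))^* )$. **Clifford algebras.** $T(V)=\bigcup_xT(\pi^{-1}(x))=\bigcup_x\bigoplus_{r\ge0}(\pi^{-1}(x))^{\otimes r}$ (degree-0 part $X\times\mathbb R$) carries the diffeology whose plots are the maps that locally take values in a finite partial sum, with all components plots of the tensor power pseudo-bundles over the same plot of $X$. For a vector space $W$ with symmetric bilinear form $q$, $C\ell(W,q)=T(W)/I$, where $I$ is the two-sided ideal generated by the elements $v\otimes w+w\otimes v+4q(v,w)$. The pseudo-bundle of Clifford algebras $\pi^{C\ell}:C\ell(V,g)\to X$ is $\bigcup_xC\ell(\pi^{-1}(x),g(x))$ with the quotient diffeology from $T(V)$. **Gluing.** For diffeological spaces $X_1,X_2$ and a smooth map $f:X_1\supseteq Y\to X_2$ ($Y$ with the subset diffeology), $X_1\cup_fX_2$ is the quotient of $X_1\sqcup X_2$ by the equivalence relation generated by $y\sim f(y)$, $y\in Y$, with the quotient of the disjoint union diffeology. A gluing $(\tilde f,f)$ between pseudo-bundles $\pi_1:V_1\to X_1$ and $\pi_2:V_2\to X_2$ consists of a diffeomorphism $f:Y\to f(Y)$, $Y\subseteq X_1$, $f(Y)\subseteq X_2$ (subset diffeologies), and a smooth map $\tilde f:\pi_1^{-1}(Y)\to\pi_2^{-1}(f(Y))$,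 linear on each fibre, with $\pi_2\circ\tilde f=f\circ\pi_1$. It yields the pseudo-bundle $\pi_1\cup_{(\tilde f,f)}\pi_2:V_1\cup_{\tilde f}V_2\to X_1\cup_fX_2$. Denote by $i_1:X_1\setminus Y\to X_1\cup_fX_2$, $i_2:X_2\to X_1\cup_fX_2$, $j_1:V_1\setminus\pi_1^{-1}(Y)\to V_1\cup_{\tilde f}V_2$, $j_2:V_2\to V_1\cup_{\tilde f}V_2$ the natural injections; the fibre over $i_1(x)$ is $j_1(\pi_1^{-1}(x))$ and the fibre over $i_2(x)$ is $j_2(\pi_2^{-1}(x))$. Pseudo-metrics $g_1,g_2$ are compatible with the gluing if $g_1(y)(v,w)=g_2(f(y))(\tilde f(v),\tilde f(w))$ for all $y\in Y$, $v,w\in\pi_1^{-1}(y)$. Then the induced pseudo-metric $\tilde g$ on $V_1\cup_{\tilde f}V_2$ is $\tilde g(i_k(x))(v,w)=g_k(x)(j_k^{-1}(v),j_k^{-1}(w))$ ($k=1$, $x\in X_1\setminus Y$; $k=2$, $x\in X_2$). **The map $\tilde F^{C\ell}$.** For compatible $g_1,g_2$, $\tilde F^{C\ell}:(\pi_1^{C\ell})^{-1}(Y)\to(\pi_2^{C\ell})^{-1}(f(Y))$ is the map whose restriction to each fibre $C\ell(\pi_1^{-1}(y),g_1(y))$, $y\in Y$, is the unital algebra homomorphism to $C\ell(\pi_2^{-1}(f(y)),g_2(f(y)))$ extending $\tilde f|_{\pi_1^{-1}(y)}$. The pair $(\tilde F^{C\ell},f)$ is a gluing between $C\ell(V_1,g_1)$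 and $C\ell(V_2,g_2)$. *)

theory Defs
  imports
    "HOL-Analysis.Abstract_Euclidean_Space"
    "HOL-Algebra.QuotRing"
    "Jordan_Normal_Form.VS_Connect"
begin

section \<open>Smooth maps between domains\<close>

text \<open>
  Domains of \<open>\<real>\<^sup>n\<close>, for all \<open>n\<close> at once, are the sets \<open>U\<close> with \<^term>\<open>openin (Euclidean_space n) U\<close>;
  a point is a sequence \<open>nat \<Rightarrow> real\<close> vanishing from index \<open>n\<close> on.
\<close>

primrec Ck_on :: "nat \<Rightarrow> nat \<Rightarrow> (nat \<Rightarrow> real) set \<Rightarrow> ((nat \<Rightarrow> real) \<Rightarrow> real) \<Rightarrow> bool" where
  "Ck_on 0 n U h \<longleftrightarrow> continuous_map (subtopology (Euclidean_space n) U) euclideanreal h"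
| "Ck_on (Suc k) n U h \<longleftrightarrow>
     continuous_map (subtopology (Euclidean_space n) U) euclideanreal h \<and>
     (\<forall>i<n. \<exists>h'. Ck_on k n U h' \<and>
        (\<forall>x\<in>U. ((\<lambda>s. h (x(i := s))) has_real_derivative h' x) (at (x i))))"

definition smooth_fun :: "nat \<Rightarrow> (nat \<Rightarrow> real) set \<Rightarrow> ((nat \<Rightarrow> real) \<Rightarrow> real) \<Rightarrow> bool" where
  "smooth_fun n U h \<longleftrightarrow> openin (Euclidean_space n) U \<and> (\<forall>k. Ck_on k n U h)"

definition smooth_dom_map ::
  "nat \<Rightarrow> (nat \<Rightarrow> real) set \<Rightarrow> nat \<Rightarrow> (nat \<Rightarrow> real) set \<Rightarrow> ((nat \<Rightarrow> real) \<Rightarrow> (nat \<Rightarrow> real)) \<Rightarrow> bool" where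
  "smooth_dom_map m W n U h \<longleftrightarrow>
     openin (Euclidean_space m) W \<and> openin (Euclidean_space n) U \<and> h \<in> W \<rightarrow> U \<and>
     (\<forall>i<n. smooth_fun m W (\<lambda>w. h w i))"

definition near_each :: "nat \<Rightarrow> (nat \<Rightarrow> real) set \<Rightarrow> ((nat \<Rightarrow> real) set \<Rightarrow> bool) \<Rightarrow> bool" where
  "near_each n U P \<longleftrightarrow> (\<forall>u\<in>U. \<exists>W. openin (Euclidean_space n) W \<and> u \<in> W \<and> W \<subseteq> U \<and> P W)"


section \<open>Diffeological spaces\<close>

text \<open>
  \<open>plot X n U p\<close> says that the restriction of \<open>p\<close> to \<open>U\<close>, a domain of \<open>\<real>\<^sup>n\<close>, is a plot of \<open>X\<close>.
  Since HOL functions are total, it may depend only on the values of \<open>p\<close> on \<open>U\<close>; this is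
  the last clause of \<open>diffeology\<close>.
\<close>

record 'a dspace =
  pts :: "'a set"
  plot :: "nat \<Rightarrow> (nat \<Rightarrow> real) set \<Rightarrow> ((nat \<Rightarrow> real) \<Rightarrow> 'a) \<Rightarrow> bool"

definition diffeology :: "'a dspace \<Rightarrow> bool" where
  "diffeology X \<longleftrightarrow>
     (\<forall>n U p. plot X n U p \<longrightarrow> openin (Euclidean_space n) U \<and> p \<in> U \<rightarrow> pts X) \<and>
     (\<forall>n U. \<forall>a\<in>pts X. openin (Euclidean_space n) U \<longrightarrow> plot X n U (\<lambda>_. a)) \<and>
     (\<forall>m W n U p h. plot X n U p \<and> smooth_dom_map m W n U h \<longrightarrow> plot X m W (p \<circ> h)) \<and>
     (\<forall>n U p. openin (Euclidean_space n) U \<and> near_each n U (\<lambda>W. plot X n W p) \<longrightarrow> plot X n U p) \<and>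
     (\<forall>n U p q. plot X n U p \<and> (\<forall>u\<in>U. q u = p u) \<longrightarrow> plot X n U q)"

definition dsmooth :: "'a dspace \<Rightarrow> 'b dspace \<Rightarrow> ('a \<Rightarrow> 'b) \<Rightarrow> bool" where
  "dsmooth X Y h \<longleftrightarrow> h \<in> pts X \<rightarrow> pts Y \<and> (\<forall>n U p. plot X n U p \<longrightarrow> plot Y n U (h \<circ> p))"

definition diffeo :: "'a dspace \<Rightarrow> 'b dspace \<Rightarrow> ('a \<Rightarrow> 'b) \<Rightarrow> bool" where
  "diffeo X Y h \<longleftrightarrow> bij_betw h (pts X) (pts Y) \<and> dsmooth X Y h \<and> dsmooth Y X (inv_into (pts X) h)"

definition dreal :: "real dspace" where
  "dreal = \<lparr>pts = UNIV, plot = smooth_fun\<rparr>"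

definition ddomain :: "nat \<Rightarrow> (nat \<Rightarrow> real) set \<Rightarrow> (nat \<Rightarrow> real) dspace" where
  "ddomain n U = \<lparr>pts = U, plot = (\<lambda>m W h. smooth_dom_map m W n U h)\<rparr>"

definition dsub :: "'a dspace \<Rightarrow> 'a set \<Rightarrow> 'a dspace" where
  "dsub X A = \<lparr>pts = pts X \<inter> A, plot = (\<lambda>n U p. plot X n U p \<and> p \<in> U \<rightarrow> A)\<rparr>"

definition dprod :: "'a dspace \<Rightarrow> 'b dspace \<Rightarrow> ('a \<times> 'b) dspace" where
  "dprod X Y = \<lparr>pts = pts X \<times> pts Y,
     plot = (\<lambda>n U p. plot X n U (fst \<circ> p) \<and> plot Y n U (snd \<circ> p))\<rparr>"

definition dsum :: "'a dspace \<Rightarrow> 'b dspace \<Rightarrow> ('a + 'b) dspace" where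
  "dsum X Y = \<lparr>pts = pts X <+> pts Y,
     plot = (\<lambda>n U p. openin (Euclidean_space n) U \<and> near_each n U (\<lambda>W.
       (\<exists>q. plot X n W q \<and> (\<forall>w\<in>W. p w = Inl (q w))) \<or>
       (\<exists>q. plot Y n W q \<and> (\<forall>w\<in>W. p w = Inr (q w)))))\<rparr>"

definition pushforward :: "('a \<Rightarrow> 'b) \<Rightarrow> 'a dspace \<Rightarrow> 'b dspace" where
  "pushforward h X = \<lparr>pts = h ` pts X,
     plot = (\<lambda>n U p. openin (Euclidean_space n) U \<and>
       near_each n U (\<lambda>W. \<exists>q. plot X n W q \<and> (\<forall>w\<in>W. p w = h (q w))))\<rparr>"


section \<open>Diffeological vector pseudo-bundles\<close>

text \<open>
  The vector space structure on the fibre over \<open>x\<close> is \<open>fibre E x\<close>. Of the ring operations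
  carried by a \<open>module\<close> record, multiplication and unit are meaningful only for bundles of algebras.
\<close>

record ('x, 'v) pbundle =
  base :: "'x dspace"
  total :: "'v dspace"
  proj :: "'v \<Rightarrow> 'x"
  fibre :: "'x \<Rightarrow> (real, 'v) module"

definition pseudo_bundle :: "('x, 'v) pbundle \<Rightarrow> bool" where
  "pseudo_bundle E \<longleftrightarrow>
     diffeology (base E) \<and> diffeology (total E) \<and>
     dsmooth (total E) (base E) (proj E) \<and> proj E ` pts (total E) = pts (base E) \<and>
     (\<forall>x\<in>pts (base E). carrier (fibre E x) = {v \<in> pts (total E). proj E v = x} \<and>
        vectorspace class_ring (fibre E x)) \<and>
     dsmooth (dsub (dprod (total E) (total E)) {(v, w). proj E v = proj E w}) (total E)
       (\<lambda>(v, w). v \<oplus>\<^bsub>fibre E (proj E v)\<^esub> w) \<and>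
     dsmooth (dprod dreal (total E)) (total E) (\<lambda>(c, v). c \<odot>\<^bsub>fibre E (proj E v)\<^esub> v) \<and>
     dsmooth (base E) (total E) (\<lambda>x. \<zero>\<^bsub>fibre E x\<^esub>)"

definition finite_dimensional :: "('x, 'v) pbundle \<Rightarrow> bool" where
  "finite_dimensional E \<longleftrightarrow> (\<forall>x\<in>pts (base E). vectorspace.fin_dim class_ring (fibre E x))"

definition bundle_diffeo ::
  "('x, 'v) pbundle \<Rightarrow> ('x, 'w) pbundle \<Rightarrow> ('v \<Rightarrow> 'w) \<Rightarrow> bool" where
  "bundle_diffeo E E' h \<longleftrightarrow>
     base E = base E' \<and> diffeo (total E) (total E') h \<and>
     (\<forall>v\<in>pts (total E). proj E' (h v) = proj E v) \<and>
     (\<forall>x\<in>pts (base E). h \<in> module_hom class_ring (fibre E x) (fibre E' x))"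

definition over :: "('x, 'v) pbundle \<Rightarrow> 'x set \<Rightarrow> 'v set" where
  "over E A = {v \<in> pts (total E). proj E v \<in> A}"

definition transport :: "('a \<Rightarrow> 'b) \<Rightarrow> (real, 'a) module \<Rightarrow> (real, 'b) module" where
  "transport h M = (let k = inv_into (carrier M) h in
     \<lparr>carrier = h ` carrier M,
      mult = (\<lambda>a b. h (k a \<otimes>\<^bsub>M\<^esub> k b)), one = h \<one>\<^bsub>M\<^esub>,
      zero = h \<zero>\<^bsub>M\<^esub>, add = (\<lambda>a b. h (k a \<oplus>\<^bsub>M\<^esub> k b)),
      smult = (\<lambda>c a. h (c \<odot>\<^bsub>M\<^esub> k a))\<rparr>)"


section \<open>Dual pseudo-bundles\<close>

definition real_line :: "(real, real) module" where
  "real_line = \<lparr>carrier = UNIV, mult = (*), one = 1, zero = 0, add = (+), smult = (*)\<rparr>"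

definition dual_space :: "('x, 'v) pbundle \<Rightarrow> 'x \<Rightarrow> (real, 'v \<Rightarrow> real) module" where
  "dual_space E x = (ring.func_space class_ring (carrier (fibre E x)))
     \<lparr>carrier := {\<phi> \<in> extensional (carrier (fibre E x)).
        \<phi> \<in> module_hom class_ring (fibre E x) real_line \<and>
        dsmooth (dsub (total E) (carrier (fibre E x))) dreal \<phi>}\<rparr>"

text \<open>
  The base point is kept in the elements \<open>(x, \<phi>)\<close> of the dual, so that fibres over different
  points are disjoint; likewise for tensor powers, tensor algebras and Clifford algebras below.
\<close>

definition dual_bundle :: "('x, 'v) pbundle \<Rightarrow> ('x, 'x \<times> ('v \<Rightarrow> real)) pbundle" where
  "dual_bundle E = \<lparr>
     base = base E,
     total = \<lparr>pts = (SIGMA x:pts (base E). carrier (dual_space E x)),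
       plot = (\<lambda>n U p. openin (Euclidean_space n) U \<and>
         p \<in> U \<rightarrow> (SIGMA x:pts (base E). carrier (dual_space E x)) \<and>
         (\<forall>n' U' q. plot (total E) n' U' q \<longrightarrow>
            dsmooth (dsub (dprod (ddomain n U) (ddomain n' U')) {(u, u'). fst (p u) = proj E (q u')})
              dreal (\<lambda>(u, u'). snd (p u) (q u'))))\<rparr>,
     proj = fst,
     fibre = (\<lambda>x. transport (Pair x) (dual_space E x))\<rparr>"


section \<open>Tensor powers and tensor algebras\<close>

text \<open>
  \<open>tensor_power W r\<close> is the quotient of the free real vector space on the words of length \<open>r\<close>
  over \<open>W\<close> by the span of the multilinearity relations; its elements are cosets of that span.
  \<open>tensor_algebra W\<close> is the direct sum of the tensor powers: families indexed by the degree,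
  with finitely many nonzero components.
\<close>

definition free_space :: "'a set \<Rightarrow> (real, 'a \<Rightarrow> real) module" where
  "free_space S = \<lparr>carrier = {t. finite {l. t l \<noteq> 0} \<and> {l. t l \<noteq> 0} \<subseteq> S},
     mult = undefined, one = undefined,
     zero = (\<lambda>_. 0), add = (\<lambda>s t l. s l + t l), smult = (\<lambda>c t l. c * t l)\<rparr>"

definition single :: "'a \<Rightarrow> 'a \<Rightarrow> real" where
  "single l = (\<lambda>l'. if l' = l then 1 else 0)"

definition words :: "(real, 'v) module \<Rightarrow> nat \<Rightarrow> 'v list set" where
  "words W r = {l. length l = r \<and> set l \<subseteq> carrier W}"

definition tensor_rels :: "(real, 'v) module \<Rightarrow> nat \<Rightarrow> ('v list \<Rightarrow> real) set" where
  "tensor_rels W r = LinearCombinations.module.span class_ring (free_space (words W r))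
     ({(\<lambda>l. single (xs @ [v \<oplus>\<^bsub>W\<^esub> w] @ ys) l - single (xs @ [v] @ ys) l - single (xs @ [w] @ ys) l) |xs v w ys.
         v \<in> carrier W \<and> w \<in> carrier W \<and> set xs \<subseteq> carrier W \<and> set ys \<subseteq> carrier W \<and>
         length xs + 1 + length ys = r} \<union>
      {(\<lambda>l. single (xs @ [c \<odot>\<^bsub>W\<^esub> v] @ ys) l - c * single (xs @ [v] @ ys) l) |xs c v ys.
         v \<in> carrier W \<and> set xs \<subseteq> carrier W \<and> set ys \<subseteq> carrier W \<and>
         length xs + 1 + length ys = r})"

definition tensor_class :: "(real, 'v) module \<Rightarrow> nat \<Rightarrow> ('v list \<Rightarrow> real) \<Rightarrow> ('v list \<Rightarrow> real) set" where
  "tensor_class W r t = tensor_rels W r +>\<^bsub>free_space (words W r)\<^esub> t"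

definition quot_smult :: "(real, 'a) module \<Rightarrow> 'a set \<Rightarrow> real \<Rightarrow> 'a set \<Rightarrow> 'a set" where
  "quot_smult M N c A = (\<Union>a\<in>A. N +>\<^bsub>M\<^esub> (c \<odot>\<^bsub>M\<^esub> a))"

definition tensor_power :: "(real, 'v) module \<Rightarrow> nat \<Rightarrow> (real, ('v list \<Rightarrow> real) set) module" where
  "tensor_power W r = (let M = free_space (words W r); N = tensor_rels W r in
     \<lparr>carrier = a_rcosets\<^bsub>M\<^esub> N, mult = undefined, one = undefined,
      zero = N, add = set_add M, smult = quot_smult M N\<rparr>)"

text \<open>
  The concatenation map from the tensor powers of degrees \<open>i\<close> and \<open>j\<close> to the one of degree \<open>i + j\<close>;
  on representatives it is the product of the free algebra on \<open>W\<close>.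
\<close>

definition tensor_concat ::
  "(real, 'v) module \<Rightarrow> nat \<Rightarrow> nat \<Rightarrow> ('v list \<Rightarrow> real) set \<Rightarrow> ('v list \<Rightarrow> real) set \<Rightarrow> ('v list \<Rightarrow> real) set" where
  "tensor_concat W i j A B =
     (\<Union>a\<in>A. \<Union>b\<in>B. tensor_class W (i + j) (\<lambda>l. a (take i l) * b (drop i l)))"

definition tensor_algebra ::
  "(real, 'v) module \<Rightarrow> (real, nat \<Rightarrow> ('v list \<Rightarrow> real) set) module" where
  "tensor_algebra W =
     \<lparr>carrier = {t. (\<forall>r. t r \<in> carrier (tensor_power W r)) \<and>
        finite {r. t r \<noteq> \<zero>\<^bsub>tensor_power W r\<^esub>}},
      mult = (\<lambda>s t r. \<Oplus>\<^bsub>tensor_power W r\<^esub>i\<in>{..r}. tensor_concat W i (r - i) (s i) (t (r - i))),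
      one = (\<lambda>r. if r = 0 then tensor_class W 0 (single []) else \<zero>\<^bsub>tensor_power W r\<^esub>),
      zero = (\<lambda>r. \<zero>\<^bsub>tensor_power W r\<^esub>),
      add = (\<lambda>s t r. s r \<oplus>\<^bsub>tensor_power W r\<^esub> t r),
      smult = (\<lambda>c t r. c \<odot>\<^bsub>tensor_power W r\<^esub> t r)\<rparr>"

definition degree_one :: "(real, 'v) module \<Rightarrow> 'v \<Rightarrow> nat \<Rightarrow> ('v list \<Rightarrow> real) set" where
  "degree_one W v = (\<lambda>r. if r = 1 then tensor_class W 1 (single [v]) else \<zero>\<^bsub>tensor_power W r\<^esub>)"

text \<open>
  In degree 0 the tensor power is \<open>X \<times> \<real>\<close> with the product diffeology; in degree \<open>r > 0\<close> the plots
  are locally finite sums of tensor products of \<open>r\<close> plots of the bundle over one plot of the base.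
\<close>

definition tensor_power_space ::
  "('x, 'v) pbundle \<Rightarrow> nat \<Rightarrow> ('x \<times> ('v list \<Rightarrow> real) set) dspace" where
  "tensor_power_space E r =
     \<lparr>pts = (SIGMA x:pts (base E). carrier (tensor_power (fibre E x) r)),
      plot = (\<lambda>n U p. openin (Euclidean_space n) U \<and>
        p \<in> U \<rightarrow> (SIGMA x:pts (base E). carrier (tensor_power (fibre E x) r)) \<and>
        near_each n U (\<lambda>W. plot (base E) n W (\<lambda>u. fst (p u)) \<and>
          (if r = 0 then
             \<exists>c. plot dreal n W c \<and>
               (\<forall>u\<in>W. let F = fibre E (fst (p u)) in
                  snd (p u) = c u \<odot>\<^bsub>tensor_power F 0\<^esub> tensor_class F 0 (single []))
           else
             \<exists>(k::nat) \<alpha>. (\<forall>m<k. \<forall>i<r. plot (total E) n W (\<alpha> m i) \<and>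
                  (\<forall>u\<in>W. proj E (\<alpha> m i u) = fst (p u))) \<and>
               (\<forall>u\<in>W. let F = fibre E (fst (p u)) in
                  snd (p u) = (\<Oplus>\<^bsub>tensor_power F r\<^esub>m\<in>{..<k}.
                    tensor_class F r (single (map (\<lambda>i. \<alpha> m i u) [0..<r])))))))\<rparr>"

definition tensor_algebra_space ::
  "('x, 'v) pbundle \<Rightarrow> ('x \<times> (nat \<Rightarrow> ('v list \<Rightarrow> real) set)) dspace" where
  "tensor_algebra_space E =
     \<lparr>pts = (SIGMA x:pts (base E). carrier (tensor_algebra (fibre E x))),
      plot = (\<lambda>n U p. openin (Euclidean_space n) U \<and>
        p \<in> U \<rightarrow> (SIGMA x:pts (base E). carrier (tensor_algebra (fibre E x))) \<and>
        near_each n U (\<lambda>W. \<exists>N.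
          (\<forall>r>N. \<forall>u\<in>W. snd (p u) r = \<zero>\<^bsub>tensor_power (fibre E (fst (p u))) r\<^esub>) \<and>
          (\<forall>r\<le>N. plot (tensor_power_space E r) n W (\<lambda>u. (fst (p u), snd (p u) r)))))\<rparr>"


section \<open>Pseudo-metrics\<close>

definition form_rank :: "(real, 'v) module \<Rightarrow> ('v \<Rightarrow> 'v \<Rightarrow> real) \<Rightarrow> nat" where
  "form_rank W b = vectorspace.dim class_ring
     ((ring.func_space class_ring (carrier W))
        \<lparr>carrier := (\<lambda>v. restrict (b v) (carrier W)) ` carrier W\<rparr>)"

text \<open>
  A section of \<open>V\<^sup>* \<otimes> V\<^sup>*\<close> is identified with a family of bilinear forms by
  \<open>(\<phi> \<otimes> \<psi>) (v, w) = \<phi> v * \<psi> w\<close>: if \<open>t\<close> is a formal combination of pairs \<open>[(x, \<phi>), (x, \<psi>)]\<close>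
  representing the value of the section at \<open>x\<close>, the form is the corresponding combination of the
  products \<open>\<phi> v * \<psi> w\<close>, whichever representative is chosen.
\<close>

definition section_form ::
  "('x, 'v) pbundle \<Rightarrow> ('x \<Rightarrow> 'x \<times> (('x \<times> ('v \<Rightarrow> real)) list \<Rightarrow> real) set) \<Rightarrow>
   ('x \<Rightarrow> 'v \<Rightarrow> 'v \<Rightarrow> real) \<Rightarrow> bool" where
  "section_form E s g \<longleftrightarrow>
     (\<forall>x\<in>pts (base E). \<forall>v\<in>carrier (fibre E x). \<forall>w\<in>carrier (fibre E x). \<forall>t\<in>snd (s x).
        g x v w = (\<Sum>l | t l \<noteq> 0. t l * snd (l ! 0) v * snd (l ! 1) w))"

definition pseudo_metric :: "('x, 'v) pbundle \<Rightarrow> ('x \<Rightarrow> 'v \<Rightarrow> 'v \<Rightarrow> real) \<Rightarrow> bool" where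
  "pseudo_metric E g \<longleftrightarrow>
     (\<exists>s. dsmooth (base E) (tensor_power_space (dual_bundle E) 2) s \<and>
        (\<forall>x\<in>pts (base E). fst (s x) = x) \<and> section_form E s g) \<and>
     (\<forall>x\<in>pts (base E).
        (\<forall>v\<in>carrier (fibre E x). \<forall>w\<in>carrier (fibre E x). g x v w = g x w v) \<and>
        (\<forall>v\<in>carrier (fibre E x). g x v v \<ge> 0) \<and>
        form_rank (fibre E x) (g x) = vectorspace.dim class_ring (dual_space E x))"


section \<open>Clifford algebras\<close>

definition clifford_ideal ::
  "(real, 'v) module \<Rightarrow> ('v \<Rightarrow> 'v \<Rightarrow> real) \<Rightarrow> (nat \<Rightarrow> ('v list \<Rightarrow> real) set) set" where
  "clifford_ideal W q = (let T = tensor_algebra W in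
     Idl\<^bsub>T\<^esub> {(degree_one W v \<otimes>\<^bsub>T\<^esub> degree_one W w) \<oplus>\<^bsub>T\<^esub> (degree_one W w \<otimes>\<^bsub>T\<^esub> degree_one W v)
             \<oplus>\<^bsub>T\<^esub> ((4 * q v w) \<odot>\<^bsub>T\<^esub> \<one>\<^bsub>T\<^esub>) |v w. v \<in> carrier W \<and> w \<in> carrier W})"

definition clifford_algebra ::
  "(real, 'v) module \<Rightarrow> ('v \<Rightarrow> 'v \<Rightarrow> real) \<Rightarrow> (real, (nat \<Rightarrow> ('v list \<Rightarrow> real) set) set) module" where
  "clifford_algebra W q = (let T = tensor_algebra W; I = clifford_ideal W q; Q = T Quot I in
     \<lparr>carrier = carrier Q, mult = mult Q, one = one Q, zero = zero Q, add = add Q,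
      smult = quot_smult T I\<rparr>)"

definition clifford_class ::
  "(real, 'v) module \<Rightarrow> ('v \<Rightarrow> 'v \<Rightarrow> real) \<Rightarrow> (nat \<Rightarrow> ('v list \<Rightarrow> real) set) \<Rightarrow>
   (nat \<Rightarrow> ('v list \<Rightarrow> real) set) set" where
  "clifford_class W q t = clifford_ideal W q +>\<^bsub>tensor_algebra W\<^esub> t"

definition clifford_bundle ::
  "('x, 'v) pbundle \<Rightarrow> ('x \<Rightarrow> 'v \<Rightarrow> 'v \<Rightarrow> real) \<Rightarrow>
   ('x, 'x \<times> (nat \<Rightarrow> ('v list \<Rightarrow> real) set) set) pbundle" where
  "clifford_bundle E g = \<lparr>
     base = base E,
     total = pushforward (\<lambda>(x, t). (x, clifford_class (fibre E x) (g x) t)) (tensor_algebra_space E),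
     proj = fst,
     fibre = (\<lambda>x. transport (Pair x) (clifford_algebra (fibre E x) (g x)))\<rparr>"

definition clifford_incl ::
  "('x, 'v) pbundle \<Rightarrow> ('x \<Rightarrow> 'v \<Rightarrow> 'v \<Rightarrow> real) \<Rightarrow> 'v \<Rightarrow> 'x \<times> (nat \<Rightarrow> ('v list \<Rightarrow> real) set) set" where
  "clifford_incl E g v = (let x = proj E v in
     (x, clifford_class (fibre E x) (g x) (degree_one (fibre E x) v)))"


section \<open>Gluing\<close>

definition glue_rel :: "'a dspace \<Rightarrow> 'b dspace \<Rightarrow> 'a set \<Rightarrow> ('a \<Rightarrow> 'b) \<Rightarrow> ('a + 'b) rel" where
  "glue_rel X1 X2 Y f = \<Inter>{R. equiv (pts X1 <+> pts X2) R \<and> (\<forall>y\<in>Y. (Inl y, Inr (f y)) \<in> R)}"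

definition glue :: "'a dspace \<Rightarrow> 'b dspace \<Rightarrow> 'a set \<Rightarrow> ('a \<Rightarrow> 'b) \<Rightarrow> ('a + 'b) set dspace" where
  "glue X1 X2 Y f = pushforward (\<lambda>z. glue_rel X1 X2 Y f `` {z}) (dsum X1 X2)"

definition glue_in1 :: "'a dspace \<Rightarrow> 'b dspace \<Rightarrow> 'a set \<Rightarrow> ('a \<Rightarrow> 'b) \<Rightarrow> 'a \<Rightarrow> ('a + 'b) set" where
  "glue_in1 X1 X2 Y f a = glue_rel X1 X2 Y f `` {Inl a}"

definition glue_in2 :: "'a dspace \<Rightarrow> 'b dspace \<Rightarrow> 'a set \<Rightarrow> ('a \<Rightarrow> 'b) \<Rightarrow> 'b \<Rightarrow> ('a + 'b) set" where
  "glue_in2 X1 X2 Y f b = glue_rel X1 X2 Y f `` {Inr b}"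

definition bundle_gluing ::
  "('x1, 'v1) pbundle \<Rightarrow> ('x2, 'v2) pbundle \<Rightarrow> 'x1 set \<Rightarrow> ('x1 \<Rightarrow> 'x2) \<Rightarrow> ('v1 \<Rightarrow> 'v2) \<Rightarrow> bool" where
  "bundle_gluing E1 E2 Y f F \<longleftrightarrow>
     Y \<subseteq> pts (base E1) \<and> f ` Y \<subseteq> pts (base E2) \<and>
     diffeo (dsub (base E1) Y) (dsub (base E2) (f ` Y)) f \<and>
     dsmooth (dsub (total E1) (over E1 Y)) (dsub (total E2) (over E2 (f ` Y))) F \<and>
     (\<forall>v\<in>over E1 Y. proj E2 (F v) = f (proj E1 v)) \<and>
     (\<forall>y\<in>Y. F \<in> module_hom class_ring (fibre E1 y) (fibre E2 (f y)))"

text \<open>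
  Below, \<open>i1\<close>, \<open>i2\<close>, \<open>j1\<close>, \<open>j2\<close> are the natural maps of the two bases and the two total spaces
  into the glued ones; \<open>i1\<close> and \<open>j1\<close> are used only off the glued part, where they are injective.
  The projection sends the class of an element of either total space to the class of its base point.
\<close>

definition glue_bundle ::
  "('x1, 'v1) pbundle \<Rightarrow> ('x2, 'v2) pbundle \<Rightarrow> 'x1 set \<Rightarrow> ('x1 \<Rightarrow> 'x2) \<Rightarrow> ('v1 \<Rightarrow> 'v2) \<Rightarrow>
   (('x1 + 'x2) set, ('v1 + 'v2) set) pbundle" where
  "glue_bundle E1 E2 Y f F =
    (let i1 = glue_in1 (base E1) (base E2) Y f;
         i2 = glue_in2 (base E1) (base E2) Y f;
         j1 = glue_in1 (total E1) (total E2) (over E1 Y) F;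
         j2 = glue_in2 (total E1) (total E2) (over E1 Y) F
     in \<lparr>base = glue (base E1) (base E2) Y f,
         total = glue (total E1) (total E2) (over E1 Y) F,
         proj = (\<lambda>c. case SOME z. z \<in> c of Inl v \<Rightarrow> i1 (proj E1 v) | Inr w \<Rightarrow> i2 (proj E2 w)),
         fibre = (\<lambda>z. if z \<in> i1 ` (pts (base E1) - Y)
           then transport j1 (fibre E1 (inv_into (pts (base E1) - Y) i1 z))
           else transport j2 (fibre E2 (inv_into (pts (base E2)) i2 z)))\<rparr>)"

definition metrics_compatible ::
  "('x1, 'v1) pbundle \<Rightarrow> 'x1 set \<Rightarrow> ('x1 \<Rightarrow> 'x2) \<Rightarrow> ('v1 \<Rightarrow> 'v2) \<Rightarrow>
   ('x1 \<Rightarrow> 'v1 \<Rightarrow> 'v1 \<Rightarrow> real) \<Rightarrow> ('x2 \<Rightarrow> 'v2 \<Rightarrow> 'v2 \<Rightarrow> real) \<Rightarrow> bool" where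
  "metrics_compatible E1 Y f F g1 g2 \<longleftrightarrow>
     (\<forall>y\<in>Y. \<forall>v\<in>carrier (fibre E1 y). \<forall>w\<in>carrier (fibre E1 y). g1 y v w = g2 (f y) (F v) (F w))"

definition glue_metric ::
  "('x1, 'v1) pbundle \<Rightarrow> ('x2, 'v2) pbundle \<Rightarrow> 'x1 set \<Rightarrow> ('x1 \<Rightarrow> 'x2) \<Rightarrow> ('v1 \<Rightarrow> 'v2) \<Rightarrow>
   ('x1 \<Rightarrow> 'v1 \<Rightarrow> 'v1 \<Rightarrow> real) \<Rightarrow> ('x2 \<Rightarrow> 'v2 \<Rightarrow> 'v2 \<Rightarrow> real) \<Rightarrow>
   ('x1 + 'x2) set \<Rightarrow> ('v1 + 'v2) set \<Rightarrow> ('v1 + 'v2) set \<Rightarrow> real" where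
  "glue_metric E1 E2 Y f F g1 g2 =
    (let i1 = glue_in1 (base E1) (base E2) Y f;
         i2 = glue_in2 (base E1) (base E2) Y f;
         j1 = glue_in1 (total E1) (total E2) (over E1 Y) F;
         j2 = glue_in2 (total E1) (total E2) (over E1 Y) F;
         k1 = inv_into (pts (total E1) - over E1 Y) j1;
         k2 = inv_into (pts (total E2)) j2
     in (\<lambda>z v w. if z \<in> i1 ` (pts (base E1) - Y)
           then g1 (inv_into (pts (base E1) - Y) i1 z) (k1 v) (k1 w)
           else g2 (inv_into (pts (base E2)) i2 z) (k2 v) (k2 w)))"

text \<open>Extensionality off the preimage of \<open>Y\<close> makes the map described below unique as a total HOL function.\<close>

definition clifford_gluing_map ::
  "('x1, 'v1) pbundle \<Rightarrow> ('x2, 'v2) pbundle \<Rightarrow> 'x1 set \<Rightarrow> ('x1 \<Rightarrow> 'x2) \<Rightarrow> ('v1 \<Rightarrow> 'v2) \<Rightarrow>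
   ('x1 \<Rightarrow> 'v1 \<Rightarrow> 'v1 \<Rightarrow> real) \<Rightarrow> ('x2 \<Rightarrow> 'v2 \<Rightarrow> 'v2 \<Rightarrow> real) \<Rightarrow>
   'x1 \<times> (nat \<Rightarrow> ('v1 list \<Rightarrow> real) set) set \<Rightarrow> 'x2 \<times> (nat \<Rightarrow> ('v2 list \<Rightarrow> real) set) set" where
  "clifford_gluing_map E1 E2 Y f F g1 g2 =
    (let C1 = clifford_bundle E1 g1; C2 = clifford_bundle E2 g2 in
     THE G. G \<in> extensional (over C1 Y) \<and>
       (\<forall>y\<in>Y. G \<in> Ring.ring_hom (fibre C1 y) (fibre C2 (f y)) \<and>
          G \<in> module_hom class_ring (fibre C1 y) (fibre C2 (f y)) \<and>
          (\<forall>v\<in>carrier (fibre E1 y). G (clifford_incl E1 g1 v) = clifford_incl E2 g2 (F v))))"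

end

theory Submission
  imports Defs
begin

text \<open>
  The isomorphism is the obvious one: the class of an element of \<open>C\<ell>(V\<^sub>k, g\<^sub>k)\<close> over \<open>x\<close> goes to its
  image under the algebra map induced by the natural map \<open>j\<^sub>k\<close> of the fibre over \<open>x\<close> into the fibre
  of the glued bundle. Everything rests on the functoriality of the Clifford algebra in linear
  maps that respect the forms, and on a lifting property of plots.

  Algebra. The free algebra on a fibre \<open>W\<close> consists of the finitely supported real functions on
  words, with convolution as product. It maps onto the tensor algebra of \<open>W\<close> and hence onto
  \<open>C\<ell>(W, q)\<close>, and pushing words forward along \<open>h\<close> descends to both quotients
  (\<open>tensor_map_proj\<close>, \<open>clifford_map_proj\<close>). Surjectivity transfers the ring structure to the tensor
  algebra, shows that an algebra map out of \<open>C\<ell>(W, q)\<close> is determined by its values on \<open>W\<close>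
  (\<open>algebra_hom_unique\<close>), and so identifies the gluing map of the Clifford bundles over \<open>Y\<close> with
  the map induced by \<open>F\<close> (\<open>FC_eq\<close>). Since \<open>j\<^sub>1 = j\<^sub>2 \<circ> F\<close> over \<open>Y\<close> and the metrics are compatible,
  \<open>j\<^sub>1\<close> respects the forms over all of \<open>X\<^sub>1\<close>, also over \<open>Y\<close>, and functoriality makes the two halves
  of the map agree on the glued part. On each fibre of the glued bundle the map is induced by a
  linear isometry that is bijective, hence is bijective itself.

  Smoothness. A morphism of bundles sends plots of tensor powers to such plots, so the map is
  smooth. For the inverse, a plot of the tensor algebra of the glued bundle has to be lifted near
  a point \<open>u\<close> to one of the two tensor algebras. Each of the finitely many plots of the glued bundle
  that enter lifts near \<open>u\<close> to \<open>V\<^sub>1\<close> or to \<open>V\<^sub>2\<close>, but different ones could lift to different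
  sides. If the plot of the base lifts to \<open>X\<^sub>2\<close> near \<open>u\<close>, then every plot over it lifts to \<open>V\<^sub>2\<close>: a
  lift to \<open>V\<^sub>1\<close> lies over \<open>Y\<close> and can be composed with \<open>F\<close> (\<open>lift2\<close>). Otherwise no plot over
  it lifts to \<open>V\<^sub>2\<close>, all lift to \<open>V\<^sub>1\<close>, and since \<open>X\<^sub>1 \<rightarrow> X\<^sub>1 \<union>\<^sub>f X\<^sub>2\<close> is injective,
  as \<open>f\<close> is, they lie over one plot of \<open>X\<^sub>1\<close> (\<open>lift1\<close>).
\<close>

section \<open>Formal sums and the free algebra\<close>

text \<open>Formal real combinations of elements of \<open>S\<close>: the functions with finite support contained in \<open>S\<close>.\<close>

abbreviation formal_sums :: "'a set \<Rightarrow> ('a \<Rightarrow> real) set" where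
  "formal_sums S \<equiv> carrier (free_space S)"

lemma formal_sums_iff: "t \<in> formal_sums S \<longleftrightarrow> finite {l. t l \<noteq> 0} \<and> (\<forall>l. t l \<noteq> 0 \<longrightarrow> l \<in> S)"
  by (auto simp: free_space_def)

lemma formal_sums_zero [simp]: "(\<lambda>_. 0) \<in> formal_sums S"
  by (simp add: formal_sums_iff)

lemma formal_sums_add:
  assumes "a \<in> formal_sums S" "b \<in> formal_sums S"
  shows "(\<lambda>l. a l + b l) \<in> formal_sums S"
proof -
  have "{l. a l + b l \<noteq> 0} \<subseteq> {l. a l \<noteq> 0} \<union> {l. b l \<noteq> 0}" by auto
  with assms show ?thesis
    unfolding formal_sums_iff by (auto intro: finite_subset)
qed

lemma formal_sums_smult:
  assumes "a \<in> formal_sums S"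
  shows "(\<lambda>l. c * a l) \<in> formal_sums S"
proof -
  have "{l. c * a l \<noteq> 0} \<subseteq> {l. a l \<noteq> 0}" by auto
  with assms show ?thesis
    unfolding formal_sums_iff by (auto intro: finite_subset)
qed

lemma formal_sums_diff:
  assumes "a \<in> formal_sums S" "b \<in> formal_sums S"
  shows "(\<lambda>l. a l - b l) \<in> formal_sums S"
  using formal_sums_add[OF assms(1) formal_sums_smult[OF assms(2), of "-1"]] by simp

lemma formal_sums_single [simp]: "single l \<in> formal_sums S \<longleftrightarrow> l \<in> S"
  by (auto simp: formal_sums_iff single_def)

lemma formal_sums_sum:
  assumes "\<And>m. m \<in> M \<Longrightarrow> a m \<in> formal_sums S"
  shows "(\<lambda>l. \<Sum>m\<in>M. a m l) \<in> formal_sums S"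
  using assms
proof (induction M rule: infinite_finite_induct)
  case (insert x M)
  then show ?case using formal_sums_add[of "a x" S "\<lambda>l. \<Sum>m\<in>M. a m l"] by simp
qed simp_all

lemma formal_sums_mono: "S \<subseteq> S' \<Longrightarrow> a \<in> formal_sums S \<Longrightarrow> a \<in> formal_sums S'"
  by (auto simp: formal_sums_iff)

lemma formal_sums_induct [consumes 1, case_names zero add]:
  assumes a: "a \<in> formal_sums S"
    and zero: "P (\<lambda>_. 0)"
    and add: "\<And>a c l. a \<in> formal_sums S \<Longrightarrow> P a \<Longrightarrow> l \<in> S \<Longrightarrow> P (\<lambda>x. a x + c * single l x)"
  shows "P a"
proof -
  have "finite M \<Longrightarrow> {l. a l \<noteq> 0} = M \<Longrightarrow> a \<in> formal_sums S \<Longrightarrow> P a" for M a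
  proof (induction M arbitrary: a rule: finite_induct)
    case empty
    then have "a = (\<lambda>_. 0)" by auto
    then show ?case using zero by simp
  next
    case (insert l M)
    define b where "b = (\<lambda>x. a x - a l * single l x)"
    have l: "l \<in> S" using insert.prems by (auto simp: formal_sums_iff)
    have b: "b \<in> formal_sums S" unfolding b_def
      using insert.prems(2) l by (intro formal_sums_diff formal_sums_smult) auto
    have "{x. b x \<noteq> 0} = M"
      using insert.prems(1) insert.hyps(2) by (auto simp: b_def single_def split: if_splits)
    then have "P b" using insert.IH b by blast
    from add[OF b this l, of "a l"] show ?case by (simp add: b_def)
  qed
  then show ?thesis using a by (auto simp: formal_sums_iff)
qed

lemma free_space_module: "module class_ring (free_space S)"
proof (rule moduleI)
  show "cring (class_ring :: real ring)"
    by unfold_locales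
  show "abelian_group (free_space S)"
  proof (rule abelian_groupI)
    fix x assume x: "x \<in> formal_sums S"
    show "\<exists>y\<in>formal_sums S. y \<oplus>\<^bsub>free_space S\<^esub> x = \<zero>\<^bsub>free_space S\<^esub>"
      by (rule bexI[OF _ formal_sums_smult[OF x, of "-1"]]) (simp add: free_space_def)
  qed (use formal_sums_add in \<open>auto simp: free_space_def add.assoc add.commute\<close>)
qed (use formal_sums_smult in \<open>auto simp: free_space_def algebra_simps\<close>)

lemma submodule_free_space_iff:
  "submodule class_ring N (free_space S) \<longleftrightarrow>
     N \<subseteq> formal_sums S \<and> (\<lambda>_. 0) \<in> N \<and> (\<forall>a\<in>N. \<forall>b\<in>N. (\<lambda>l. a l + b l) \<in> N) \<and>
     (\<forall>c. \<forall>a\<in>N. (\<lambda>l. c * a l) \<in> N)"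
  using free_space_module[of S] unfolding submodule_def by (auto simp: free_space_def)

text \<open>The linear extension of a map of the indexing sets to formal sums.\<close>

definition push :: "('a \<Rightarrow> 'b) \<Rightarrow> ('a \<Rightarrow> real) \<Rightarrow> 'b \<Rightarrow> real" where
  "push h a = (\<lambda>l'. \<Sum>l | a l \<noteq> 0. a l * single (h l) l')"

lemma push_eq_sum:
  assumes "finite M" "{l. a l \<noteq> 0} \<subseteq> M"
  shows "push h a l' = (\<Sum>l\<in>M. a l * single (h l) l')"
  unfolding push_def using assms by (intro sum.mono_neutral_left) auto

lemma push_zero [simp]: "push h (\<lambda>_. 0) = (\<lambda>_. 0)"
  by (simp add: push_def)

lemma push_add:
  assumes "a \<in> formal_sums S" "b \<in> formal_sums S"
  shows "push h (\<lambda>l. a l + b l) = (\<lambda>l. push h a l + push h b l)"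
proof
  fix l'
  let ?M = "{l. a l \<noteq> 0} \<union> {l. b l \<noteq> 0}"
  have M: "finite ?M" using assms by (auto simp: formal_sums_iff)
  have "push h (\<lambda>l. a l + b l) l' = (\<Sum>l\<in>?M. (a l + b l) * single (h l) l')"
    by (rule push_eq_sum[OF M]) auto
  also have "\<dots> = (\<Sum>l\<in>?M. a l * single (h l) l') + (\<Sum>l\<in>?M. b l * single (h l) l')"
    by (simp add: sum.distrib algebra_simps)
  also have "\<dots> = push h a l' + push h b l'"
    using M by (intro arg_cong2[where f = "(+)"] push_eq_sum[symmetric]) auto
  finally show "push h (\<lambda>l. a l + b l) l' = push h a l' + push h b l'" .
qed

lemma push_smult: "push h (\<lambda>l. c * a l) = (\<lambda>l. c * push h a l)"
  by (cases "c = 0") (auto simp: push_def sum_distrib_left mult.assoc)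

lemma push_diff:
  assumes "a \<in> formal_sums S" "b \<in> formal_sums S"
  shows "push h (\<lambda>l. a l - b l) = (\<lambda>l. push h a l - push h b l)"
  using push_add[OF assms(1) formal_sums_smult[OF assms(2), of "-1"], of h]
    push_smult[of h "-1" b] by simp

lemma push_single [simp]: "push h (single l) = single (h l)"
proof -
  have "{x. single l x \<noteq> 0} = {l}" by (auto simp: single_def)
  then show ?thesis by (simp add: push_def fun_eq_iff single_def)
qed

lemma push_sum:
  assumes "\<And>m. m \<in> M \<Longrightarrow> a m \<in> formal_sums S"
  shows "push h (\<lambda>l. \<Sum>m\<in>M. a m l) = (\<lambda>l. \<Sum>m\<in>M. push h (a m) l)"
  using assms
proof (induction M rule: infinite_finite_induct)
  case (insert x M)
  then show ?case
    using push_add[of "a x" S "\<lambda>l. \<Sum>m\<in>M. a m l" h] formal_sums_sum[of M a S] by simp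
qed simp_all

lemma push_cong:
  assumes "a \<in> formal_sums S" "\<And>l. l \<in> S \<Longrightarrow> h l = h' l"
  shows "push h a = push h' a"
  using assms unfolding push_def formal_sums_iff by (auto intro!: sum.cong ext)

lemma push_single_add:
  assumes "a \<in> formal_sums S" "l \<in> S"
  shows "push h (\<lambda>x. a x + c * single l x) = (\<lambda>x. push h a x + c * single (h l) x)"
  using push_add[OF assms(1) formal_sums_smult[where c = c and a = "single l"], of h] assms(2)
  by (simp add: push_smult)

lemma push_closed:
  assumes "a \<in> formal_sums S" "h \<in> S \<rightarrow> S'"
  shows "push h a \<in> formal_sums S'"
  using assms(1)
proof (induction rule: formal_sums_induct)
  case (add a c l)
  then show ?case using assms(2)
    by (auto simp: push_single_add[of _ S] intro!: formal_sums_add formal_sums_smult)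
qed simp

lemma push_push:
  assumes "a \<in> formal_sums S"
  shows "push h' (push h a) = push (h' \<circ> h) a"
  using assms
proof (induction rule: formal_sums_induct)
  case (add a c l)
  have "push h a \<in> formal_sums UNIV" by (rule push_closed[OF add(1)]) simp
  then show ?case
    using add by (simp add: push_single_add[of _ S] push_single_add[of _ UNIV])
qed simp

lemma push_id:
  assumes "a \<in> formal_sums S" "\<And>l. l \<in> S \<Longrightarrow> h l = l"
  shows "push h a = a"
  using assms(1)
proof (induction rule: formal_sums_induct)
  case (add a c l)
  then show ?case using assms(2) by (simp add: push_single_add[of _ S])
qed simp

text \<open>The product of the free algebra: convolution over the ways of cutting a word in two.\<close>

definition conv :: "('a list \<Rightarrow> real) \<Rightarrow> ('a list \<Rightarrow> real) \<Rightarrow> 'a list \<Rightarrow> real" where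
  "conv a b = (\<lambda>l. \<Sum>i\<le>length l. a (take i l) * b (drop i l))"

lemma conv_add_left: "conv (\<lambda>l. a l + b l) d = (\<lambda>l. conv a d l + conv b d l)"
  and conv_add_right: "conv d (\<lambda>l. a l + b l) = (\<lambda>l. conv d a l + conv d b l)"
  and conv_smult_left: "conv (\<lambda>l. c * a l) d = (\<lambda>l. c * conv a d l)"
  and conv_smult_right: "conv d (\<lambda>l. c * a l) = (\<lambda>l. c * conv d a l)"
  and conv_zero_left [simp]: "conv (\<lambda>_. 0) d = (\<lambda>_. 0)"
  and conv_zero_right [simp]: "conv d (\<lambda>_. 0) = (\<lambda>_. 0)"
  by (auto simp: conv_def algebra_simps sum.distrib sum_distrib_left intro!: ext sum.cong)

lemma conv_diff_left: "conv (\<lambda>l. a l - b l) d = (\<lambda>l. conv a d l - conv b d l)"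
  and conv_diff_right: "conv d (\<lambda>l. a l - b l) = (\<lambda>l. conv d a l - conv d b l)"
  by (auto simp: conv_def algebra_simps sum_subtractf)

lemma conv_assoc: "conv (conv a b) d = conv a (conv b d)"
proof
  fix l :: "'a list"
  let ?n = "length l"
  have "conv (conv a b) d l =
      (\<Sum>i\<le>?n. \<Sum>j\<le>i. a (take j l) * b (drop j (take i l)) * d (drop i l))"
    by (auto simp: conv_def sum_distrib_right min_def intro!: sum.cong)
  also have "\<dots> = (\<Sum>(i, j)\<in>(SIGMA i:{..?n}. {..i}). a (take j l) * b (drop j (take i l)) * d (drop i l))"
    by (simp add: sum.Sigma)
  also have "\<dots> = (\<Sum>(j, k)\<in>(SIGMA j:{..?n}. {..?n - j}).
      a (take j l) * b (drop j (take (j + k) l)) * d (drop (j + k) l))"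
    by (rule sum.reindex_bij_witness[where j = "\<lambda>(i, j). (j, i - j)" and i = "\<lambda>(j, k). (j + k, j)"]) auto
  also have "\<dots> = (\<Sum>j\<le>?n. \<Sum>k\<le>?n - j. a (take j l) * b (drop j (take (j + k) l)) * d (drop (j + k) l))"
    by (simp add: sum.Sigma)
  also have "\<dots> = conv a (conv b d) l"
    by (auto simp: conv_def sum_distrib_left drop_take add.commute mult.assoc intro!: sum.cong)
  finally show "conv (conv a b) d l = conv a (conv b d) l" .
qed

lemma conv_single_Nil_left: "conv (single []) a = a"
proof
  fix l :: "'a list"
  have "conv (single []) a l = (\<Sum>i\<le>length l. if i = 0 then a l else 0)"
    unfolding conv_def by (intro sum.cong) (auto simp: single_def)
  then show "conv (single []) a l = a l" by simp
qed

lemma conv_single_Nil_right: "conv a (single []) = a"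
proof
  fix l :: "'a list"
  have "conv a (single []) l = (\<Sum>i\<le>length l. if i = length l then a l else 0)"
    unfolding conv_def by (intro sum.cong) (auto simp: single_def)
  then show "conv a (single []) l = a l" by simp
qed

text \<open>
  If the left factor is homogeneous of degree \<open>i\<close>, only the cut after \<open>i\<close> letters contributes; on
  words shorter than \<open>i\<close>, where \<^const>\<open>take\<close> returns the whole word, both sides vanish.
\<close>

lemma conv_homogeneous:
  assumes "\<And>l. a l \<noteq> 0 \<Longrightarrow> length l = i"
  shows "conv a b = (\<lambda>l. a (take i l) * b (drop i l))"
proof
  fix l :: "'a list"
  show "conv a b l = a (take i l) * b (drop i l)"
  proof (cases "i \<le> length l")
    case True
    have "a (take k l) = 0" if "k \<le> length l" "k \<noteq> i" for k
      using assms[of "take k l"] that by auto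
    then have "conv a b l = (\<Sum>k\<le>length l. if k = i then a (take i l) * b (drop i l) else 0)"
      unfolding conv_def by (intro sum.cong) auto
    then show ?thesis using True by simp
  next
    case False
    then have "a (take k l) = 0" for k using assms[of "take k l"] by force
    then show ?thesis by (simp add: conv_def)
  qed
qed

lemma conv_single_single: "conv (single x) (single y) = single (x @ y)"
proof -
  have "conv (single x) (single y) = (\<lambda>l. single x (take (length x) l) * single y (drop (length x) l))"
    by (rule conv_homogeneous) (simp add: single_def split: if_splits)
  also have "\<dots> = single (x @ y)"
  proof
    fix l
    have "take (length x) l = x \<and> drop (length x) l = y \<longleftrightarrow> l = x @ y"
      by (metis append_eq_conv_conj)
    then show "single x (take (length x) l) * single y (drop (length x) l) = single (x @ y) l"
      by (auto simp: single_def)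
  qed
  finally show ?thesis .
qed

lemma conv_closed:
  assumes "a \<in> formal_sums S" "b \<in> formal_sums S'" and S: "\<And>x y. x \<in> S \<Longrightarrow> y \<in> S' \<Longrightarrow> x @ y \<in> S''"
  shows "conv a b \<in> formal_sums S''"
  using assms(1)
proof (induction rule: formal_sums_induct)
  case (add a c l)
  from assms(2) have "conv (single l) b \<in> formal_sums S''"
  proof (induction rule: formal_sums_induct)
    case (add b c' l')
    then show ?case using \<open>l \<in> S\<close> S
      by (auto simp: conv_add_right conv_smult_right conv_single_single
          intro!: formal_sums_add formal_sums_smult)
  qed simp
  then show ?case using add
    by (auto simp: conv_add_left conv_smult_left intro!: formal_sums_add formal_sums_smult)
qed simp

lemma push_conv:
  assumes a: "a \<in> formal_sums S" and b: "b \<in> formal_sums S'"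
  shows "push (map h) (conv a b) = conv (push (map h) a) (push (map h) b)"
  using a
proof (induction rule: formal_sums_induct)
  case (add a c l)
  have single: "push (map h) (conv (single l) b) = conv (single (map h l)) (push (map h) b)"
    using b
  proof (induction rule: formal_sums_induct)
    case (add b c' l')
    have "conv (single l) b \<in> formal_sums UNIV" by (rule conv_closed[OF _ add(1)]) auto
    then show ?case using add
      by (simp add: push_single_add[of _ S'] push_single_add[of _ UNIV] conv_add_right
          conv_smult_right conv_single_single)
  qed simp
  have in1: "conv a b \<in> formal_sums UNIV" by (rule conv_closed[OF add(1) b]) auto
  have in2: "conv (single l) b \<in> formal_sums UNIV" by (rule conv_closed[OF _ b]) auto
  show ?case
    using add single
    by (simp add: conv_add_left conv_smult_left push_single_add[of _ S] push_smult
        push_add[OF in1 formal_sums_smult[OF in2]])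
qed simp

text \<open>The free unital associative real algebra on \<open>S\<close>.\<close>

definition free_algebra :: "'v set \<Rightarrow> (real, 'v list \<Rightarrow> real) module" where
  "free_algebra S = \<lparr>carrier = formal_sums (lists S), mult = conv, one = single [],
     zero = (\<lambda>_. 0), add = (\<lambda>a b l. a l + b l), smult = (\<lambda>c a l. c * a l)\<rparr>"

lemma free_algebra_ring: "ring (free_algebra S)"
proof (rule ringI)
  show "abelian_group (free_algebra S)"
  proof (rule abelian_groupI)
    fix x assume x: "x \<in> carrier (free_algebra S)"
    show "\<exists>y\<in>carrier (free_algebra S). y \<oplus>\<^bsub>free_algebra S\<^esub> x = \<zero>\<^bsub>free_algebra S\<^esub>"
      using x formal_sums_smult[of x "lists S" "-1"]
      by (intro bexI[of _ "\<lambda>l. -1 * x l"]) (auto simp: free_algebra_def)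
  qed (use formal_sums_add in \<open>auto simp: free_algebra_def add.assoc add.commute\<close>)
  show "Group.monoid (free_algebra S)"
    by (rule monoidI)
      (auto simp: free_algebra_def conv_assoc conv_single_Nil_left conv_single_Nil_right
         intro!: conv_closed[of _ "lists S" _ "lists S"])
qed (auto simp: free_algebra_def conv_add_left conv_add_right)

text \<open>The homogeneous component of degree \<open>r\<close> of a formal sum of words.\<close>

definition component :: "nat \<Rightarrow> ('v list \<Rightarrow> real) \<Rightarrow> 'v list \<Rightarrow> real" where
  "component r a = (\<lambda>l. if length l = r then a l else 0)"

lemma words_iff: "l \<in> words W r \<longleftrightarrow> length l = r \<and> l \<in> lists (carrier W)"
  by (auto simp: words_def)

lemma component_closed:
  assumes "a \<in> formal_sums (lists (carrier W))"
  shows "component r a \<in> formal_sums (words W r)"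
proof -
  have "{l. component r a l \<noteq> 0} \<subseteq> {l. a l \<noteq> 0}" by (auto simp: component_def)
  with assms show ?thesis
    unfolding formal_sums_iff by (auto simp: component_def words_iff intro: finite_subset)
qed

lemma component_add: "component r (\<lambda>l. a l + b l) = (\<lambda>l. component r a l + component r b l)"
  and component_diff: "component r (\<lambda>l. a l - b l) = (\<lambda>l. component r a l - component r b l)"
  and component_smult: "component r (\<lambda>l. c * a l) = (\<lambda>l. c * component r a l)"
  and component_zero [simp]: "component r (\<lambda>_. 0) = (\<lambda>_. 0)"
  by (auto simp: component_def)

lemma component_single: "component r (single l) = (if length l = r then single l else (\<lambda>_. 0))"
  by (auto simp: component_def single_def)

lemma component_push:
  assumes "a \<in> formal_sums S"
  shows "component r (push (map h) a) = push (map h) (component r a)"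
  using assms
proof (induction rule: formal_sums_induct)
  case (add a c l)
  have 1: "component r a \<in> formal_sums UNIV"
    using component_closed[OF formal_sums_mono[OF _ add(1)], of "\<lparr>carrier = UNIV, \<dots> = undefined\<rparr>" r]
    by (auto intro: formal_sums_mono[of _ UNIV])
  show ?case
    using add push_single_add[OF 1, of l "map h" c]
    by (auto simp: push_single_add[of _ S] component_add component_smult component_single)
qed simp

lemma component_conv:
  "component r (conv a b) = (\<lambda>l. \<Sum>i\<le>r. conv (component i a) (component (r - i) b) l)"
proof
  fix l :: "'a list"
  have 1: "conv (component i a) (component (r - i) b) l =
     (if length l = r then a (take i l) * b (drop i l) else 0)" if "i \<le> r" for i
  proof -
    have "conv (component i a) (component (r - i) b) l = component i a (take i l) * component (r - i) b (drop i l)"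
      by (subst conv_homogeneous[of _ i]) (auto simp: component_def split: if_splits)
    then show ?thesis using that by (auto simp: component_def min_def)
  qed
  show "component r (conv a b) l = (\<Sum>i\<le>r. conv (component i a) (component (r - i) b) l)"
    using 1 by (auto simp: component_def conv_def)
qed

section \<open>Tensor powers and the tensor algebra as quotients of formal sums\<close>

text \<open>
  Closure of the carrier under the linear operations. This is the only property of a fibre that
  the ring structure of its tensor and Clifford algebras depends on; none of the vector space
  axioms is involved, since all computations take place in quotients of formal sums.
\<close>

definition closed_ops :: "(real, 'v) module \<Rightarrow> bool" where
  "closed_ops W \<longleftrightarrow> (\<forall>v\<in>carrier W. \<forall>w\<in>carrier W. v \<oplus>\<^bsub>W\<^esub> w \<in> carrier W) \<and>
     (\<forall>c. \<forall>v\<in>carrier W. c \<odot>\<^bsub>W\<^esub> v \<in> carrier W)"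

text \<open>
  The two families of multilinearity relations: additivity and homogeneity in the letter that
  follows the word \<open>xs\<close>.
\<close>

definition add_relator :: "(real, 'v) module \<Rightarrow> 'v list \<Rightarrow> 'v \<Rightarrow> 'v \<Rightarrow> 'v list \<Rightarrow> 'v list \<Rightarrow> real" where
  "add_relator W xs v w ys = (\<lambda>l. single (xs @ [v \<oplus>\<^bsub>W\<^esub> w] @ ys) l - single (xs @ [v] @ ys) l - single (xs @ [w] @ ys) l)"

definition smult_relator :: "(real, 'v) module \<Rightarrow> 'v list \<Rightarrow> real \<Rightarrow> 'v \<Rightarrow> 'v list \<Rightarrow> 'v list \<Rightarrow> real" where
  "smult_relator W xs c v ys = (\<lambda>l. single (xs @ [c \<odot>\<^bsub>W\<^esub> v] @ ys) l - c * single (xs @ [v] @ ys) l)"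

text \<open>The relators on words of length \<open>r\<close>; they span \<^const>\<open>tensor_rels\<close>.\<close>

definition tensor_gens :: "(real, 'v) module \<Rightarrow> nat \<Rightarrow> ('v list \<Rightarrow> real) set" where
  "tensor_gens W r =
     {add_relator W xs v w ys |xs v w ys. v \<in> carrier W \<and> w \<in> carrier W \<and> set xs \<subseteq> carrier W \<and>
        set ys \<subseteq> carrier W \<and> length xs + 1 + length ys = r} \<union>
     {smult_relator W xs c v ys |xs c v ys. v \<in> carrier W \<and> set xs \<subseteq> carrier W \<and>
        set ys \<subseteq> carrier W \<and> length xs + 1 + length ys = r}"

lemma tensor_gens_cases:
  assumes "g \<in> tensor_gens W r"
  obtains xs v w ys where "g = add_relator W xs v w ys" "v \<in> carrier W" "w \<in> carrier W"
      "xs \<in> lists (carrier W)" "ys \<in> lists (carrier W)" "length xs + 1 + length ys = r"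
    | xs c v ys where "g = smult_relator W xs c v ys" "v \<in> carrier W"
      "xs \<in> lists (carrier W)" "ys \<in> lists (carrier W)" "length xs + 1 + length ys = r"
  using assms unfolding tensor_gens_def lists_eq_set by blast

lemma add_relator_in:
  assumes "v \<in> carrier W" "w \<in> carrier W" "xs \<in> lists (carrier W)" "ys \<in> lists (carrier W)"
    "length xs + 1 + length ys = r"
  shows "add_relator W xs v w ys \<in> tensor_gens W r"
  using assms unfolding tensor_gens_def lists_eq_set by blast

lemma smult_relator_in:
  assumes "v \<in> carrier W" "xs \<in> lists (carrier W)" "ys \<in> lists (carrier W)"
    "length xs + 1 + length ys = r"
  shows "smult_relator W xs c v ys \<in> tensor_gens W r"
  using assms unfolding tensor_gens_def lists_eq_set by blast

lemma tensor_rels_eq_span: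
  "tensor_rels W r = LinearCombinations.module.span class_ring (free_space (words W r)) (tensor_gens W r)"
  unfolding tensor_rels_def tensor_gens_def add_relator_def smult_relator_def ..

lemma conv_add_relator_right: "conv (add_relator W xs v w ys) (single l) = add_relator W xs v w (ys @ l)"
  by (simp add: add_relator_def conv_diff_left conv_single_single)

lemma conv_smult_relator_right: "conv (smult_relator W xs c v ys) (single l) = smult_relator W xs c v (ys @ l)"
  by (simp add: smult_relator_def conv_diff_left conv_single_single conv_smult_left)

lemma conv_add_relator_left: "conv (single l) (add_relator W xs v w ys) = add_relator W (l @ xs) v w ys"
  by (simp add: add_relator_def conv_diff_right conv_single_single)

lemma conv_smult_relator_left: "conv (single l) (smult_relator W xs c v ys) = smult_relator W (l @ xs) c v ys"
  by (simp add: smult_relator_def conv_diff_right conv_single_single conv_smult_right)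

context
  fixes W :: "(real, 'v) module"
  assumes W: "closed_ops W"
begin

lemma tensor_gens_closed: "tensor_gens W r \<subseteq> formal_sums (words W r)"
proof
  fix g assume "g \<in> tensor_gens W r"
  then show "g \<in> formal_sums (words W r)"
    by (cases rule: tensor_gens_cases)
      (use W in \<open>auto simp: add_relator_def smult_relator_def closed_ops_def words_iff
        intro!: formal_sums_diff formal_sums_smult\<close>)
qed

lemma tensor_rels_submodule: "submodule class_ring (tensor_rels W r) (free_space (words W r))"
  unfolding tensor_rels_eq_span
  by (rule module.span_is_submodule[OF free_space_module tensor_gens_closed])

lemma tensor_gens_subset: "tensor_gens W r \<subseteq> tensor_rels W r"
  unfolding tensor_rels_eq_span
  by (rule module.in_own_span[OF free_space_module tensor_gens_closed])

lemma tensor_rels_least: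
  assumes "tensor_gens W r \<subseteq> N" "submodule class_ring N (free_space (words W r))"
  shows "tensor_rels W r \<subseteq> N"
  unfolding tensor_rels_eq_span
  by (rule module.span_is_subset[OF free_space_module assms])

lemma tensor_rels_closed: "a \<in> tensor_rels W r \<Longrightarrow> a \<in> formal_sums (words W r)"
  and tensor_rels_zero [simp]: "(\<lambda>_. 0) \<in> tensor_rels W r"
  and tensor_rels_add: "a \<in> tensor_rels W r \<Longrightarrow> b \<in> tensor_rels W r \<Longrightarrow> (\<lambda>l. a l + b l) \<in> tensor_rels W r"
  and tensor_rels_smult: "a \<in> tensor_rels W r \<Longrightarrow> (\<lambda>l. c * a l) \<in> tensor_rels W r"
  using tensor_rels_submodule[of r] unfolding submodule_free_space_iff by blast+

lemma tensor_rels_diff: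
  "a \<in> tensor_rels W r \<Longrightarrow> b \<in> tensor_rels W r \<Longrightarrow> (\<lambda>l. a l - b l) \<in> tensor_rels W r"
  using tensor_rels_add[of a r "\<lambda>l. -1 * b l"] tensor_rels_smult[of b r "-1"] by simp

lemma conv_words_closed:
  "a \<in> formal_sums (words W i) \<Longrightarrow> b \<in> formal_sums (words W j) \<Longrightarrow> conv a b \<in> formal_sums (words W (i + j))"
  by (erule conv_closed) (auto simp: words_iff)

text \<open>
  Over all degrees together the relations form a two-sided ideal of the free algebra: a relator
  multiplied by a word is again a relator.
\<close>

lemma tensor_rels_conv_right:
  assumes a: "a \<in> tensor_rels W i" and b: "b \<in> formal_sums (words W j)"
  shows "conv a b \<in> tensor_rels W (i + j)"
proof -
  let ?N = "{a \<in> formal_sums (words W i). conv a b \<in> tensor_rels W (i + j)}"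
  have "tensor_rels W i \<subseteq> ?N"
  proof (rule tensor_rels_least)
    show "submodule class_ring ?N (free_space (words W i))"
      unfolding submodule_free_space_iff
      by (auto simp: conv_add_left conv_smult_left formal_sums_add formal_sums_smult
          tensor_rels_add tensor_rels_smult)
    have "conv g b \<in> tensor_rels W (i + j)" if g: "g \<in> tensor_gens W i" for g
      using b
    proof (induction rule: formal_sums_induct)
      case (add b c l)
      from g have "conv g (single l) \<in> tensor_gens W (i + j)"
        by (cases rule: tensor_gens_cases)
          (use \<open>l \<in> words W j\<close> in \<open>auto simp: conv_add_relator_right conv_smult_relator_right words_iff
            intro!: add_relator_in smult_relator_in\<close>)
      then show ?case using add tensor_gens_subset
        by (auto simp: conv_add_right conv_smult_right intro!: tensor_rels_add tensor_rels_smult)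
    qed simp
    then show "tensor_gens W i \<subseteq> ?N" using tensor_gens_closed by auto
  qed
  then show ?thesis using a by blast
qed

lemma tensor_rels_conv_left:
  assumes a: "a \<in> tensor_rels W i" and b: "b \<in> formal_sums (words W j)"
  shows "conv b a \<in> tensor_rels W (j + i)"
proof -
  let ?N = "{a \<in> formal_sums (words W i). conv b a \<in> tensor_rels W (j + i)}"
  have "tensor_rels W i \<subseteq> ?N"
  proof (rule tensor_rels_least)
    show "submodule class_ring ?N (free_space (words W i))"
      unfolding submodule_free_space_iff
      by (auto simp: conv_add_right conv_smult_right formal_sums_add formal_sums_smult
          tensor_rels_add tensor_rels_smult)
    have "conv b g \<in> tensor_rels W (j + i)" if g: "g \<in> tensor_gens W i" for g
      using b
    proof (induction rule: formal_sums_induct)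
      case (add b c l)
      from g have "conv (single l) g \<in> tensor_gens W (j + i)"
        by (cases rule: tensor_gens_cases)
          (use \<open>l \<in> words W j\<close> in \<open>auto simp: conv_add_relator_left conv_smult_relator_left words_iff
            intro!: add_relator_in smult_relator_in\<close>)
      then show ?case using add tensor_gens_subset
        by (auto simp: conv_add_left conv_smult_left intro!: tensor_rels_add tensor_rels_smult)
    qed simp
    then show "tensor_gens W i \<subseteq> ?N" using tensor_gens_closed by auto
  qed
  then show ?thesis using a by blast
qed

lemma mem_tensor_class_iff: "a \<in> tensor_class W r b \<longleftrightarrow> (\<lambda>l. a l - b l) \<in> tensor_rels W r"
proof -
  have "tensor_class W r b = (\<lambda>n l. n l + b l) ` tensor_rels W r"
    by (auto simp: tensor_class_def a_r_coset_def' free_space_def)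
  moreover have "(\<lambda>l. a l - b l) = n \<longleftrightarrow> a = (\<lambda>l. n l + b l)" for n
    by (auto simp: fun_eq_iff algebra_simps)
  ultimately show ?thesis by auto
qed

lemma tensor_class_self: "a \<in> tensor_class W r a"
  by (simp add: mem_tensor_class_iff)

lemma tensor_class_eq_iff:
  "tensor_class W r a = tensor_class W r b \<longleftrightarrow> (\<lambda>l. a l - b l) \<in> tensor_rels W r"
proof
  assume "tensor_class W r a = tensor_class W r b"
  then show "(\<lambda>l. a l - b l) \<in> tensor_rels W r"
    using tensor_class_self[of a r] by (simp add: mem_tensor_class_iff)
next
  assume ab: "(\<lambda>l. a l - b l) \<in> tensor_rels W r"
  have "(\<lambda>l. x l - a l) \<in> tensor_rels W r \<longleftrightarrow> (\<lambda>l. x l - b l) \<in> tensor_rels W r" for x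
    using tensor_rels_add[OF _ ab, of "\<lambda>l. x l - a l"] tensor_rels_diff[OF _ ab, of "\<lambda>l. x l - b l"]
    by auto
  then show "tensor_class W r a = tensor_class W r b"
    by (auto simp: mem_tensor_class_iff)
qed

lemma tensor_power_carrier: "carrier (tensor_power W r) = tensor_class W r ` formal_sums (words W r)"
  by (auto simp: tensor_power_def tensor_class_def A_RCOSETS_def' Let_def)

lemma tensor_power_zero: "\<zero>\<^bsub>tensor_power W r\<^esub> = tensor_class W r (\<lambda>_. 0)"
  by (auto simp: tensor_power_def Let_def mem_tensor_class_iff)

lemma tensor_power_add:
  "tensor_class W r a \<oplus>\<^bsub>tensor_power W r\<^esub> tensor_class W r b = tensor_class W r (\<lambda>l. a l + b l)"
proof -
  have "tensor_class W r a \<oplus>\<^bsub>tensor_power W r\<^esub> tensor_class W r b =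
      {(\<lambda>l. x l + y l) |x y. x \<in> tensor_class W r a \<and> y \<in> tensor_class W r b}"
    by (auto simp: tensor_power_def Let_def set_add_def' free_space_def)
  also have "\<dots> = tensor_class W r (\<lambda>l. a l + b l)"
  proof (intro equalityI subsetI)
    fix z assume "z \<in> {(\<lambda>l. x l + y l) |x y. x \<in> tensor_class W r a \<and> y \<in> tensor_class W r b}"
    then obtain x y where z: "z = (\<lambda>l. x l + y l)" and "x \<in> tensor_class W r a" "y \<in> tensor_class W r b"
      by blast
    then show "z \<in> tensor_class W r (\<lambda>l. a l + b l)"
      using tensor_rels_add[of "\<lambda>l. x l - a l" r "\<lambda>l. y l - b l"]
      by (simp add: mem_tensor_class_iff algebra_simps)
  next
    fix z assume z: "z \<in> tensor_class W r (\<lambda>l. a l + b l)"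
    have "(\<lambda>l. z l - b l) \<in> tensor_class W r a"
      using z by (simp add: mem_tensor_class_iff algebra_simps)
    then show "z \<in> {(\<lambda>l. x l + y l) |x y. x \<in> tensor_class W r a \<and> y \<in> tensor_class W r b}"
      using tensor_class_self[of b r] by (intro CollectI exI[of _ "\<lambda>l. z l - b l"] exI[of _ b]) auto
  qed
  finally show ?thesis .
qed

lemma tensor_power_smult:
  "c \<odot>\<^bsub>tensor_power W r\<^esub> tensor_class W r a = tensor_class W r (\<lambda>l. c * a l)"
proof -
  have "c \<odot>\<^bsub>tensor_power W r\<^esub> tensor_class W r a = (\<Union>x\<in>tensor_class W r a. tensor_class W r (\<lambda>l. c * x l))"
    by (simp add: tensor_power_def Let_def quot_smult_def tensor_class_def free_space_def)
  also have "\<dots> = (\<Union>x\<in>tensor_class W r a. tensor_class W r (\<lambda>l. c * a l))"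
    using tensor_rels_smult[of _ r c]
    by (intro SUP_cong) (auto simp: tensor_class_eq_iff mem_tensor_class_iff simp flip: right_diff_distrib)
  finally show ?thesis using tensor_class_self[of a r] by auto
qed

lemma tensor_concat_class:
  assumes a: "a \<in> formal_sums (words W i)" and b: "b \<in> formal_sums (words W j)"
  shows "tensor_concat W i j (tensor_class W i a) (tensor_class W j b) = tensor_class W (i + j) (conv a b)"
proof -
  have "tensor_class W (i + j) (\<lambda>l. x (take i l) * y (drop i l)) = tensor_class W (i + j) (conv a b)"
    if x: "x \<in> tensor_class W i a" and y: "y \<in> tensor_class W j b" for x y
  proof -
    have xa: "(\<lambda>l. x l - a l) \<in> tensor_rels W i" and yb: "(\<lambda>l. y l - b l) \<in> tensor_rels W j"
      using x y by (simp_all add: mem_tensor_class_iff)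
    have x': "x \<in> formal_sums (words W i)"
      using formal_sums_add[OF tensor_rels_closed[OF xa] a] by simp
    have "(\<lambda>l. x (take i l) * y (drop i l)) = conv x y"
      using x' by (intro conv_homogeneous[symmetric]) (auto simp: formal_sums_iff words_iff)
    moreover have "(\<lambda>l. conv x y l - conv a b l) \<in> tensor_rels W (i + j)"
      using tensor_rels_add[OF tensor_rels_conv_left[OF yb x'] tensor_rels_conv_right[OF xa b]]
      by (simp add: conv_diff_left conv_diff_right)
    ultimately show ?thesis by (simp add: tensor_class_eq_iff)
  qed
  then show ?thesis
    using tensor_class_self[of a i] tensor_class_self[of b j] unfolding tensor_concat_def by auto
qed

lemma tensor_power_abelian_monoid: "abelian_monoid (tensor_power W r)"
  by (rule abelian_monoidI)
    (auto simp: tensor_power_carrier tensor_power_zero tensor_power_add algebra_simps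
      intro!: imageI formal_sums_add)

lemma tensor_power_finsum:
  assumes "finite M" "\<And>m. m \<in> M \<Longrightarrow> a m \<in> formal_sums (words W r)"
  shows "(\<Oplus>\<^bsub>tensor_power W r\<^esub>m\<in>M. tensor_class W r (a m)) = tensor_class W r (\<lambda>l. \<Sum>m\<in>M. a m l)"
proof -
  interpret abelian_monoid "tensor_power W r" by (rule tensor_power_abelian_monoid)
  show ?thesis using assms
    by (induction M rule: finite_induct)
      (simp_all add: tensor_power_zero tensor_power_add tensor_power_carrier)
qed

end

text \<open>The quotient map from the free algebra to the tensor algebra.\<close>

definition tensor_proj :: "(real, 'v) module \<Rightarrow> ('v list \<Rightarrow> real) \<Rightarrow> nat \<Rightarrow> ('v list \<Rightarrow> real) set" where
  "tensor_proj W a = (\<lambda>r. tensor_class W r (component r a))"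

abbreviation free_carrier :: "(real, 'v) module \<Rightarrow> ('v list \<Rightarrow> real) set" where
  "free_carrier W \<equiv> formal_sums (lists (carrier W))"

lemma conv_free_carrier: "a \<in> free_carrier W \<Longrightarrow> b \<in> free_carrier W \<Longrightarrow> conv a b \<in> free_carrier W"
  by (rule conv_closed) auto

context
  fixes W :: "(real, 'v) module"
  assumes W: "closed_ops W"
begin

lemma tensor_proj_closed:
  assumes "a \<in> free_carrier W"
  shows "tensor_proj W a \<in> carrier (tensor_algebra W)"
proof -
  have "{r. tensor_proj W a r \<noteq> \<zero>\<^bsub>tensor_power W r\<^esub>} \<subseteq> length ` {l. a l \<noteq> 0}"
  proof
    fix r assume "r \<in> {r. tensor_proj W a r \<noteq> \<zero>\<^bsub>tensor_power W r\<^esub>}"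
    then have "component r a \<noteq> (\<lambda>_. 0)" by (auto simp: tensor_proj_def tensor_power_zero[OF W])
    then show "r \<in> length ` {l. a l \<noteq> 0}" by (auto simp: component_def fun_eq_iff split: if_splits)
  qed
  moreover have "finite (length ` {l. a l \<noteq> 0})" using assms by (simp add: formal_sums_iff)
  ultimately have "finite {r. tensor_proj W a r \<noteq> \<zero>\<^bsub>tensor_power W r\<^esub>}"
    by (rule finite_subset)
  then show ?thesis
    using component_closed[OF assms]
    by (auto simp: tensor_algebra_def tensor_power_carrier[OF W] tensor_proj_def)
qed

lemma tensor_proj_surj:
  assumes "t \<in> carrier (tensor_algebra W)"
  obtains a where "a \<in> free_carrier W" "t = tensor_proj W a"
proof -
  let ?R = "{r. t r \<noteq> \<zero>\<^bsub>tensor_power W r\<^esub>}"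
  have fin: "finite ?R" and car: "\<And>r. t r \<in> tensor_class W r ` formal_sums (words W r)"
    using assms by (auto simp: tensor_algebra_def tensor_power_carrier[OF W])
  have "\<forall>r. \<exists>a. a \<in> formal_sums (words W r) \<and> t r = tensor_class W r a \<and> (r \<notin> ?R \<longrightarrow> a = (\<lambda>_. 0))"
  proof
    fix r
    show "\<exists>a. a \<in> formal_sums (words W r) \<and> t r = tensor_class W r a \<and> (r \<notin> ?R \<longrightarrow> a = (\<lambda>_. 0))"
      using car[of r] by (cases "r \<in> ?R") (auto simp: tensor_power_zero[OF W])
  qed
  from choice[OF this] obtain b where b: "\<And>r. b r \<in> formal_sums (words W r)"
      "\<And>r. t r = tensor_class W r (b r)" "\<And>r. r \<notin> ?R \<Longrightarrow> b r = (\<lambda>_. 0)"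
    by blast
  have b_length: "b r l = 0" if "length l \<noteq> r" for r l
    using b(1)[of r] that by (auto simp: formal_sums_iff words_iff)
  \<comment> \<open>The representatives of the nonzero components have disjoint supports.\<close>
  define a where "a = (\<lambda>l. \<Sum>r\<in>?R. b r l)"
  have "a \<in> free_carrier W" unfolding a_def
    by (rule formal_sums_sum) (rule formal_sums_mono[OF _ b(1)], auto simp: words_iff)
  moreover have "component r a = b r" for r
  proof
    fix l :: "'v list"
    have "a l = (\<Sum>r'\<in>?R. if r' = length l then b (length l) l else 0)"
      unfolding a_def by (intro sum.cong) (auto simp: b_length)
    then have "a l = b (length l) l" using fin b(3)[of "length l"] by auto
    then show "component r a l = b r l" by (auto simp: component_def b_length)
  qed
  then have "t = tensor_proj W a" by (auto simp: tensor_proj_def b(2))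
  ultimately show ?thesis ..
qed

lemma tensor_algebra_carrier: "carrier (tensor_algebra W) = tensor_proj W ` free_carrier W"
  using tensor_proj_closed by (auto elim: tensor_proj_surj)

lemma tensor_proj_add:
  "tensor_proj W a \<oplus>\<^bsub>tensor_algebra W\<^esub> tensor_proj W b = tensor_proj W (\<lambda>l. a l + b l)"
  by (simp add: tensor_algebra_def tensor_proj_def tensor_power_add[OF W] component_add)

lemma tensor_proj_smult:
  "c \<odot>\<^bsub>tensor_algebra W\<^esub> tensor_proj W a = tensor_proj W (\<lambda>l. c * a l)"
  by (simp add: tensor_algebra_def tensor_proj_def tensor_power_smult[OF W] component_smult)

lemma tensor_proj_zero: "\<zero>\<^bsub>tensor_algebra W\<^esub> = tensor_proj W (\<lambda>_. 0)"
  by (simp add: tensor_algebra_def tensor_proj_def tensor_power_zero[OF W])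

lemma tensor_proj_one: "\<one>\<^bsub>tensor_algebra W\<^esub> = tensor_proj W (single [])"
  by (rule ext) (simp add: tensor_algebra_def tensor_proj_def tensor_power_zero[OF W] component_single)

lemma degree_one_eq_tensor_proj: "degree_one W v = tensor_proj W (single [v])"
  by (rule ext) (simp add: degree_one_def tensor_proj_def tensor_power_zero[OF W] component_single)

lemma tensor_proj_mult:
  assumes a: "a \<in> free_carrier W" and b: "b \<in> free_carrier W"
  shows "tensor_proj W a \<otimes>\<^bsub>tensor_algebra W\<^esub> tensor_proj W b = tensor_proj W (conv a b)"
proof
  fix r
  interpret abelian_monoid "tensor_power W r" by (rule tensor_power_abelian_monoid[OF W])
  have conv: "conv (component i a) (component (r - i) b) \<in> formal_sums (words W r)" if "i \<le> r" for i
    using conv_words_closed[OF W component_closed[OF a] component_closed[OF b], of i "r - i"] that by simp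
  have "(tensor_proj W a \<otimes>\<^bsub>tensor_algebra W\<^esub> tensor_proj W b) r =
      (\<Oplus>\<^bsub>tensor_power W r\<^esub>i\<in>{..r}. tensor_concat W i (r - i)
        (tensor_class W i (component i a)) (tensor_class W (r - i) (component (r - i) b)))"
    by (simp add: tensor_algebra_def tensor_proj_def)
  also have "\<dots> = (\<Oplus>\<^bsub>tensor_power W r\<^esub>i\<in>{..r}. tensor_class W r (conv (component i a) (component (r - i) b)))"
    using conv
    by (intro finsum_cong')
      (auto simp: tensor_concat_class[OF W component_closed[OF a] component_closed[OF b]]
        tensor_power_carrier[OF W])
  also have "\<dots> = tensor_class W r (component r (conv a b))"
    unfolding component_conv using conv by (intro tensor_power_finsum[OF W]) auto
  finally show "(tensor_proj W a \<otimes>\<^bsub>tensor_algebra W\<^esub> tensor_proj W b) r = tensor_proj W (conv a b) r"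
    by (simp add: tensor_proj_def)
qed

text \<open>The tensor algebra is a ring because it is a homomorphic image of the free algebra.\<close>

lemma tensor_algebra_ring: "ring (tensor_algebra W)"
proof -
  interpret A: ring "free_algebra (carrier W)" by (rule free_algebra_ring)
  have "tensor_proj W \<in> Ring.ring_hom (free_algebra (carrier W)) (tensor_algebra W)"
    by (rule ring_hom_memI)
      (simp_all add: free_algebra_def tensor_proj_closed tensor_proj_mult tensor_proj_add tensor_proj_one)
  from A.ring_hom_imp_img_ring[OF this] show ?thesis
    by (simp add: free_algebra_def tensor_proj_zero[symmetric] tensor_algebra_carrier[symmetric])
qed

end

text \<open>
  The map of tensor powers induced by a linear map \<open>h\<close>, computed on any representative of a tensor,
  and the map of tensor algebras with these components.
\<close>

definition tensor_power_map ::
  "(real, 'w) module \<Rightarrow> ('v \<Rightarrow> 'w) \<Rightarrow> nat \<Rightarrow> ('v list \<Rightarrow> real) set \<Rightarrow> ('w list \<Rightarrow> real) set" where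
  "tensor_power_map W' h r A = tensor_class W' r (push (map h) (SOME a. a \<in> A))"

definition tensor_map ::
  "(real, 'w) module \<Rightarrow> ('v \<Rightarrow> 'w) \<Rightarrow> (nat \<Rightarrow> ('v list \<Rightarrow> real) set) \<Rightarrow> nat \<Rightarrow> ('w list \<Rightarrow> real) set" where
  "tensor_map W' h t = (\<lambda>r. tensor_power_map W' h r (t r))"

context
  fixes W :: "(real, 'v) module" and W' :: "(real, 'w) module" and h :: "'v \<Rightarrow> 'w"
  assumes W: "closed_ops W" and W': "closed_ops W'" and h: "h \<in> module_hom class_ring W W'"
begin

lemma module_hom_maps: "h \<in> carrier W \<rightarrow> carrier W'" "v \<in> carrier W \<Longrightarrow> h v \<in> carrier W'"
  using module_hom_closed[OF h] by auto

lemma map_words: "map h \<in> words W r \<rightarrow> words W' r" "map h \<in> lists (carrier W) \<rightarrow> lists (carrier W')"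
  using module_hom_maps by (auto simp: words_iff in_lists_conv_set)

lemma tensor_rels_push:
  assumes "a \<in> tensor_rels W r"
  shows "push (map h) a \<in> tensor_rels W' r"
proof -
  let ?N = "{a \<in> formal_sums (words W r). push (map h) a \<in> tensor_rels W' r}"
  have "tensor_rels W r \<subseteq> ?N"
  proof (rule tensor_rels_least[OF W])
    show "submodule class_ring ?N (free_space (words W r))"
      unfolding submodule_free_space_iff
      by (auto simp: push_add[of _ "words W r"] push_smult formal_sums_add formal_sums_smult
          tensor_rels_add[OF W'] tensor_rels_smult[OF W'] tensor_rels_zero[OF W'])
    have "push (map h) g \<in> tensor_gens W' r" if "g \<in> tensor_gens W r" for g
      using that
    proof (cases rule: tensor_gens_cases)
      case (1 xs v w ys)
      have s: "single l \<in> formal_sums UNIV" for l :: "'v list" by simp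
      have "push (map h) g = add_relator W' (map h xs) (h v) (h w) (map h ys)"
        using 1 module_hom_add[OF h]
        by (simp add: add_relator_def push_diff[OF formal_sums_diff[OF s s] s] push_diff[OF s s])
      then show ?thesis using 1 map_words(2) module_hom_maps by (auto intro!: add_relator_in)
    next
      case (2 xs c v ys)
      have s: "single l \<in> formal_sums UNIV" for l :: "'v list" by simp
      have "push (map h) g = smult_relator W' (map h xs) c (h v) (map h ys)"
        using 2 module_hom_smult[OF h, of c v]
        by (simp add: smult_relator_def push_diff[OF s formal_sums_smult[OF s]] push_smult)
      then show ?thesis using 2 map_words(2) module_hom_maps by (auto intro!: smult_relator_in)
    qed
    then show "tensor_gens W r \<subseteq> ?N" using tensor_gens_closed[OF W] tensor_gens_subset[OF W'] by blast
  qed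
  then show ?thesis using assms by blast
qed

lemma tensor_power_map_class:
  assumes a: "a \<in> formal_sums (words W r)"
  shows "tensor_power_map W' h r (tensor_class W r a) = tensor_class W' r (push (map h) a)"
proof -
  define b where "b = (SOME b. b \<in> tensor_class W r a)"
  have "b \<in> tensor_class W r a"
    unfolding b_def by (rule someI[of "\<lambda>b. b \<in> tensor_class W r a"]) (rule tensor_class_self[OF W])
  then have ba: "(\<lambda>l. b l - a l) \<in> tensor_rels W r" by (simp add: mem_tensor_class_iff[OF W])
  have b: "b \<in> formal_sums (words W r)"
    using formal_sums_add[OF tensor_rels_closed[OF W ba] a] by simp
  show ?thesis
    using tensor_rels_push[OF ba]
    by (simp add: tensor_power_map_def b_def[symmetric] tensor_class_eq_iff[OF W'] push_diff[OF b a])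
qed

lemma tensor_map_proj:
  assumes a: "a \<in> free_carrier W"
  shows "tensor_map W' h (tensor_proj W a) = tensor_proj W' (push (map h) a)"
  by (simp add: tensor_map_def tensor_proj_def tensor_power_map_class component_closed[OF a]
      component_push[OF a])

lemma push_free_carrier: "a \<in> free_carrier W \<Longrightarrow> push (map h) a \<in> free_carrier W'"
  by (rule push_closed[OF _ map_words(2)])

lemma tensor_map_ring_hom: "tensor_map W' h \<in> Ring.ring_hom (tensor_algebra W) (tensor_algebra W')"
proof (rule ring_hom_memI)
  fix s t assume "s \<in> carrier (tensor_algebra W)" "t \<in> carrier (tensor_algebra W)"
  then obtain a b where ab: "a \<in> free_carrier W" "s = tensor_proj W a" "b \<in> free_carrier W" "t = tensor_proj W b"
    by (meson tensor_proj_surj[OF W])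
  show "tensor_map W' h s \<in> carrier (tensor_algebra W')"
    using ab by (simp add: tensor_map_proj tensor_proj_closed[OF W'] push_free_carrier)
  show "tensor_map W' h (s \<otimes>\<^bsub>tensor_algebra W\<^esub> t) = tensor_map W' h s \<otimes>\<^bsub>tensor_algebra W'\<^esub> tensor_map W' h t"
    using ab by (simp add: tensor_map_proj tensor_proj_mult[OF W] tensor_proj_mult[OF W']
        push_free_carrier conv_free_carrier push_conv[of _ "lists (carrier W)"])
  show "tensor_map W' h (s \<oplus>\<^bsub>tensor_algebra W\<^esub> t) = tensor_map W' h s \<oplus>\<^bsub>tensor_algebra W'\<^esub> tensor_map W' h t"
    using ab by (simp add: tensor_map_proj tensor_proj_add[OF W] tensor_proj_add[OF W']
        formal_sums_add push_add[of _ "lists (carrier W)"])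
next
  show "tensor_map W' h \<one>\<^bsub>tensor_algebra W\<^esub> = \<one>\<^bsub>tensor_algebra W'\<^esub>"
    by (simp add: tensor_proj_one[OF W] tensor_proj_one[OF W'] tensor_map_proj)
qed

end

section \<open>Clifford algebras and their maps\<close>

text \<open>The quotient map from the free algebra to the Clifford algebra.\<close>

definition clifford_proj ::
  "(real, 'v) module \<Rightarrow> ('v \<Rightarrow> 'v \<Rightarrow> real) \<Rightarrow> ('v list \<Rightarrow> real) \<Rightarrow> (nat \<Rightarrow> ('v list \<Rightarrow> real) set) set" where
  "clifford_proj W Q a = clifford_class W Q (tensor_proj W a)"

text \<open>The generator \<open>v \<otimes> w + w \<otimes> v + 4 Q(v, w)\<close> of the Clifford ideal, as an element of the free algebra.\<close>

definition clifford_relator :: "('v \<Rightarrow> 'v \<Rightarrow> real) \<Rightarrow> 'v \<Rightarrow> 'v \<Rightarrow> 'v list \<Rightarrow> real" where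
  "clifford_relator Q v w = (\<lambda>l. single [v, w] l + single [w, v] l + 4 * Q v w * single [] l)"

context
  fixes W :: "(real, 'v) module" and Q :: "'v \<Rightarrow> 'v \<Rightarrow> real"
  assumes W: "closed_ops W"
begin

interpretation T: ring "tensor_algebra W" by (rule tensor_algebra_ring[OF W])

lemma clifford_relator_closed:
  assumes "v \<in> carrier W" "w \<in> carrier W"
  shows "clifford_relator Q v w \<in> free_carrier W"
  unfolding clifford_relator_def using assms
  by (intro formal_sums_add formal_sums_smult) auto

lemma clifford_ideal_eq:
  "clifford_ideal W Q = Idl\<^bsub>tensor_algebra W\<^esub>
     {tensor_proj W (clifford_relator Q v w) |v w. v \<in> carrier W \<and> w \<in> carrier W}"
proof -
  have "(degree_one W v \<otimes>\<^bsub>tensor_algebra W\<^esub> degree_one W w) \<oplus>\<^bsub>tensor_algebra W\<^esub>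
      (degree_one W w \<otimes>\<^bsub>tensor_algebra W\<^esub> degree_one W v) \<oplus>\<^bsub>tensor_algebra W\<^esub>
      ((4 * Q v w) \<odot>\<^bsub>tensor_algebra W\<^esub> \<one>\<^bsub>tensor_algebra W\<^esub>) = tensor_proj W (clifford_relator Q v w)"
    if "v \<in> carrier W" "w \<in> carrier W" for v w
    using that
    by (simp add: degree_one_eq_tensor_proj[OF W] tensor_proj_one[OF W] tensor_proj_mult[OF W]
        tensor_proj_add[OF W] tensor_proj_smult[OF W] conv_single_single clifford_relator_def)
  then show ?thesis
    unfolding clifford_ideal_def Let_def
    by (intro arg_cong[where f = "genideal (tensor_algebra W)"] Collect_cong ex_cong1) auto
qed

lemma clifford_gens_closed:
  "{tensor_proj W (clifford_relator Q v w) |v w. v \<in> carrier W \<and> w \<in> carrier W} \<subseteq> carrier (tensor_algebra W)"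
  using clifford_relator_closed tensor_proj_closed[OF W] by auto

lemma clifford_ideal_ideal: "ideal (clifford_ideal W Q) (tensor_algebra W)"
  unfolding clifford_ideal_eq by (rule T.genideal_ideal[OF clifford_gens_closed])

interpretation I: ideal "clifford_ideal W Q" "tensor_algebra W" by (rule clifford_ideal_ideal)

lemma clifford_relator_mem:
  assumes "v \<in> carrier W" "w \<in> carrier W"
  shows "tensor_proj W (clifford_relator Q v w) \<in> clifford_ideal W Q"
  using T.genideal_self[OF clifford_gens_closed] assms unfolding clifford_ideal_eq by blast

lemma clifford_ideal_least:
  assumes "ideal J (tensor_algebra W)"
    and "\<And>v w. v \<in> carrier W \<Longrightarrow> w \<in> carrier W \<Longrightarrow> tensor_proj W (clifford_relator Q v w) \<in> J"
  shows "clifford_ideal W Q \<subseteq> J"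
  unfolding clifford_ideal_eq using assms by (intro T.genideal_minimal) auto

lemma clifford_carrier: "carrier (clifford_algebra W Q) = clifford_class W Q ` carrier (tensor_algebra W)"
  by (auto simp: clifford_algebra_def Let_def FactRing_def A_RCOSETS_def' clifford_class_def)

lemma clifford_carrier_eq_proj: "carrier (clifford_algebra W Q) = clifford_proj W Q ` free_carrier W"
  by (simp add: clifford_carrier tensor_algebra_carrier[OF W] clifford_proj_def image_image)

lemma clifford_proj_eq_iff:
  assumes a: "a \<in> free_carrier W" and b: "b \<in> free_carrier W"
  shows "clifford_proj W Q a = clifford_proj W Q b \<longleftrightarrow>
     tensor_proj W (\<lambda>l. a l - b l) \<in> clifford_ideal W Q"
proof -
  have b': "(\<lambda>l. -1 * b l) \<in> free_carrier W" by (rule formal_sums_smult[OF b])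
  have "\<ominus>\<^bsub>tensor_algebra W\<^esub> tensor_proj W b = tensor_proj W (\<lambda>l. -1 * b l)"
    using b b' tensor_proj_closed[OF W]
    by (intro T.minus_equality) (auto simp: tensor_proj_add[OF W] tensor_proj_zero[OF W])
  then have "tensor_proj W a \<ominus>\<^bsub>tensor_algebra W\<^esub> tensor_proj W b = tensor_proj W (\<lambda>l. a l - b l)"
    by (simp add: a_minus_def tensor_proj_add[OF W])
  then show ?thesis
    using T.quotient_eq_iff_same_a_r_cos[OF clifford_ideal_ideal tensor_proj_closed[OF W a] tensor_proj_closed[OF W b]]
    by (simp add: clifford_proj_def clifford_class_def)
qed

lemma clifford_proj_add:
  assumes a: "a \<in> free_carrier W" and b: "b \<in> free_carrier W"
  shows "clifford_proj W Q a \<oplus>\<^bsub>clifford_algebra W Q\<^esub> clifford_proj W Q b = clifford_proj W Q (\<lambda>l. a l + b l)"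
  using I.a_rcos_sum[OF tensor_proj_closed[OF W a] tensor_proj_closed[OF W b]]
  by (simp add: clifford_algebra_def Let_def FactRing_def clifford_proj_def clifford_class_def tensor_proj_add[OF W])

lemma clifford_proj_mult:
  assumes a: "a \<in> free_carrier W" and b: "b \<in> free_carrier W"
  shows "clifford_proj W Q a \<otimes>\<^bsub>clifford_algebra W Q\<^esub> clifford_proj W Q b = clifford_proj W Q (conv a b)"
  using I.rcoset_mult_add[OF tensor_proj_closed[OF W a] tensor_proj_closed[OF W b]]
  by (simp add: clifford_algebra_def Let_def FactRing_def clifford_proj_def clifford_class_def
      tensor_proj_mult[OF W a b])

lemma clifford_proj_one: "\<one>\<^bsub>clifford_algebra W Q\<^esub> = clifford_proj W Q (single [])"
  by (simp add: clifford_algebra_def Let_def FactRing_def clifford_proj_def clifford_class_def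
      tensor_proj_one[OF W])

text \<open>
  Scalar multiplication of cosets is well defined because the ideal is stable under multiplication
  by the scalars \<open>c \<cdot> 1\<close> of the tensor algebra.
\<close>

lemma clifford_proj_smult:
  assumes a: "a \<in> free_carrier W"
  shows "c \<odot>\<^bsub>clifford_algebra W Q\<^esub> clifford_proj W Q a = clifford_proj W Q (\<lambda>l. c * a l)"
proof -
  have ca: "(\<lambda>l. c * a l) \<in> free_carrier W" by (rule formal_sums_smult[OF a])
  have "clifford_class W Q (c \<odot>\<^bsub>tensor_algebra W\<^esub> x) = clifford_proj W Q (\<lambda>l. c * a l)"
    if x: "x \<in> clifford_proj W Q a" for x
  proof -
    have "x \<in> carrier (tensor_algebra W)"
      using T.a_r_coset_subset_G[OF I.a_subset tensor_proj_closed[OF W a]] x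
      by (auto simp: clifford_proj_def clifford_class_def)
    then obtain b where b: "b \<in> free_carrier W" "x = tensor_proj W b" by (rule tensor_proj_surj[OF W])
    have "clifford_proj W Q a = clifford_proj W Q b"
      using T.a_repr_independence[OF _ tensor_proj_closed[OF W a] I.a_subgroup] x b
      by (simp add: clifford_proj_def clifford_class_def)
    then have "tensor_proj W (\<lambda>l. b l - a l) \<in> clifford_ideal W Q"
      using clifford_proj_eq_iff[OF b(1) a] by simp
    moreover have "(\<lambda>l. c * single [] l) \<in> free_carrier W"
      by (rule formal_sums_smult) simp
    moreover have "conv (\<lambda>l. c * single [] l) (\<lambda>l. b l - a l) = (\<lambda>l. c * b l - c * a l)"
      by (simp add: conv_smult_left conv_single_Nil_left algebra_simps)
    ultimately have "tensor_proj W (\<lambda>l. c * b l - c * a l) \<in> clifford_ideal W Q"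
      using I.I_l_closed[of "tensor_proj W (\<lambda>l. b l - a l)" "tensor_proj W (\<lambda>l. c * single [] l)"]
      by (simp add: tensor_proj_mult[OF W] tensor_proj_closed[OF W] formal_sums_diff[OF b(1) a])
    then have "clifford_proj W Q (\<lambda>l. c * b l) = clifford_proj W Q (\<lambda>l. c * a l)"
      by (simp add: clifford_proj_eq_iff[OF formal_sums_smult[OF b(1)] ca])
    then show ?thesis by (simp add: clifford_proj_def b(2) tensor_proj_smult[OF W])
  qed
  moreover have "tensor_proj W a \<in> clifford_proj W Q a"
    unfolding clifford_proj_def clifford_class_def by (rule I.a_rcos_self[OF tensor_proj_closed[OF W a]])
  ultimately have "(\<Union>x\<in>clifford_proj W Q a. clifford_class W Q (c \<odot>\<^bsub>tensor_algebra W\<^esub> x)) =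
      clifford_proj W Q (\<lambda>l. c * a l)" by blast
  then show ?thesis
    by (simp add: clifford_algebra_def Let_def quot_smult_def clifford_class_def)
qed

end

text \<open>
  The maps along which Clifford algebras are functorial: linear maps that respect the given forms. The
  closure conditions on both spaces are included.
\<close>

definition isometric_map ::
  "(real, 'v) module \<Rightarrow> ('v \<Rightarrow> 'v \<Rightarrow> real) \<Rightarrow> (real, 'w) module \<Rightarrow> ('w \<Rightarrow> 'w \<Rightarrow> real) \<Rightarrow> ('v \<Rightarrow> 'w) \<Rightarrow> bool" where
  "isometric_map W Q W' Q' h \<longleftrightarrow> closed_ops W \<and> closed_ops W' \<and> h \<in> module_hom class_ring W W' \<and>
     (\<forall>v\<in>carrier W. \<forall>w\<in>carrier W. Q' (h v) (h w) = Q v w)"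

text \<open>The map of Clifford algebras induced by \<open>h\<close>, computed on any representative in the free algebra.\<close>

definition clifford_map ::
  "(real, 'v) module \<Rightarrow> ('v \<Rightarrow> 'v \<Rightarrow> real) \<Rightarrow> (real, 'w) module \<Rightarrow> ('w \<Rightarrow> 'w \<Rightarrow> real) \<Rightarrow> ('v \<Rightarrow> 'w) \<Rightarrow>
   (nat \<Rightarrow> ('v list \<Rightarrow> real) set) set \<Rightarrow> (nat \<Rightarrow> ('w list \<Rightarrow> real) set) set" where
  "clifford_map W Q W' Q' h c =
     clifford_proj W' Q' (push (map h) (SOME a. a \<in> free_carrier W \<and> clifford_proj W Q a = c))"

context
  fixes W :: "(real, 'v) module" and W' :: "(real, 'w) module" and h Q Q'
  assumes iso: "isometric_map W Q W' Q' h"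
begin

lemma isometric_mapD:
  "closed_ops W" "closed_ops W'" "h \<in> module_hom class_ring W W'"
  "v \<in> carrier W \<Longrightarrow> w \<in> carrier W \<Longrightarrow> Q' (h v) (h w) = Q v w"
  using iso by (auto simp: isometric_map_def)

text \<open>The preimage of the ideal of the target is an ideal containing the generators of the ideal of the source.\<close>

lemma tensor_map_clifford_ideal:
  assumes "t \<in> clifford_ideal W Q"
  shows "tensor_map W' h t \<in> clifford_ideal W' Q'"
proof -
  note D = isometric_mapD
  interpret T: ring "tensor_algebra W" by (rule tensor_algebra_ring[OF D(1)])
  interpret T': ring "tensor_algebra W'" by (rule tensor_algebra_ring[OF D(2)])
  interpret ring_hom_ring "tensor_algebra W" "tensor_algebra W'" "tensor_map W' h"
    by (rule ring_hom_ringI2[OF T.ring_axioms T'.ring_axioms tensor_map_ring_hom[OF D(1-3)]])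
  let ?J = "{t \<in> carrier (tensor_algebra W). tensor_map W' h t \<in> clifford_ideal W' Q'}"
  have "clifford_ideal W Q \<subseteq> ?J"
  proof (rule clifford_ideal_least[OF D(1)])
    show "ideal ?J (tensor_algebra W)" by (rule ideal_vimage[OF clifford_ideal_ideal[OF D(2)]])
    fix v w assume vw: "v \<in> carrier W" "w \<in> carrier W"
    note c = clifford_relator_closed[OF D(1) vw, of Q]
    have s: "single l \<in> formal_sums UNIV" for l :: "'v list" by simp
    have "push (map h) (clifford_relator Q v w) = clifford_relator Q' (h v) (h w)"
      using D(4)[OF vw]
      by (simp add: clifford_relator_def push_add[OF formal_sums_add[OF s s] formal_sums_smult[OF s]]
          push_add[OF s s] push_smult)
    then show "tensor_proj W (clifford_relator Q v w) \<in> ?J"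
      using c clifford_relator_mem[OF D(2) module_hom_maps(2)[OF D(1-3) vw(1)] module_hom_maps(2)[OF D(1-3) vw(2)], of Q']
      by (simp add: tensor_proj_closed[OF D(1)] tensor_map_proj[OF D(1-3)])
  qed
  then show ?thesis using assms by blast
qed

lemma clifford_map_proj:
  assumes a: "a \<in> free_carrier W"
  shows "clifford_map W Q W' Q' h (clifford_proj W Q a) = clifford_proj W' Q' (push (map h) a)"
proof -
  note D = isometric_mapD
  define b where "b = (SOME b. b \<in> free_carrier W \<and> clifford_proj W Q b = clifford_proj W Q a)"
  have b: "b \<in> free_carrier W \<and> clifford_proj W Q b = clifford_proj W Q a"
    unfolding b_def by (rule someI[of _ a]) (simp add: a)
  then have "tensor_proj W (\<lambda>l. b l - a l) \<in> clifford_ideal W Q"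
    using clifford_proj_eq_iff[OF D(1)] a by blast
  from tensor_map_clifford_ideal[OF this]
  have "tensor_proj W' (\<lambda>l. push (map h) b l - push (map h) a l) \<in> clifford_ideal W' Q'"
    using a b by (simp add: tensor_map_proj[OF D(1-3)] formal_sums_diff push_diff[of _ "lists (carrier W)"])
  then show ?thesis
    using a b push_free_carrier[OF D(1-3)] clifford_proj_eq_iff[OF D(2)]
    unfolding clifford_map_def b_def[symmetric] by blast
qed

lemma clifford_map_class:
  assumes "t \<in> carrier (tensor_algebra W)"
  shows "clifford_map W Q W' Q' h (clifford_class W Q t) = clifford_class W' Q' (tensor_map W' h t)"
proof -
  obtain a where a: "a \<in> free_carrier W" "t = tensor_proj W a"
    using assms by (rule tensor_proj_surj[OF isometric_mapD(1)])
  show ?thesis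
    using clifford_map_proj[OF a(1)]
    by (simp add: a(2) clifford_proj_def tensor_map_proj[OF isometric_mapD(1-3) a(1)])
qed

lemma clifford_map_module_hom:
  "clifford_map W Q W' Q' h \<in> module_hom class_ring (clifford_algebra W Q) (clifford_algebra W' Q')"
  using push_free_carrier[OF isometric_mapD(1-3)]
  by (auto simp: module_hom_def clifford_carrier_eq_proj[OF isometric_mapD(1)]
      clifford_carrier_eq_proj[OF isometric_mapD(2)] clifford_proj_add[OF isometric_mapD(1)]
      clifford_proj_add[OF isometric_mapD(2)] clifford_proj_smult[OF isometric_mapD(1)]
      clifford_proj_smult[OF isometric_mapD(2)] clifford_map_proj formal_sums_add formal_sums_smult
      push_add[of _ "lists (carrier W)"] push_smult)

lemma clifford_map_ring_hom:
  "clifford_map W Q W' Q' h \<in> Ring.ring_hom (clifford_algebra W Q) (clifford_algebra W' Q')"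
proof (rule ring_hom_memI)
  show "clifford_map W Q W' Q' h \<one>\<^bsub>clifford_algebra W Q\<^esub> = \<one>\<^bsub>clifford_algebra W' Q'\<^esub>"
    by (simp add: clifford_proj_one[OF isometric_mapD(1)] clifford_proj_one[OF isometric_mapD(2)] clifford_map_proj)
qed (use module_hom_closed[OF clifford_map_module_hom] module_hom_add[OF clifford_map_module_hom]
    push_free_carrier[OF isometric_mapD(1-3)]
    in \<open>auto simp: clifford_carrier_eq_proj[OF isometric_mapD(1)] clifford_proj_mult[OF isometric_mapD(1)]
      clifford_proj_mult[OF isometric_mapD(2)] clifford_map_proj conv_free_carrier
      push_conv[of _ "lists (carrier W)"]\<close>)

end

lemma clifford_map_comp:
  assumes h: "isometric_map W Q W' Q' h" and h': "isometric_map W' Q' W'' Q'' h'"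
    and h'': "isometric_map W Q W'' Q'' h''" and eq: "\<And>v. v \<in> carrier W \<Longrightarrow> h' (h v) = h'' v"
    and c: "c \<in> carrier (clifford_algebra W Q)"
  shows "clifford_map W' Q' W'' Q'' h' (clifford_map W Q W' Q' h c) = clifford_map W Q W'' Q'' h'' c"
proof -
  obtain a where a: "a \<in> free_carrier W" "c = clifford_proj W Q a"
    using c by (auto simp: clifford_carrier_eq_proj[OF isometric_mapD(1)[OF h]])
  have "push (map h') (push (map h) a) = push (map h'') a"
    unfolding push_push[OF a(1)] using eq by (intro push_cong[OF a(1)]) auto
  then show ?thesis
    using a(1) push_free_carrier[OF isometric_mapD(1-3)[OF h] a(1)]
    by (simp add: a(2) clifford_map_proj[OF h] clifford_map_proj[OF h'] clifford_map_proj[OF h''])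
qed

lemma clifford_map_id:
  assumes "isometric_map W Q W Q h" "\<And>v. v \<in> carrier W \<Longrightarrow> h v = v" "c \<in> carrier (clifford_algebra W Q)"
  shows "clifford_map W Q W Q h c = c"
proof -
  obtain a where a: "a \<in> free_carrier W" "c = clifford_proj W Q a"
    using assms(3) by (auto simp: clifford_carrier_eq_proj[OF isometric_mapD(1)[OF assms(1)]])
  have "push (map h) a = a"
    using assms(2) by (intro push_id[OF a(1)]) (auto intro: map_idI)
  then show ?thesis using a by (simp add: clifford_map_proj[OF assms(1)])
qed

lemma clifford_map_bij:
  assumes h: "isometric_map W Q W' Q' h" and k: "isometric_map W' Q' W Q k"
    and kh: "\<And>v. v \<in> carrier W \<Longrightarrow> k (h v) = v" and hk: "\<And>w. w \<in> carrier W' \<Longrightarrow> h (k w) = w"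
  shows "bij_betw (clifford_map W Q W' Q' h) (carrier (clifford_algebra W Q)) (carrier (clifford_algebra W' Q'))"
proof (rule bij_betw_byWitness[where f' = "clifford_map W' Q' W Q k"])
  have id: "isometric_map W Q W Q (\<lambda>v. v)" "isometric_map W' Q' W' Q' (\<lambda>v. v)"
    using h by (auto simp: isometric_map_def module_hom_def)
  show "\<forall>c\<in>carrier (clifford_algebra W Q). clifford_map W' Q' W Q k (clifford_map W Q W' Q' h c) = c"
    using clifford_map_comp[OF h k id(1)] clifford_map_id[OF id(1)] kh by simp
  show "\<forall>c\<in>carrier (clifford_algebra W' Q'). clifford_map W Q W' Q' h (clifford_map W' Q' W Q k c) = c"
    using clifford_map_comp[OF k h id(2)] clifford_map_id[OF id(2)] hk by simp
qed (use module_hom_closed[OF clifford_map_module_hom[OF h]] module_hom_closed[OF clifford_map_module_hom[OF k]] in auto)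

text \<open>
  An algebra homomorphism out of a quotient of the free algebra is determined by its values on the letters.
\<close>

lemma algebra_hom_unique:
  assumes p: "p \<in> Ring.ring_hom (free_algebra S) C" "p \<in> module_hom class_ring (free_algebra S) C"
    and G: "G \<in> Ring.ring_hom C D" "G \<in> module_hom class_ring C D"
    and G': "G' \<in> Ring.ring_hom C D" "G' \<in> module_hom class_ring C D"
    and eq: "\<And>v. v \<in> S \<Longrightarrow> G (p (single [v])) = G' (p (single [v]))"
    and a: "a \<in> formal_sums (lists S)"
  shows "G (p a) = G' (p a)"
proof -
  have carrier: "x \<in> carrier (free_algebra S) \<longleftrightarrow> x \<in> formal_sums (lists S)" for x
    by (simp add: free_algebra_def)
  have p_closed: "p x \<in> carrier C" if "x \<in> formal_sums (lists S)" for x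
    using ring_hom_closed[OF p(1)] that by (simp add: carrier)
  have p_smult: "p (\<lambda>l. c * x l) = c \<odot>\<^bsub>C\<^esub> p x" if "x \<in> formal_sums (lists S)" for c x
    using module_hom_smult[OF p(2), of c x] that by (simp add: free_algebra_def)
  have single: "G (p (single l)) = G' (p (single l))" if "l \<in> lists S" for l
    using that
  proof (induction l)
    case Nil
    have "p (single []) = \<one>\<^bsub>C\<^esub>" using ring_hom_one[OF p(1)] by (simp add: free_algebra_def)
    then show ?case using ring_hom_one[OF G(1)] ring_hom_one[OF G'(1)] by simp
  next
    case (Cons v l)
    have "p (single (v # l)) = p (single [v]) \<otimes>\<^bsub>C\<^esub> p (single l)"
      using ring_hom_mult[OF p(1), of "single [v]" "single l"] Cons
      by (simp add: free_algebra_def conv_single_single)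
    then show ?case
      using Cons eq p_closed ring_hom_mult[OF G(1), of "p (single [v])" "p (single l)"]
        ring_hom_mult[OF G'(1), of "p (single [v])" "p (single l)"] by simp
  qed
  show ?thesis using a
  proof (induction rule: formal_sums_induct)
    case zero
    have "p (\<lambda>_. 0) = 0 \<odot>\<^bsub>C\<^esub> p (single [])" using p_smult[of "single []" 0] by simp
    then show ?case
      using module_hom_smult[OF G(2), of 0 "p (single [])"] module_hom_smult[OF G'(2), of 0 "p (single [])"]
        p_closed single[of "[]"] by simp
  next
    case (add a c l)
    have cl: "(\<lambda>x. c * single l x) \<in> formal_sums (lists S)"
      using add by (intro formal_sums_smult) simp
    have "p (\<lambda>x. a x + c * single l x) = p a \<oplus>\<^bsub>C\<^esub> (c \<odot>\<^bsub>C\<^esub> p (single l))"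
      using ring_hom_add[OF p(1), of a "\<lambda>x. c * single l x"] add cl p_smult[of "single l" c]
      by (simp add: free_algebra_def)
    moreover have "c \<odot>\<^bsub>C\<^esub> p (single l) \<in> carrier C"
      using p_closed[OF cl] p_smult[of "single l" c] add by simp
    ultimately show ?case
      using add single[of l] p_closed[of a] p_closed[of "single l"]
        module_hom_add[OF G(2), of "p a" "c \<odot>\<^bsub>C\<^esub> p (single l)"]
        module_hom_add[OF G'(2), of "p a" "c \<odot>\<^bsub>C\<^esub> p (single l)"]
        module_hom_smult[OF G(2), of c "p (single l)"] module_hom_smult[OF G'(2), of c "p (single l)"]
      by simp
  qed
qed

subsection \<open>Transport of structure\<close>

context
  fixes M :: "(real, 'a) module" and h :: "'a \<Rightarrow> 'b"
  assumes inj: "inj_on h (carrier M)"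
begin

lemma transport_carrier: "carrier (transport h M) = h ` carrier M"
  by (simp add: transport_def Let_def)

lemma transport_one: "\<one>\<^bsub>transport h M\<^esub> = h \<one>\<^bsub>M\<^esub>"
  by (simp add: transport_def Let_def)

lemma transport_add:
  "a \<in> carrier M \<Longrightarrow> b \<in> carrier M \<Longrightarrow> h a \<oplus>\<^bsub>transport h M\<^esub> h b = h (a \<oplus>\<^bsub>M\<^esub> b)"
  and transport_mult:
  "a \<in> carrier M \<Longrightarrow> b \<in> carrier M \<Longrightarrow> h a \<otimes>\<^bsub>transport h M\<^esub> h b = h (a \<otimes>\<^bsub>M\<^esub> b)"
  and transport_smult: "a \<in> carrier M \<Longrightarrow> c \<odot>\<^bsub>transport h M\<^esub> h a = h (c \<odot>\<^bsub>M\<^esub> a)"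
  using inj by (simp_all add: transport_def Let_def)

lemma transport_module_hom: "h \<in> module_hom class_ring M (transport h M)"
  by (auto simp: module_hom_def transport_carrier transport_add transport_smult)

lemma transport_ring_hom: "h \<in> Ring.ring_hom M (transport h M)"
  by (rule ring_hom_memI) (simp_all add: transport_carrier transport_add transport_mult transport_one)

lemma transport_closed_ops: "closed_ops M \<Longrightarrow> closed_ops (transport h M)"
  by (auto simp: closed_ops_def transport_carrier transport_add transport_smult)

lemma transport_inv_module_hom:
  assumes "closed_ops M"
  shows "inv_into (carrier M) h \<in> module_hom class_ring (transport h M) M"
  using assms inj
  by (auto simp: module_hom_def transport_carrier transport_add transport_smult closed_ops_def)

end

section \<open>Plots and neighbourhoods\<close>

lemma near_each_self: "openin (Euclidean_space n) U \<Longrightarrow> P U \<Longrightarrow> near_each n U P"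
  unfolding near_each_def by blast

lemma near_eachE:
  assumes "near_each n U P" "u \<in> U"
  obtains W where "openin (Euclidean_space n) W" "u \<in> W" "W \<subseteq> U" "P W"
  using assms unfolding near_each_def by blast

lemma near_each_trans:
  assumes "near_each n U P"
    and "\<And>W. openin (Euclidean_space n) W \<Longrightarrow> W \<subseteq> U \<Longrightarrow> P W \<Longrightarrow> near_each n W Q"
  shows "near_each n U Q"
  unfolding near_each_def
proof
  fix u assume "u \<in> U"
  then obtain W where W: "openin (Euclidean_space n) W" "u \<in> W" "W \<subseteq> U" "P W"
    using assms(1) unfolding near_each_def by blast
  then obtain W' where "openin (Euclidean_space n) W'" "u \<in> W'" "W' \<subseteq> W" "Q W'"
    using assms(2) unfolding near_each_def by meson
  then show "\<exists>W. openin (Euclidean_space n) W \<and> u \<in> W \<and> W \<subseteq> U \<and> Q W"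
    using W(3) by blast
qed

lemma near_each_mono:
  assumes "near_each n U P"
    and "\<And>W. openin (Euclidean_space n) W \<Longrightarrow> W \<subseteq> U \<Longrightarrow> P W \<Longrightarrow> Q W"
  shows "near_each n U Q"
  using assms(1) by (rule near_each_trans) (auto intro: near_each_self assms(2))

lemma near_each_subset:
  assumes "near_each n U P" "openin (Euclidean_space n) U'" "U' \<subseteq> U"
    and "\<And>W W'. openin (Euclidean_space n) W' \<Longrightarrow> W' \<subseteq> W \<Longrightarrow> W \<subseteq> U \<Longrightarrow> P W \<Longrightarrow> P W'"
  shows "near_each n U' P"
  unfolding near_each_def
proof
  fix u assume "u \<in> U'"
  then obtain W where W: "openin (Euclidean_space n) W" "u \<in> W" "W \<subseteq> U" "P W"
    using assms(1,3) unfolding near_each_def by blast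
  then have "openin (Euclidean_space n) (W \<inter> U')" "P (W \<inter> U')"
    using assms(2) assms(4)[of "W \<inter> U'" W] by auto
  then show "\<exists>W. openin (Euclidean_space n) W \<and> u \<in> W \<and> W \<subseteq> U' \<and> P W"
    using \<open>u \<in> U'\<close> W(2) by blast
qed

lemma common_neighbourhood:
  assumes "finite J" and "openin T U" "u \<in> U"
    and "\<And>x. x \<in> J \<Longrightarrow> \<exists>W. openin T W \<and> u \<in> W \<and> W \<subseteq> U \<and> P x W"
    and mono: "\<And>x W W'. x \<in> J \<Longrightarrow> P x W \<Longrightarrow> W \<subseteq> U \<Longrightarrow> openin T W' \<Longrightarrow> W' \<subseteq> W \<Longrightarrow> P x W'"
  shows "\<exists>W. openin T W \<and> u \<in> W \<and> W \<subseteq> U \<and> (\<forall>x\<in>J. P x W)"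
  using assms(1,4,5)
proof (induction J rule: finite_induct)
  case empty
  then show ?case using assms(2,3) by auto
next
  case (insert x J)
  have "\<exists>W. openin T W \<and> u \<in> W \<and> W \<subseteq> U \<and> (\<forall>x\<in>J. P x W)"
  proof (rule insert.IH)
    show "\<exists>W. openin T W \<and> u \<in> W \<and> W \<subseteq> U \<and> P y W" if "y \<in> J" for y
      using insert.prems(1)[of y] that by simp
    show "P y W'" if "y \<in> J" "P y W" "W \<subseteq> U" "openin T W'" "W' \<subseteq> W" for y W W'
      using insert.prems(2)[of y W W'] that by simp
  qed
  then obtain W where W: "openin T W" "u \<in> W" "W \<subseteq> U" "\<forall>x\<in>J. P x W" by blast
  obtain W' where W': "openin T W'" "u \<in> W'" "W' \<subseteq> U" "P x W'"
    using insert.prems(1)[of x] by auto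
  have "openin T (W \<inter> W')" using W(1) W'(1) by (rule openin_Int)
  moreover have "P y (W \<inter> W')" if "y \<in> insert x J" for y
  proof (cases "y = x")
    case True
    then show ?thesis using insert.prems(2)[OF _ W'(4,3) calculation] by simp
  next
    case False
    then show ?thesis using insert.prems(2)[of y W "W \<inter> W'"] W calculation that by blast
  qed
  ultimately show ?case using W W' by (intro exI[of _ "W \<inter> W'"]) auto
qed

lemma Ck_on_const: "Ck_on k n U (\<lambda>_. c)"
  by (induction k arbitrary: c) (auto intro!: exI[of _ "\<lambda>_. 0"])

lemma Ck_on_coordinate: "Ck_on k n U (\<lambda>x. x i)"
proof (cases k)
  have cont: "continuous_map (subtopology (Euclidean_space n) U) euclideanreal (\<lambda>x. x i)"
    unfolding Euclidean_space_def
    by (intro continuous_map_from_subtopology continuous_map_product_projection) simp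
  {
    case 0
    then show ?thesis using cont by simp
  next
    case (Suc k')
    have "((\<lambda>s. (x(m := s)) i) has_real_derivative (if m = i then 1 else 0)) (at (x m))" for x m
      by (cases "m = i") (auto simp: fun_upd_def)
    then show ?thesis
      using cont Ck_on_const Suc by (auto intro!: exI[of _ "\<lambda>_. if _ = i then 1 else 0"])
  }
qed

lemma Ck_on_subset: "Ck_on k n U h \<Longrightarrow> W \<subseteq> U \<Longrightarrow> Ck_on k n W h"
proof (induction k arbitrary: h)
  case 0
  then show ?case using continuous_map_from_subtopology_mono by auto
next
  case (Suc k)
  have "\<exists>h'. Ck_on k n W h' \<and> (\<forall>x\<in>W. ((\<lambda>s. h (x(i := s))) has_real_derivative h' x) (at (x i)))"
    if "i < n" for i
  proof -
    from Suc.prems(1) that obtain h' where "Ck_on k n U h'"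
      "\<forall>x\<in>U. ((\<lambda>s. h (x(i := s))) has_real_derivative h' x) (at (x i))"
      by auto
    then show ?thesis using Suc.IH[of h'] Suc.prems(2) by (intro exI[of _ h']) auto
  qed
  then show ?case
    using Suc.prems continuous_map_from_subtopology_mono by auto
qed

lemma dreal_plot_subset:
  assumes "plot dreal n U c" "openin (Euclidean_space n) W" "W \<subseteq> U"
  shows "plot dreal n W c"
  using assms by (auto simp: dreal_def smooth_fun_def intro: Ck_on_subset)

lemma diffeologyD:
  assumes "diffeology X"
  shows "plot X n U p \<Longrightarrow> openin (Euclidean_space n) U \<and> p \<in> U \<rightarrow> pts X"
    "plot X n U p \<Longrightarrow> smooth_dom_map m W n U h \<Longrightarrow> plot X m W (p \<circ> h)"
  subgoal using assms unfolding diffeology_def by (elim conjE) iprover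
  subgoal premises p
  proof -
    have "\<forall>m W n U p h. plot X n U p \<and> smooth_dom_map m W n U h \<longrightarrow> plot X m W (p \<circ> h)"
      using assms unfolding diffeology_def by (elim conjE)
    then show ?thesis using p by iprover
  qed
  done

lemma diffeology_plot:
  assumes "diffeology X" "plot X n U p"
  shows "openin (Euclidean_space n) U" "u \<in> U \<Longrightarrow> p u \<in> pts X"
  using diffeologyD(1)[OF assms] by auto

text \<open>The part of the axioms of a diffeology needed to pass to smaller neighbourhoods.\<close>

definition plots_restrict :: "'a dspace \<Rightarrow> bool" where
  "plots_restrict X \<longleftrightarrow> (\<forall>n U p W. plot X n U p \<longrightarrow> openin (Euclidean_space n) W \<longrightarrow> W \<subseteq> U \<longrightarrow> plot X n W p)"

lemma plots_restrictD:
  "plots_restrict X \<Longrightarrow> plot X n U p \<Longrightarrow> openin (Euclidean_space n) W \<Longrightarrow> W \<subseteq> U \<Longrightarrow> plot X n W p"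
  unfolding plots_restrict_def by iprover

lemma diffeology_plot_subset:
  assumes X: "diffeology X" and p: "plot X n U p" and W: "openin (Euclidean_space n) W" "W \<subseteq> U"
  shows "plot X n W p"
proof -
  have "smooth_dom_map n W n U id"
    using diffeology_plot(1)[OF X p] W
    by (auto simp: smooth_dom_map_def smooth_fun_def Ck_on_coordinate)
  then have "plot X n W (p \<circ> id)" by (rule diffeologyD(2)[OF X p])
  then show ?thesis by simp
qed

lemma diffeology_plots_restrict: "diffeology X \<Longrightarrow> plots_restrict X"
  unfolding plots_restrict_def using diffeology_plot_subset by blast

section \<open>Morphisms of pseudo-bundles and lifting of tensors\<close>

lemma pseudo_bundleD:
  assumes "pseudo_bundle E"
  shows "diffeology (base E)" "diffeology (total E)"
    "plot (total E) n U p \<Longrightarrow> plot (base E) n U (proj E \<circ> p)"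
    "v \<in> pts (total E) \<Longrightarrow> proj E v \<in> pts (base E)"
    "x \<in> pts (base E) \<Longrightarrow> carrier (fibre E x) = {v \<in> pts (total E). proj E v = x}"
    "x \<in> pts (base E) \<Longrightarrow> closed_ops (fibre E x)"
proof -
  show "closed_ops (fibre E x)" if "x \<in> pts (base E)"
  proof -
    interpret vectorspace class_ring "fibre E x" using assms that by (simp add: pseudo_bundle_def)
    show ?thesis by (simp add: closed_ops_def)
  qed
qed (use assms in \<open>auto simp: pseudo_bundle_def dsmooth_def\<close>)

lemma pseudo_bundle_restrict:
  assumes "pseudo_bundle E"
  shows "plots_restrict (base E)" "plots_restrict (total E)"
  using pseudo_bundleD(1,2)[OF assms] by (auto intro: diffeology_plots_restrict)

text \<open>A morphism of pseudo-bundles: smooth maps of base and total spaces, linear on the fibres.\<close>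

definition bundle_morphism ::
  "('x, 'v) pbundle \<Rightarrow> ('y, 'w) pbundle \<Rightarrow> ('x \<Rightarrow> 'y) \<Rightarrow> ('v \<Rightarrow> 'w) \<Rightarrow> bool" where
  "bundle_morphism E E' i j \<longleftrightarrow>
     dsmooth (base E) (base E') i \<and> dsmooth (total E) (total E') j \<and>
     (\<forall>v\<in>pts (total E). proj E' (j v) = i (proj E v)) \<and>
     (\<forall>x\<in>pts (base E). j \<in> module_hom class_ring (fibre E x) (fibre E' (i x)))"

lemma tensor_power_map_closed:
  assumes "closed_ops W" "closed_ops W'" "h \<in> module_hom class_ring W W'" "A \<in> carrier (tensor_power W r)"
  shows "tensor_power_map W' h r A \<in> carrier (tensor_power W' r)"
  using assms(4) push_closed[OF _ map_words(1)[OF assms(1-3)]]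
  by (auto simp: tensor_power_carrier[OF assms(1)] tensor_power_carrier[OF assms(2)]
      tensor_power_map_class[OF assms(1-3)])

lemma tensor_power_map_unit:
  assumes "closed_ops W" "closed_ops W'" "h \<in> module_hom class_ring W W'"
  shows "tensor_power_map W' h 0 (c \<odot>\<^bsub>tensor_power W 0\<^esub> tensor_class W 0 (single [])) =
    c \<odot>\<^bsub>tensor_power W' 0\<^esub> tensor_class W' 0 (single [])"
  using tensor_power_map_class[OF assms, of "\<lambda>l. c * single [] l" 0] formal_sums_smult[of "single []" "words W 0" c]
  by (simp add: tensor_power_smult[OF assms(1)] tensor_power_smult[OF assms(2)] push_smult words_iff)

lemma tensor_power_map_sum:
  assumes W: "closed_ops W" "closed_ops W'" "h \<in> module_hom class_ring W W'"
    and M: "finite M" and l: "\<And>m. m \<in> M \<Longrightarrow> l m \<in> words W r"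
  shows "tensor_power_map W' h r (\<Oplus>\<^bsub>tensor_power W r\<^esub>m\<in>M. tensor_class W r (single (l m))) =
    (\<Oplus>\<^bsub>tensor_power W' r\<^esub>m\<in>M. tensor_class W' r (single (map h (l m))))"
proof -
  have l': "map h (l m) \<in> words W' r" if "m \<in> M" for m
    using map_words(1)[OF W, of r] l[OF that] by auto
  show ?thesis
    using l l' M
    by (simp add: tensor_power_finsum[OF W(1)] tensor_power_finsum[OF W(2)] tensor_power_map_class[OF W]
        formal_sums_sum push_sum[of _ _ "words W r"])
qed

lemma tensor_power_sum_closed:
  assumes W: "closed_ops W" and M: "finite M" and l: "\<And>m. m \<in> M \<Longrightarrow> l m \<in> words W r"
  shows "(\<Oplus>\<^bsub>tensor_power W r\<^esub>m\<in>M. tensor_class W r (single (l m))) \<in> carrier (tensor_power W r)"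
  using l M by (simp add: tensor_power_finsum[OF W] tensor_power_carrier[OF W] formal_sums_sum)

lemma fibre_words:
  assumes E: "pseudo_bundle E" and x: "x \<in> pts (base E)"
    and \<alpha>: "\<And>i. i < r \<Longrightarrow> \<alpha> i \<in> pts (total E)" "\<And>i. i < r \<Longrightarrow> proj E (\<alpha> i) = x"
  shows "map \<alpha> [0..<r] \<in> words (fibre E x) r"
  using pseudo_bundleD(5)[OF E x] \<alpha> by (auto simp: words_def)

text \<open>
  The representation on \<open>W\<close> of a plot of the tensor power of degree \<open>r\<close>: a smooth multiple of the
  unit section if \<open>r = 0\<close>, and otherwise a finite sum of tensor products of plots over one plot of the base.
\<close>

definition tensor_plot_data ::
  "('x, 'v) pbundle \<Rightarrow> nat \<Rightarrow> nat \<Rightarrow> ((nat \<Rightarrow> real) \<Rightarrow> 'x \<times> ('v list \<Rightarrow> real) set) \<Rightarrow> (nat \<Rightarrow> real) set \<Rightarrow> bool" where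
  "tensor_plot_data E r n p W \<longleftrightarrow> plot (base E) n W (\<lambda>u. fst (p u)) \<and>
     (if r = 0 then
        \<exists>c. plot dreal n W c \<and>
          (\<forall>u\<in>W. let F = fibre E (fst (p u)) in
             snd (p u) = c u \<odot>\<^bsub>tensor_power F 0\<^esub> tensor_class F 0 (single []))
      else
        \<exists>(k::nat) \<alpha>. (\<forall>m<k. \<forall>i<r. plot (total E) n W (\<alpha> m i) \<and>
             (\<forall>u\<in>W. proj E (\<alpha> m i u) = fst (p u))) \<and>
          (\<forall>u\<in>W. let F = fibre E (fst (p u)) in
             snd (p u) = (\<Oplus>\<^bsub>tensor_power F r\<^esub>m\<in>{..<k}.
               tensor_class F r (single (map (\<lambda>i. \<alpha> m i u) [0..<r])))))"

lemma tensor_plot_data_zeroE: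
  assumes "tensor_plot_data E 0 n p W"
  obtains c where "plot dreal n W c"
    "\<And>u. u \<in> W \<Longrightarrow> snd (p u) =
       c u \<odot>\<^bsub>tensor_power (fibre E (fst (p u))) 0\<^esub> tensor_class (fibre E (fst (p u))) 0 (single [])"
  using assms unfolding tensor_plot_data_def Let_def by auto

lemma tensor_plot_dataE:
  assumes "tensor_plot_data E r n p W" "r \<noteq> 0"
  obtains k :: nat and \<alpha> where
    "\<And>m t. m < k \<Longrightarrow> t < r \<Longrightarrow> plot (total E) n W (\<alpha> m t)"
    "\<And>m t u. m < k \<Longrightarrow> t < r \<Longrightarrow> u \<in> W \<Longrightarrow> proj E (\<alpha> m t u) = fst (p u)"
    "\<And>u. u \<in> W \<Longrightarrow> snd (p u) = (\<Oplus>\<^bsub>tensor_power (fibre E (fst (p u))) r\<^esub>m\<in>{..<k}.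
       tensor_class (fibre E (fst (p u))) r (single (map (\<lambda>t. \<alpha> m t u) [0..<r])))"
proof -
  from assms have "\<exists>(k::nat) \<alpha>. (\<forall>m<k. \<forall>i<r. plot (total E) n W (\<alpha> m i) \<and>
        (\<forall>u\<in>W. proj E (\<alpha> m i u) = fst (p u))) \<and>
      (\<forall>u\<in>W. snd (p u) = (\<Oplus>\<^bsub>tensor_power (fibre E (fst (p u))) r\<^esub>m\<in>{..<k}.
         tensor_class (fibre E (fst (p u))) r (single (map (\<lambda>i. \<alpha> m i u) [0..<r]))))"
    by (simp add: tensor_plot_data_def Let_def)
  then obtain k :: nat and \<alpha> where *: "\<forall>m<k. \<forall>i<r. plot (total E) n W (\<alpha> m i) \<and> (\<forall>u\<in>W. proj E (\<alpha> m i u) = fst (p u))"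
      "\<forall>u\<in>W. snd (p u) = (\<Oplus>\<^bsub>tensor_power (fibre E (fst (p u))) r\<^esub>m\<in>{..<k}.
         tensor_class (fibre E (fst (p u))) r (single (map (\<lambda>i. \<alpha> m i u) [0..<r])))"
    by (elim exE conjE) (rule that; assumption)
  show ?thesis by (rule that[of k \<alpha>]) (use * in \<open>simp_all\<close>)
qed

lemma tensor_plot_dataI:
  fixes k :: nat
  assumes "plot (base E) n W (\<lambda>u. fst (p u))" "r \<noteq> 0"
    and "\<And>m t. m < k \<Longrightarrow> t < r \<Longrightarrow> plot (total E) n W (\<alpha> m t)"
    and "\<And>m t u. m < k \<Longrightarrow> t < r \<Longrightarrow> u \<in> W \<Longrightarrow> proj E (\<alpha> m t u) = fst (p u)"
    and "\<And>u. u \<in> W \<Longrightarrow> snd (p u) = (\<Oplus>\<^bsub>tensor_power (fibre E (fst (p u))) r\<^esub>m\<in>{..<k}.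
       tensor_class (fibre E (fst (p u))) r (single (map (\<lambda>t. \<alpha> m t u) [0..<r])))"
  shows "tensor_plot_data E r n p W"
proof -
  have "\<exists>(k::nat) \<alpha>. (\<forall>m<k. \<forall>i<r. plot (total E) n W (\<alpha> m i) \<and>
        (\<forall>u\<in>W. proj E (\<alpha> m i u) = fst (p u))) \<and>
      (\<forall>u\<in>W. snd (p u) = (\<Oplus>\<^bsub>tensor_power (fibre E (fst (p u))) r\<^esub>m\<in>{..<k}.
         tensor_class (fibre E (fst (p u))) r (single (map (\<lambda>i. \<alpha> m i u) [0..<r]))))"
    by (rule exI[of _ k], rule exI[of _ \<alpha>], intro conjI allI impI ballI)
      (use assms(3-5) in simp_all)
  then show ?thesis using assms(1,2) by (simp add: tensor_plot_data_def Let_def)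
qed

lemma tensor_power_space_plot_iff:
  "plot (tensor_power_space E r) n U p \<longleftrightarrow> openin (Euclidean_space n) U \<and>
     p \<in> U \<rightarrow> (SIGMA x:pts (base E). carrier (tensor_power (fibre E x) r)) \<and>
     near_each n U (tensor_plot_data E r n p)"
  unfolding tensor_power_space_def tensor_plot_data_def by simp

lemma tensor_plot_data_subset:
  assumes E: "plots_restrict (base E)" "plots_restrict (total E)" and W: "tensor_plot_data E r n p W"
    and W': "openin (Euclidean_space n) W'" "W' \<subseteq> W"
  shows "tensor_plot_data E r n p W'"
proof -
  note base = plots_restrictD[OF E(1) _ W']
  note total = plots_restrictD[OF E(2) _ W']
  note real = dreal_plot_subset[OF _ W']
  show ?thesis
  proof (cases "r = 0")
    case True
    with W obtain c where "plot dreal n W c" "\<And>u. u \<in> W \<Longrightarrow> snd (p u) =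
        c u \<odot>\<^bsub>tensor_power (fibre E (fst (p u))) 0\<^esub> tensor_class (fibre E (fst (p u))) 0 (single [])"
      by (auto elim: tensor_plot_data_zeroE)
    moreover have "plot (base E) n W (\<lambda>u. fst (p u))" using W by (simp add: tensor_plot_data_def)
    ultimately show ?thesis using W'(2) base real True
      unfolding tensor_plot_data_def Let_def by (auto intro!: exI[of _ c])
  next
    case False
    from W False obtain k :: nat and \<alpha> where \<alpha>:
      "\<And>m t. m < k \<Longrightarrow> t < r \<Longrightarrow> plot (total E) n W (\<alpha> m t)"
      "\<And>m t u. m < k \<Longrightarrow> t < r \<Longrightarrow> u \<in> W \<Longrightarrow> proj E (\<alpha> m t u) = fst (p u)"
      "\<And>u. u \<in> W \<Longrightarrow> snd (p u) = (\<Oplus>\<^bsub>tensor_power (fibre E (fst (p u))) r\<^esub>m\<in>{..<k}.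
         tensor_class (fibre E (fst (p u))) r (single (map (\<lambda>t. \<alpha> m t u) [0..<r])))"
      by (rule tensor_plot_dataE) blast
    show ?thesis
    proof (rule tensor_plot_dataI[OF _ False, of _ _ _ _ k \<alpha>])
      show "plot (base E) n W' (\<lambda>u. fst (p u))" using W by (intro base) (simp add: tensor_plot_data_def)
    qed (use \<alpha> W'(2) total in auto)
  qed
qed

lemma tensor_power_space_plot_subset:
  assumes E: "plots_restrict (base E)" "plots_restrict (total E)" and p: "plot (tensor_power_space E r) n U p"
    and W: "openin (Euclidean_space n) W" "W \<subseteq> U"
  shows "plot (tensor_power_space E r) n W p"
proof -
  have "near_each n W (tensor_plot_data E r n p)"
  proof (rule near_each_subset[OF _ W])
    show "near_each n U (tensor_plot_data E r n p)" using p unfolding tensor_power_space_plot_iff by blast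
  qed (rule tensor_plot_data_subset[OF E])
  then show ?thesis using p W unfolding tensor_power_space_plot_iff by blast
qed

text \<open>The representation on \<open>W\<close> of a plot of the tensor algebra: plots in degrees up to some \<open>N\<close>, zero above.\<close>

abbreviation tensor_algebra_plot_data ::
  "('x, 'v) pbundle \<Rightarrow> nat \<Rightarrow> ((nat \<Rightarrow> real) \<Rightarrow> 'x \<times> (nat \<Rightarrow> ('v list \<Rightarrow> real) set)) \<Rightarrow>
   (nat \<Rightarrow> real) set \<Rightarrow> bool" where
  "tensor_algebra_plot_data E n p W \<equiv> \<exists>N.
     (\<forall>r>N. \<forall>u\<in>W. snd (p u) r = \<zero>\<^bsub>tensor_power (fibre E (fst (p u))) r\<^esub>) \<and>
     (\<forall>r\<le>N. plot (tensor_power_space E r) n W (\<lambda>u. (fst (p u), snd (p u) r)))"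

lemma tensor_algebra_space_plot_subset:
  assumes E: "plots_restrict (base E)" "plots_restrict (total E)" and p: "plot (tensor_algebra_space E) n U p"
    and W: "openin (Euclidean_space n) W" "W \<subseteq> U"
  shows "plot (tensor_algebra_space E) n W p"
proof -
  let ?P = "tensor_algebra_plot_data E n p"
  have "near_each n U ?P" using p by (simp add: tensor_algebra_space_def)
  then have "near_each n W ?P"
  proof (rule near_each_subset[OF _ W])
    fix V V' assume V': "openin (Euclidean_space n) V'" "V' \<subseteq> V" and "?P V"
    from this(3) obtain N where "\<forall>r>N. \<forall>u\<in>V. snd (p u) r = \<zero>\<^bsub>tensor_power (fibre E (fst (p u))) r\<^esub>"
      "\<forall>r\<le>N. plot (tensor_power_space E r) n V (\<lambda>u. (fst (p u), snd (p u) r))" by blast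
    then show "?P V'" using V' tensor_power_space_plot_subset[OF E _ V']
      by (intro exI[of _ N]) (simp add: subset_iff)
  qed
  then show ?thesis using p W by (auto simp: tensor_algebra_space_def)
qed

context
  fixes E :: "('x, 'v) pbundle" and E' :: "('y, 'w) pbundle" and i j
  assumes E: "pseudo_bundle E"
    and E': "\<And>x. x \<in> pts (base E') \<Longrightarrow> closed_ops (fibre E' x)"
    and ij: "bundle_morphism E E' i j"
begin

lemma bundle_morphismD:
  "x \<in> pts (base E) \<Longrightarrow> i x \<in> pts (base E')"
  "plot (base E) n U p \<Longrightarrow> plot (base E') n U (i \<circ> p)"
  "v \<in> pts (total E) \<Longrightarrow> j v \<in> pts (total E')"
  "plot (total E) n U q \<Longrightarrow> plot (total E') n U (j \<circ> q)"
  "v \<in> pts (total E) \<Longrightarrow> proj E' (j v) = i (proj E v)"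
  using ij unfolding bundle_morphism_def dsmooth_def by auto

lemma fibre_map:
  assumes "x \<in> pts (base E)"
  shows "closed_ops (fibre E x)" "closed_ops (fibre E' (i x))"
    "j \<in> module_hom class_ring (fibre E x) (fibre E' (i x))"
  using assms ij pseudo_bundleD(6)[OF E] E' bundle_morphismD(1) unfolding bundle_morphism_def by auto

lemma tensor_power_space_push:
  assumes p: "plot (tensor_power_space E r) n U p"
  shows "plot (tensor_power_space E' r) n U
    (\<lambda>u. (i (fst (p u)), tensor_power_map (fibre E' (i (fst (p u)))) j r (snd (p u))))"
proof -
  let ?p' = "\<lambda>u. (i (fst (p u)), tensor_power_map (fibre E' (i (fst (p u)))) j r (snd (p u)))"
  have U: "openin (Euclidean_space n) U"
    and mem: "\<And>u. u \<in> U \<Longrightarrow> fst (p u) \<in> pts (base E) \<and> snd (p u) \<in> carrier (tensor_power (fibre E (fst (p u))) r)"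
    and near: "near_each n U (tensor_plot_data E r n p)"
    using p unfolding tensor_power_space_plot_iff by (auto simp: Pi_iff mem_Sigma_iff split_beta)
  have "near_each n U (tensor_plot_data E' r n ?p')"
    using near
  proof (rule near_each_mono)
    fix W assume W: "openin (Euclidean_space n) W" "W \<subseteq> U" "tensor_plot_data E r n p W"
    have "plot (base E') n W (i \<circ> (\<lambda>u. fst (p u)))"
      using W(3) by (intro bundle_morphismD) (simp add: tensor_plot_data_def)
    then have base: "plot (base E') n W (\<lambda>u. i (fst (p u)))" by (simp add: o_def)
    show "tensor_plot_data E' r n ?p' W"
    proof (cases "r = 0")
      case True
      with W(3) obtain c where "plot dreal n W c"
        "\<And>u. u \<in> W \<Longrightarrow> snd (p u) = c u \<odot>\<^bsub>tensor_power (fibre E (fst (p u))) 0\<^esub> tensor_class (fibre E (fst (p u))) 0 (single [])"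
        by (auto elim: tensor_plot_data_zeroE)
      then show ?thesis
        using True base W(2) mem
        unfolding tensor_plot_data_def Let_def
        by (auto intro!: exI[of _ c] simp: tensor_power_map_unit[OF fibre_map] subset_iff)
    next
      case False
      from W(3) False obtain k :: nat and \<alpha> where \<alpha>:
        "\<And>m t. m < k \<Longrightarrow> t < r \<Longrightarrow> plot (total E) n W (\<alpha> m t)"
        "\<And>m t u. m < k \<Longrightarrow> t < r \<Longrightarrow> u \<in> W \<Longrightarrow> proj E (\<alpha> m t u) = fst (p u)"
        "\<And>u. u \<in> W \<Longrightarrow> snd (p u) = (\<Oplus>\<^bsub>tensor_power (fibre E (fst (p u))) r\<^esub>m\<in>{..<k}.
               tensor_class (fibre E (fst (p u))) r (single (map (\<lambda>t. \<alpha> m t u) [0..<r])))"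
        by (rule tensor_plot_dataE) blast
      have pts: "\<alpha> m t u \<in> pts (total E)" if "m < k" "t < r" "u \<in> W" for m t u
        using diffeology_plot(2)[OF pseudo_bundleD(2)[OF E] \<alpha>(1)] that by blast
      have words: "map (\<lambda>t. \<alpha> m t u) [0..<r] \<in> words (fibre E (fst (p u))) r" if "m < k" "u \<in> W" for m u
        using that pts \<alpha>(2) mem W(2) by (intro fibre_words[OF E]) auto
      have "tensor_power_map (fibre E' (i (fst (p u)))) j r (snd (p u)) =
          (\<Oplus>\<^bsub>tensor_power (fibre E' (i (fst (p u)))) r\<^esub>m\<in>{..<k}.
               tensor_class (fibre E' (i (fst (p u)))) r (single (map (\<lambda>t. j (\<alpha> m t u)) [0..<r])))"
        if u: "u \<in> W" for u
      proof -
        have x: "fst (p u) \<in> pts (base E)" using u mem W(2) by blast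
        show ?thesis
          using tensor_power_map_sum[OF fibre_map[OF x], of "{..<k}" "\<lambda>m. map (\<lambda>t. \<alpha> m t u) [0..<r]" r] words u
          by (simp add: \<alpha>(3) o_def)
      qed
      moreover have "plot (total E') n W (\<lambda>u. j (\<alpha> m t u))" if "m < k" "t < r" for m t
        using bundle_morphismD(4)[OF \<alpha>(1)[OF that]] by (simp add: o_def)
      ultimately show ?thesis
        using False base bundle_morphismD(5) pts \<alpha>(2)
        by (intro tensor_plot_dataI[where k = k and \<alpha> = "\<lambda>m t u. j (\<alpha> m t u)"]) auto
    qed
  qed
  moreover have "?p' \<in> U \<rightarrow> (SIGMA x:pts (base E'). carrier (tensor_power (fibre E' x) r))"
    using mem bundle_morphismD(1) tensor_power_map_closed[OF fibre_map] by auto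
  ultimately show ?thesis using U unfolding tensor_power_space_plot_iff by blast
qed

lemma tensor_algebra_space_push:
  assumes p: "plot (tensor_algebra_space E) n U p"
  shows "plot (tensor_algebra_space E') n U
    (\<lambda>u. (i (fst (p u)), tensor_map (fibre E' (i (fst (p u)))) j (snd (p u))))"
proof -
  let ?p' = "\<lambda>u. (i (fst (p u)), tensor_map (fibre E' (i (fst (p u)))) j (snd (p u)))"
  have U: "openin (Euclidean_space n) U"
    and mem: "\<And>u. u \<in> U \<Longrightarrow> fst (p u) \<in> pts (base E) \<and> snd (p u) \<in> carrier (tensor_algebra (fibre E (fst (p u))))"
    and near: "near_each n U (tensor_algebra_plot_data E n p)"
    using p unfolding tensor_algebra_space_def by (auto simp: Pi_iff mem_Sigma_iff split_beta)
  have "near_each n U (tensor_algebra_plot_data E' n ?p')"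
    using near
  proof (rule near_each_mono, elim exE conjE, intro exI conjI allI impI ballI)
    fix W N r assume W: "W \<subseteq> U"
    {
      fix u
      assume N: "\<forall>r>N. \<forall>u\<in>W. snd (p u) r = \<zero>\<^bsub>tensor_power (fibre E (fst (p u))) r\<^esub>" "N < r" "u \<in> W"
      then have x: "fst (p u) \<in> pts (base E)" using W mem by blast
      show "snd (?p' u) r = \<zero>\<^bsub>tensor_power (fibre E' (fst (?p' u))) r\<^esub>"
        using N tensor_power_map_class[OF fibre_map[OF x], of "\<lambda>_. 0" r]
        by (simp add: tensor_map_def tensor_power_zero[OF fibre_map(1)[OF x]] tensor_power_zero[OF fibre_map(2)[OF x]])
    next
      assume "\<forall>r\<le>N. plot (tensor_power_space E r) n W (\<lambda>u. (fst (p u), snd (p u) r))" "r \<le> N"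
      then show "plot (tensor_power_space E' r) n W (\<lambda>u. (fst (?p' u), snd (?p' u) r))"
        using tensor_power_space_push[of r n W "\<lambda>u. (fst (p u), snd (p u) r)"] by (simp add: tensor_map_def)
    }
  qed
  moreover have "?p' \<in> U \<rightarrow> (SIGMA x:pts (base E'). carrier (tensor_algebra (fibre E' x)))"
    using mem bundle_morphismD(1) ring_hom_closed[OF tensor_map_ring_hom[OF fibre_map]] by auto
  ultimately show ?thesis using U unfolding tensor_algebra_space_def by simp
qed

text \<open>
  Plots of tensor powers lift along a morphism if the plots of the total space do, all of them over
  one and the same lift \<open>b\<close> of the plot of the base. Near \<open>u\<close> only finitely many factors are involved,
  so they lift on a common neighbourhood. The lift \<open>b\<close> is given separately since there may be no factor
  at all, in degree 0 or for an empty sum.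
\<close>

lemma tensor_power_space_lift:
  assumes q: "plot (tensor_power_space E' r) n U q" and u: "u \<in> U"
    and b: "plot (base E) n U b" "\<And>w. w \<in> U \<Longrightarrow> fst (q w) = i (b w)"
    and lift: "\<And>W \<alpha>. openin (Euclidean_space n) W \<Longrightarrow> u \<in> W \<Longrightarrow> W \<subseteq> U \<Longrightarrow> plot (total E') n W \<alpha> \<Longrightarrow>
      (\<And>w. w \<in> W \<Longrightarrow> proj E' (\<alpha> w) = i (b w)) \<Longrightarrow>
      \<exists>W'. openin (Euclidean_space n) W' \<and> u \<in> W' \<and> W' \<subseteq> W \<and>
        (\<exists>\<beta>. plot (total E) n W' \<beta> \<and> (\<forall>w\<in>W'. proj E (\<beta> w) = b w \<and> j (\<beta> w) = \<alpha> w))"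
  shows "\<exists>W. openin (Euclidean_space n) W \<and> u \<in> W \<and> W \<subseteq> U \<and>
    (\<exists>s. plot (tensor_power_space E r) n W (\<lambda>w. (b w, s w)) \<and>
      (\<forall>w\<in>W. snd (q w) = tensor_power_map (fibre E' (i (b w))) j r (s w)))"
proof -
  obtain W0 where W0: "openin (Euclidean_space n) W0" "u \<in> W0" "W0 \<subseteq> U" "tensor_plot_data E' r n q W0"
    using q u unfolding tensor_power_space_plot_iff near_each_def by blast
  note base_sub = diffeology_plot_subset[OF pseudo_bundleD(1)[OF E]]
  note total_sub = diffeology_plot_subset[OF pseudo_bundleD(2)[OF E]]
  have x: "b w \<in> pts (base E)" if "w \<in> U" for w
    using diffeology_plot(2)[OF pseudo_bundleD(1)[OF E] b(1) that] .
  show ?thesis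
  proof (cases "r = 0")
    case True
    with W0(4) obtain c where c: "plot dreal n W0 c"
      "\<And>w. w \<in> W0 \<Longrightarrow> snd (q w) = c w \<odot>\<^bsub>tensor_power (fibre E' (fst (q w))) 0\<^esub> tensor_class (fibre E' (fst (q w))) 0 (single [])"
      by (auto elim: tensor_plot_data_zeroE)
    define s where "s = (\<lambda>w. c w \<odot>\<^bsub>tensor_power (fibre E (b w)) 0\<^esub> tensor_class (fibre E (b w)) 0 (single []))"
    have "s w \<in> carrier (tensor_power (fibre E (b w)) 0)" if "w \<in> W0" for w
    proof -
      note F = fibre_map(1)[OF x, of w]
      have "w \<in> U" using that W0(3) by blast
      then show ?thesis
        by (auto simp: s_def tensor_power_smult[OF F] tensor_power_carrier[OF F] words_iff
            intro!: imageI formal_sums_smult)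
    qed
    moreover have "tensor_plot_data E r n (\<lambda>w. (b w, s w)) W0"
      using True c(1) base_sub[OF b(1) W0(1,3)] by (auto simp: tensor_plot_data_def s_def Let_def)
    ultimately have "plot (tensor_power_space E r) n W0 (\<lambda>w. (b w, s w))"
      using True W0(1,3) x unfolding tensor_power_space_plot_iff by (auto intro: near_each_self)
    moreover have "snd (q w) = tensor_power_map (fibre E' (i (b w))) j r (s w)" if "w \<in> W0" for w
      using that W0(3) b(2) c(2) x True by (auto simp: s_def tensor_power_map_unit[OF fibre_map])
    ultimately show ?thesis using W0 by blast
  next
    case False
    from W0(4) False obtain k :: nat and \<alpha> where \<alpha>:
      "\<And>m t. m < k \<Longrightarrow> t < r \<Longrightarrow> plot (total E') n W0 (\<alpha> m t)"
      "\<And>m t w. m < k \<Longrightarrow> t < r \<Longrightarrow> w \<in> W0 \<Longrightarrow> proj E' (\<alpha> m t w) = fst (q w)"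
      "\<And>w. w \<in> W0 \<Longrightarrow> snd (q w) = (\<Oplus>\<^bsub>tensor_power (fibre E' (fst (q w))) r\<^esub>m\<in>{..<k}.
             tensor_class (fibre E' (fst (q w))) r (single (map (\<lambda>t. \<alpha> m t w) [0..<r])))"
      by (rule tensor_plot_dataE) blast
    let ?P = "\<lambda>(m, t) W. \<exists>\<beta>. plot (total E) n W \<beta> \<and> (\<forall>w\<in>W. proj E (\<beta> w) = b w \<and> j (\<beta> w) = \<alpha> m t w)"
    have "\<exists>W. openin (Euclidean_space n) W \<and> u \<in> W \<and> W \<subseteq> W0 \<and> (\<forall>z\<in>{..<k} \<times> {..<r}. ?P z W)"
    proof (rule common_neighbourhood)
      fix z assume z: "z \<in> {..<k} \<times> {..<r}"
      show "\<exists>W. openin (Euclidean_space n) W \<and> u \<in> W \<and> W \<subseteq> W0 \<and> ?P z W"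
        using lift[OF W0(1-3) \<alpha>(1)[of "fst z" "snd z"]] z \<alpha>(2) b(2) W0(3) by (auto simp: subset_iff)
      fix W W' assume "?P z W" "openin (Euclidean_space n) W'" "W' \<subseteq> W"
      then show "?P z W'" using total_sub by (fastforce simp: split_beta)
    qed (use W0 in auto)
    then obtain W where W: "openin (Euclidean_space n) W" "u \<in> W" "W \<subseteq> W0"
      and "\<forall>z. \<exists>\<beta>. z \<in> {..<k} \<times> {..<r} \<longrightarrow> plot (total E) n W \<beta> \<and>
        (\<forall>w\<in>W. proj E (\<beta> w) = b w \<and> j (\<beta> w) = \<alpha> (fst z) (snd z) w)"
      by (auto simp: split_beta)
    from choice[OF this(4)] obtain \<beta>' where \<beta>': "\<And>z. z \<in> {..<k} \<times> {..<r} \<Longrightarrow> plot (total E) n W (\<beta>' z) \<and>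
        (\<forall>w\<in>W. proj E (\<beta>' z w) = b w \<and> j (\<beta>' z w) = \<alpha> (fst z) (snd z) w)"
      by blast
    define \<beta> where "\<beta> = (\<lambda>m t. \<beta>' (m, t))"
    have \<beta>: "plot (total E) n W (\<beta> m t)" "w \<in> W \<Longrightarrow> proj E (\<beta> m t w) = b w"
      "w \<in> W \<Longrightarrow> j (\<beta> m t w) = \<alpha> m t w" if "m < k" "t < r" for m t w
      using \<beta>'[of "(m, t)"] that by (auto simp: \<beta>_def)
    have WU: "W \<subseteq> U" using W(3) W0(3) by blast
    define s where "s = (\<lambda>w. \<Oplus>\<^bsub>tensor_power (fibre E (b w)) r\<^esub>m\<in>{..<k}.
      tensor_class (fibre E (b w)) r (single (map (\<lambda>t. \<beta> m t w) [0..<r])))"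
    have words: "map (\<lambda>t. \<beta> m t w) [0..<r] \<in> words (fibre E (b w)) r" if "m < k" "w \<in> W" for m w
      using that \<beta>(2) diffeology_plot(2)[OF pseudo_bundleD(2)[OF E] \<beta>(1)] WU
      by (intro fibre_words[OF E x]) auto
    have "s w \<in> carrier (tensor_power (fibre E (b w)) r)" if "w \<in> W" for w
      unfolding s_def using that WU words by (intro tensor_power_sum_closed[OF fibre_map(1)[OF x]]) auto
    moreover have "tensor_plot_data E r n (\<lambda>w. (b w, s w)) W"
      using False \<beta>(1,2) base_sub[OF b(1) W(1) WU]
      by (intro tensor_plot_dataI[where k = k and \<alpha> = \<beta>]) (auto simp: s_def)
    ultimately have "plot (tensor_power_space E r) n W (\<lambda>w. (b w, s w))"
      using W(1) WU x unfolding tensor_power_space_plot_iff by (auto intro: near_each_self)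
    moreover have "snd (q w) = tensor_power_map (fibre E' (i (b w))) j r (s w)" if w: "w \<in> W" for w
    proof -
      have xw: "b w \<in> pts (base E)" and bw: "fst (q w) = i (b w)" using w WU x b(2) by auto
      have "map (j \<circ> (\<lambda>t. \<beta> m t w)) [0..<r] = map (\<lambda>t. \<alpha> m t w) [0..<r]" if "m < k" for m
        using that \<beta>(3) w by simp
      then have "tensor_power_map (fibre E' (i (b w))) j r (s w) =
          (\<Oplus>\<^bsub>tensor_power (fibre E' (i (b w))) r\<^esub>m\<in>{..<k}.
             tensor_class (fibre E' (i (b w))) r (single (map j (map (\<lambda>t. \<beta> m t w) [0..<r]))))"
        unfolding s_def using words w by (intro tensor_power_map_sum[OF fibre_map[OF xw]]) auto
      also have "\<dots> = (\<Oplus>\<^bsub>tensor_power (fibre E' (i (b w))) r\<^esub>m\<in>{..<k}.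
             tensor_class (fibre E' (i (b w))) r (single (map (\<lambda>t. \<alpha> m t w) [0..<r])))"
      proof -
        interpret abelian_monoid "tensor_power (fibre E' (i (b w))) r"
          by (rule tensor_power_abelian_monoid[OF fibre_map(2)[OF xw]])
        have eq: "map j (map (\<lambda>t. \<beta> m t w) [0..<r]) = map (\<lambda>t. \<alpha> m t w) [0..<r]" if "m < k" for m
          using that \<beta>(3) w by simp
        have "map j (map (\<lambda>t. \<beta> m t w) [0..<r]) \<in> words (fibre E' (i (b w))) r" if "m < k" for m
          using map_words(1)[OF fibre_map[OF xw], of r] words[OF that w] by blast
        then show ?thesis
          by (intro finsum_cong')
            (auto simp: eq tensor_power_carrier[OF fibre_map(2)[OF xw]] simp del: map_map)
      qed
      finally show ?thesis using \<alpha>(3)[of w] w W(3) bw by auto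
    qed
    ultimately show ?thesis using W(1,2) WU by blast
  qed
qed

text \<open>
  The same for tensor algebras: near \<open>u\<close> only the components of degree at most some \<open>N\<close> matter, and the
  lift is set to zero in the higher degrees.
\<close>

lemma tensor_algebra_space_lift:
  assumes q: "plot (tensor_algebra_space E') n U q" and u: "u \<in> U"
    and b: "plot (base E) n U b" "\<And>w. w \<in> U \<Longrightarrow> fst (q w) = i (b w)"
    and lift: "\<And>W \<alpha>. openin (Euclidean_space n) W \<Longrightarrow> u \<in> W \<Longrightarrow> W \<subseteq> U \<Longrightarrow> plot (total E') n W \<alpha> \<Longrightarrow>
      (\<And>w. w \<in> W \<Longrightarrow> proj E' (\<alpha> w) = i (b w)) \<Longrightarrow>
      \<exists>W'. openin (Euclidean_space n) W' \<and> u \<in> W' \<and> W' \<subseteq> W \<and>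
        (\<exists>\<beta>. plot (total E) n W' \<beta> \<and> (\<forall>w\<in>W'. proj E (\<beta> w) = b w \<and> j (\<beta> w) = \<alpha> w))"
  shows "\<exists>W. openin (Euclidean_space n) W \<and> u \<in> W \<and> W \<subseteq> U \<and>
    (\<exists>t. plot (tensor_algebra_space E) n W t \<and>
      (\<forall>w\<in>W. q w = (i (fst (t w)), tensor_map (fibre E' (i (fst (t w)))) j (snd (t w)))))"
proof -
  have "near_each n U (tensor_algebra_plot_data E' n q)"
    using q unfolding tensor_algebra_space_def by simp
  then obtain W0 where W0: "openin (Euclidean_space n) W0" "u \<in> W0" "W0 \<subseteq> U"
    and "\<exists>N. (\<forall>r>N. \<forall>u\<in>W0. snd (q u) r = \<zero>\<^bsub>tensor_power (fibre E' (fst (q u))) r\<^esub>) \<and>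
          (\<forall>r\<le>N. plot (tensor_power_space E' r) n W0 (\<lambda>u. (fst (q u), snd (q u) r)))"
    by (elim near_eachE[OF _ u])
  from this(4) obtain N where N: "\<And>r w. N < r \<Longrightarrow> w \<in> W0 \<Longrightarrow> snd (q w) r = \<zero>\<^bsub>tensor_power (fibre E' (fst (q w))) r\<^esub>"
      "\<And>r. r \<le> N \<Longrightarrow> plot (tensor_power_space E' r) n W0 (\<lambda>u. (fst (q u), snd (q u) r))"
    by blast
  have x: "b w \<in> pts (base E)" if "w \<in> U" for w
    using diffeology_plot(2)[OF pseudo_bundleD(1)[OF E] b(1) that] .
  let ?P = "\<lambda>r W. \<exists>s. plot (tensor_power_space E r) n W (\<lambda>w. (b w, s w)) \<and>
      (\<forall>w\<in>W. snd (q w) r = tensor_power_map (fibre E' (i (b w))) j r (s w))"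
  have "\<exists>W. openin (Euclidean_space n) W \<and> u \<in> W \<and> W \<subseteq> W0 \<and> (\<forall>r\<in>{..N}. ?P r W)"
  proof (rule common_neighbourhood)
    fix r assume r: "r \<in> {..N}"
    have "\<exists>W. openin (Euclidean_space n) W \<and> u \<in> W \<and> W \<subseteq> W0 \<and>
      (\<exists>s. plot (tensor_power_space E r) n W (\<lambda>w. (b w, s w)) \<and>
        (\<forall>w\<in>W. snd (fst (q w), snd (q w) r) = tensor_power_map (fibre E' (i (b w))) j r (s w)))"
    proof (rule tensor_power_space_lift[OF N(2) W0(2)])
      show "plot (base E) n W0 b" by (rule diffeology_plot_subset[OF pseudo_bundleD(1)[OF E] b(1) W0(1,3)])
    qed (use r W0(3) b(2) lift in auto)
    then show "\<exists>W. openin (Euclidean_space n) W \<and> u \<in> W \<and> W \<subseteq> W0 \<and> ?P r W" by simp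
    fix W W' assume "?P r W" "openin (Euclidean_space n) W'" "W' \<subseteq> W"
    then show "?P r W'" 
      using tensor_power_space_plot_subset[OF pseudo_bundle_restrict[OF E]] by (meson subset_iff)
  qed (use W0 in auto)
  then obtain W where W: "openin (Euclidean_space n) W" "u \<in> W" "W \<subseteq> W0"
    and "\<forall>r. \<exists>s. r \<le> N \<longrightarrow> plot (tensor_power_space E r) n W (\<lambda>w. (b w, s w)) \<and>
      (\<forall>w\<in>W. snd (q w) r = tensor_power_map (fibre E' (i (b w))) j r (s w))"
    by auto
  from choice[OF this(4)] obtain s where s:
      "\<And>r. r \<le> N \<Longrightarrow> plot (tensor_power_space E r) n W (\<lambda>w. (b w, s r w))"
      "\<And>r w. r \<le> N \<Longrightarrow> w \<in> W \<Longrightarrow> snd (q w) r = tensor_power_map (fibre E' (i (b w))) j r (s r w)"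
    by blast
  have WU: "W \<subseteq> U" using W(3) W0(3) by blast
  define t where "t = (\<lambda>w. (b w, \<lambda>r. if r \<le> N then s r w else \<zero>\<^bsub>tensor_power (fibre E (b w)) r\<^esub>))"
  have "snd (t w) \<in> carrier (tensor_algebra (fibre E (b w)))" if w: "w \<in> W" for w
  proof -
    have F: "closed_ops (fibre E (b w))" using fibre_map(1)[OF x] w WU by blast
    have "s r w \<in> carrier (tensor_power (fibre E (b w)) r)" if "r \<le> N" for r
      using s(1)[OF that] w unfolding tensor_power_space_plot_iff by auto
    moreover have "\<zero>\<^bsub>tensor_power (fibre E (b w)) r\<^esub> \<in> carrier (tensor_power (fibre E (b w)) r)" for r
      by (simp add: tensor_power_zero[OF F] tensor_power_carrier[OF F])
    moreover have "{r. snd (t w) r \<noteq> \<zero>\<^bsub>tensor_power (fibre E (b w)) r\<^esub>} \<subseteq> {..N}"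
      by (auto simp: t_def)
    ultimately show ?thesis
      by (auto simp: t_def tensor_algebra_def intro: finite_subset)
  qed
  then have "t \<in> W \<rightarrow> (SIGMA x:pts (base E). carrier (tensor_algebra (fibre E x)))"
    using x WU by (auto simp: t_def)
  moreover have "near_each n W (tensor_algebra_plot_data E n t)"
    using s(1) by (intro near_each_self[OF W(1)] exI[of _ N]) (auto simp: t_def)
  ultimately have "plot (tensor_algebra_space E) n W t"
    using W(1) unfolding tensor_algebra_space_def by simp
  moreover have "q w = (i (fst (t w)), tensor_map (fibre E' (i (fst (t w)))) j (snd (t w)))" if w: "w \<in> W" for w
  proof -
    have xw: "b w \<in> pts (base E)" and bw: "fst (q w) = i (b w)" using w WU x b(2) by auto
    have "snd (q w) r = tensor_map (fibre E' (i (b w))) j (snd (t w)) r" for r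
    proof (cases "r \<le> N")
      case True
      then show ?thesis using s(2) w by (simp add: t_def tensor_map_def)
    next
      case False
      then show ?thesis
        using N(1)[of r w] w W(3) bw tensor_power_map_class[OF fibre_map[OF xw], of "\<lambda>_. 0" r]
        by (auto simp: t_def tensor_map_def tensor_power_zero[OF fibre_map(1)[OF xw]]
            tensor_power_zero[OF fibre_map(2)[OF xw]])
    qed
    then show ?thesis using bw by (simp add: t_def prod_eq_iff fun_eq_iff)
  qed
  ultimately show ?thesis using W(1,2) WU by blast
qed

end

section \<open>Gluing of diffeological spaces\<close>

text \<open>
  The normal form of a point of the disjoint union: points of the glued part are moved to the
  second space. Two points are identified by the gluing exactly when their normal forms agree.
\<close>

definition glue_normal :: "'a set \<Rightarrow> ('a \<Rightarrow> 'b) \<Rightarrow> 'a + 'b \<Rightarrow> 'a + 'b" where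
  "glue_normal A f z = (case z of Inl a \<Rightarrow> if a \<in> A then Inr (f a) else Inl a | Inr b \<Rightarrow> Inr b)"

text \<open>
  The map out of a glued space given by a map on each piece, evaluated on some element of the class; it
  does not depend on the choice when the two maps agree on identified points.
\<close>

definition glue_case :: "('a \<Rightarrow> 'c) \<Rightarrow> ('b \<Rightarrow> 'c) \<Rightarrow> ('a + 'b) set \<Rightarrow> 'c" where
  "glue_case u1 u2 c = (case SOME z. z \<in> c of Inl a \<Rightarrow> u1 a | Inr b \<Rightarrow> u2 b)"

context
  fixes X1 :: "'a dspace" and X2 :: "'b dspace" and A :: "'a set" and f :: "'a \<Rightarrow> 'b"
  assumes A: "A \<subseteq> pts X1" and f: "f ` A \<subseteq> pts X2"
begin

lemma glue_rel_eq:
  "glue_rel X1 X2 A f = {(z, z'). z \<in> pts X1 <+> pts X2 \<and> z' \<in> pts X1 <+> pts X2 \<and>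
     glue_normal A f z = glue_normal A f z'}" (is "_ = ?R")
proof
  have "equiv (pts X1 <+> pts X2) ?R"
    by (rule equivI) (auto simp: refl_on_def sym_def trans_def)
  then show "glue_rel X1 X2 A f \<subseteq> ?R"
    using A f unfolding glue_rel_def by (intro Inter_lower) (auto simp: glue_normal_def)
next
  have "?R \<subseteq> R" if R: "equiv (pts X1 <+> pts X2) R" and y: "\<forall>y\<in>A. (Inl y, Inr (f y)) \<in> R" for R
  proof
    have normal: "(z, glue_normal A f z) \<in> R" if "z \<in> pts X1 <+> pts X2" for z
      using that y equiv_class_self[OF R that] by (auto simp: glue_normal_def split: sum.split)
    fix p assume "p \<in> ?R"
    then obtain z z' where p: "p = (z, z')" and z: "z \<in> pts X1 <+> pts X2" "z' \<in> pts X1 <+> pts X2"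
        "glue_normal A f z = glue_normal A f z'"
      by blast
    show "p \<in> R"
      unfolding p using normal[OF z(1)] normal[OF z(2)] R
      by (metis equivE symD transD z(3))
  qed
  then show "?R \<subseteq> glue_rel X1 X2 A f" unfolding glue_rel_def by blast
qed

lemma glue_class_iff:
  assumes "z \<in> pts X1 <+> pts X2" "z' \<in> pts X1 <+> pts X2"
  shows "glue_rel X1 X2 A f `` {z} = glue_rel X1 X2 A f `` {z'} \<longleftrightarrow> glue_normal A f z = glue_normal A f z'"
  using assms unfolding glue_rel_eq by auto

lemma glue_in1_eq_in1_iff:
  "a \<in> pts X1 \<Longrightarrow> a' \<in> pts X1 \<Longrightarrow> glue_in1 X1 X2 A f a = glue_in1 X1 X2 A f a' \<longleftrightarrow>
     a = a' \<or> a \<in> A \<and> a' \<in> A \<and> f a = f a'"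
  and glue_in2_eq_in2_iff:
  "b \<in> pts X2 \<Longrightarrow> b' \<in> pts X2 \<Longrightarrow> glue_in2 X1 X2 A f b = glue_in2 X1 X2 A f b' \<longleftrightarrow> b = b'"
  and glue_in1_eq_in2_iff:
  "a \<in> pts X1 \<Longrightarrow> b \<in> pts X2 \<Longrightarrow> glue_in1 X1 X2 A f a = glue_in2 X1 X2 A f b \<longleftrightarrow> a \<in> A \<and> f a = b"
  unfolding glue_in1_def glue_in2_def
  by (auto simp: glue_class_iff[OF InlI InlI] glue_class_iff[OF InrI InrI] glue_class_iff[OF InlI InrI]
      glue_normal_def simp del: Image_singleton_iff)

lemma glue_pts: "pts (glue X1 X2 A f) = glue_in1 X1 X2 A f ` pts X1 \<union> glue_in2 X1 X2 A f ` pts X2"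
  by (auto simp: glue_def pushforward_def dsum_def glue_in1_def glue_in2_def Plus_def image_image image_Un)

lemma glue_pts_cases:
  assumes "c \<in> pts (glue X1 X2 A f)"
  obtains a where "a \<in> pts X1 - A" "c = glue_in1 X1 X2 A f a" | b where "b \<in> pts X2" "c = glue_in2 X1 X2 A f b"
proof -
  from assms consider a where "a \<in> pts X1" "c = glue_in1 X1 X2 A f a" | b where "b \<in> pts X2" "c = glue_in2 X1 X2 A f b"
    unfolding glue_pts by blast
  then show ?thesis
  proof cases
    case (1 a)
    show ?thesis
    proof (cases "a \<in> A")
      case True
      then have "f a \<in> pts X2" "c = glue_in2 X1 X2 A f (f a)"
        using 1 f glue_in1_eq_in2_iff by auto
      then show ?thesis by (rule that(2))
    next
      case False
      with 1 show ?thesis by (auto intro: that(1))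
    qed
  next
    case (2 b)
    then show ?thesis by (rule that(2))
  qed
qed

context
  fixes u1 :: "'a \<Rightarrow> 'c" and u2 :: "'b \<Rightarrow> 'c"
  assumes u: "\<And>a. a \<in> A \<Longrightarrow> u1 a = u2 (f a)"
begin

lemma glue_case_class:
  assumes z: "z \<in> pts X1 <+> pts X2"
  shows "glue_case u1 u2 (glue_rel X1 X2 A f `` {z}) = case_sum u1 u2 z"
proof -
  let ?c = "glue_rel X1 X2 A f `` {z}"
  define s where "s = (SOME z'. z' \<in> ?c)"
  have "s \<in> ?c"
    unfolding s_def by (rule someI[of _ z]) (use z in \<open>simp add: glue_rel_eq\<close>)
  then have *: "glue_normal A f s = glue_normal A f z"
    by (simp add: glue_rel_eq)
  have normal: "case_sum u1 u2 (glue_normal A f z') = case_sum u1 u2 z'" for z'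
    using u by (auto simp: glue_normal_def split: sum.split)
  show ?thesis
    using arg_cong[OF *, of "case_sum u1 u2"] unfolding normal glue_case_def s_def .
qed

lemma glue_case_in1: "a \<in> pts X1 \<Longrightarrow> glue_case u1 u2 (glue_in1 X1 X2 A f a) = u1 a"
  and glue_case_in2: "b \<in> pts X2 \<Longrightarrow> glue_case u1 u2 (glue_in2 X1 X2 A f b) = u2 b"
  using glue_case_class[of "Inl a"] glue_case_class[of "Inr b"] by (auto simp: glue_in1_def glue_in2_def)

end

end

lemma glue_plotE:
  assumes "plot (glue X1 X2 A f) n U p" "u \<in> U"
  obtains (left) W q where "openin (Euclidean_space n) W" "u \<in> W" "W \<subseteq> U" "plot X1 n W q"
      "\<And>w. w \<in> W \<Longrightarrow> p w = glue_in1 X1 X2 A f (q w)"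
    | (right) W q where "openin (Euclidean_space n) W" "u \<in> W" "W \<subseteq> U" "plot X2 n W q"
      "\<And>w. w \<in> W \<Longrightarrow> p w = glue_in2 X1 X2 A f (q w)"
proof -
  have "near_each n U (\<lambda>W. \<exists>q. plot (dsum X1 X2) n W q \<and> (\<forall>w\<in>W. p w = glue_rel X1 X2 A f `` {q w}))"
    using assms(1) by (simp add: glue_def pushforward_def)
  then obtain W where W: "openin (Euclidean_space n) W" "u \<in> W" "W \<subseteq> U"
    and "\<exists>q. plot (dsum X1 X2) n W q \<and> (\<forall>w\<in>W. p w = glue_rel X1 X2 A f `` {q w})"
    by (elim near_eachE[OF _ assms(2)])
  then obtain q where q: "plot (dsum X1 X2) n W q" "\<And>w. w \<in> W \<Longrightarrow> p w = glue_rel X1 X2 A f `` {q w}"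
    by blast
  have "near_each n W (\<lambda>W. (\<exists>q'. plot X1 n W q' \<and> (\<forall>w\<in>W. q w = Inl (q' w))) \<or>
       (\<exists>q'. plot X2 n W q' \<and> (\<forall>w\<in>W. q w = Inr (q' w))))"
    using q(1) by (simp add: dsum_def)
  then obtain W' where W': "openin (Euclidean_space n) W'" "u \<in> W'" "W' \<subseteq> W"
    and "(\<exists>q'. plot X1 n W' q' \<and> (\<forall>w\<in>W'. q w = Inl (q' w))) \<or>
       (\<exists>q'. plot X2 n W' q' \<and> (\<forall>w\<in>W'. q w = Inr (q' w)))"
    by (elim near_eachE[OF _ W(2)])
  from this(4) show ?thesis
  proof (elim disjE exE conjE)
    fix q' assume "plot X1 n W' q'" "\<forall>w\<in>W'. q w = Inl (q' w)"
    then show ?thesis using q(2) W' W(3) by (intro left[of W' q']) (auto simp: glue_in1_def)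
  next
    fix q' assume "plot X2 n W' q'" "\<forall>w\<in>W'. q w = Inr (q' w)"
    then show ?thesis using q(2) W' W(3) by (intro right[of W' q']) (auto simp: glue_in2_def)
  qed
qed

lemma glue_plotI:
  assumes U: "openin (Euclidean_space n) U"
    and local: "\<And>u. u \<in> U \<Longrightarrow> \<exists>W. openin (Euclidean_space n) W \<and> u \<in> W \<and> W \<subseteq> U \<and>
      ((\<exists>q. plot X1 n W q \<and> (\<forall>w\<in>W. p w = glue_in1 X1 X2 A f (q w))) \<or>
       (\<exists>q. plot X2 n W q \<and> (\<forall>w\<in>W. p w = glue_in2 X1 X2 A f (q w))))"
  shows "plot (glue X1 X2 A f) n U p"
proof -
  have dsum: "plot (dsum X1 X2) n W (\<lambda>w. Inl (q w))" if "openin (Euclidean_space n) W" "plot X1 n W q" for W q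
    using that by (auto simp: dsum_def intro!: near_each_self)
  have dsum': "plot (dsum X1 X2) n W (\<lambda>w. Inr (q w))" if "openin (Euclidean_space n) W" "plot X2 n W q" for W q
    using that by (auto simp: dsum_def intro!: near_each_self)
  have "near_each n U (\<lambda>W. \<exists>q. plot (dsum X1 X2) n W q \<and> (\<forall>w\<in>W. p w = glue_rel X1 X2 A f `` {q w}))"
    unfolding near_each_def
  proof
    fix u assume "u \<in> U"
    from local[OF this] obtain W where W: "openin (Euclidean_space n) W" "u \<in> W" "W \<subseteq> U"
      and "(\<exists>q. plot X1 n W q \<and> (\<forall>w\<in>W. p w = glue_in1 X1 X2 A f (q w))) \<or>
       (\<exists>q. plot X2 n W q \<and> (\<forall>w\<in>W. p w = glue_in2 X1 X2 A f (q w)))"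
      by blast
    from this(4) have "\<exists>q. plot (dsum X1 X2) n W q \<and> (\<forall>w\<in>W. p w = glue_rel X1 X2 A f `` {q w})"
      using dsum[OF W(1)] dsum'[OF W(1)] unfolding glue_in1_def glue_in2_def by (elim disjE exE conjE) blast+
    then show "\<exists>W. openin (Euclidean_space n) W \<and> u \<in> W \<and> W \<subseteq> U \<and>
        (\<exists>q. plot (dsum X1 X2) n W q \<and> (\<forall>w\<in>W. p w = glue_rel X1 X2 A f `` {q w}))"
      using W by blast
  qed
  then show ?thesis using U by (simp add: glue_def pushforward_def)
qed

lemma glue_in1_plot: "openin (Euclidean_space n) U \<Longrightarrow> plot X1 n U q \<Longrightarrow> plot (glue X1 X2 A f) n U (glue_in1 X1 X2 A f \<circ> q)"
  and glue_in2_plot: "openin (Euclidean_space n) U \<Longrightarrow> plot X2 n U q' \<Longrightarrow> plot (glue X1 X2 A f) n U (glue_in2 X1 X2 A f \<circ> q')"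
  by (rule glue_plotI; fastforce)+

lemma glue_in1_smooth: "diffeology X1 \<Longrightarrow> A \<subseteq> pts X1 \<Longrightarrow> f ` A \<subseteq> pts X2 \<Longrightarrow>
    dsmooth X1 (glue X1 X2 A f) (glue_in1 X1 X2 A f)"
  unfolding dsmooth_def by (auto simp: glue_pts intro: glue_in1_plot diffeology_plot(1))

lemma glue_in2_smooth: "diffeology X2 \<Longrightarrow> A \<subseteq> pts X1 \<Longrightarrow> f ` A \<subseteq> pts X2 \<Longrightarrow>
    dsmooth X2 (glue X1 X2 A f) (glue_in2 X1 X2 A f)"
  unfolding dsmooth_def by (auto simp: glue_pts intro: glue_in2_plot diffeology_plot(1))

lemma glue_plots_restrict:
  assumes X: "plots_restrict X1" "plots_restrict X2"
  shows "plots_restrict (glue X1 X2 A f)"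
  unfolding plots_restrict_def
proof (intro allI impI)
  fix n U p W
  assume p: "plot (glue X1 X2 A f) n U p" and W: "openin (Euclidean_space n) W" "W \<subseteq> U"
  show "plot (glue X1 X2 A f) n W p"
  proof (rule glue_plotI[OF W(1)])
    fix u assume u: "u \<in> W"
    from p subsetD[OF W(2) u] show "\<exists>V. openin (Euclidean_space n) V \<and> u \<in> V \<and> V \<subseteq> W \<and>
      ((\<exists>q. plot X1 n V q \<and> (\<forall>w\<in>V. p w = glue_in1 X1 X2 A f (q w))) \<or>
       (\<exists>q. plot X2 n V q \<and> (\<forall>w\<in>V. p w = glue_in2 X1 X2 A f (q w))))"
    proof (cases rule: glue_plotE)
      case (left V q)
      then have "plot X1 n (V \<inter> W) q" using W by (intro plots_restrictD[OF X(1) left(4)]) auto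
      then show ?thesis using left u W by (intro exI[of _ "V \<inter> W"]) auto
    next
      case (right V q)
      then have "plot X2 n (V \<inter> W) q" using W by (intro plots_restrictD[OF X(2) right(4)]) auto
      then show ?thesis using right u W by (intro exI[of _ "V \<inter> W"]) auto
    qed
  qed
qed

section \<open>Gluing of pseudo-bundles\<close>

text \<open>
  The set-theoretic part of a gluing of pseudo-bundles: a fibrewise map over an injective map of
  a subset of the base.
\<close>

locale fibred_gluing =
  fixes E1 :: "('x1, 'v1) pbundle" and E2 :: "('x2, 'v2) pbundle"
    and Y :: "'x1 set" and f :: "'x1 \<Rightarrow> 'x2" and F :: "'v1 \<Rightarrow> 'v2"
  assumes Y_subset: "Y \<subseteq> pts (base E1)"
    and f_image: "f ` Y \<subseteq> pts (base E2)"
    and f_inj: "inj_on f Y"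
    and F_image: "F ` over E1 Y \<subseteq> pts (total E2)"
    and proj_F: "\<And>v. v \<in> over E1 Y \<Longrightarrow> proj E2 (F v) = f (proj E1 v)"
begin

abbreviation "i1 \<equiv> glue_in1 (base E1) (base E2) Y f"
abbreviation "i2 \<equiv> glue_in2 (base E1) (base E2) Y f"
abbreviation "j1 \<equiv> glue_in1 (total E1) (total E2) (over E1 Y) F"
abbreviation "j2 \<equiv> glue_in2 (total E1) (total E2) (over E1 Y) F"
abbreviation "G \<equiv> glue_bundle E1 E2 Y f F"

lemma over_subset: "over E1 Y \<subseteq> pts (total E1)"
  by (auto simp: over_def)

lemmas base_in1_iff = glue_in1_eq_in1_iff[OF Y_subset f_image]
  and base_in2_iff = glue_in2_eq_in2_iff[OF Y_subset f_image]
  and base_in12_iff = glue_in1_eq_in2_iff[OF Y_subset f_image]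
  and total_in1_iff = glue_in1_eq_in1_iff[OF over_subset F_image]
  and total_in2_iff = glue_in2_eq_in2_iff[OF over_subset F_image]
  and total_in12_iff = glue_in1_eq_in2_iff[OF over_subset F_image]

lemma i1_inj: "inj_on i1 (pts (base E1))"
  using f_inj by (auto intro!: inj_onI simp: base_in1_iff dest: inj_onD)

lemma i1_Y: "y \<in> Y \<Longrightarrow> i1 y = i2 (f y)"
  using Y_subset f_image by (subst base_in12_iff) auto

lemma j1_over: "v \<in> over E1 Y \<Longrightarrow> j1 v = j2 (F v)"
  using over_subset F_image by (subst total_in12_iff) auto

lemma base_G: "base G = glue (base E1) (base E2) Y f"
  and total_G: "total G = glue (total E1) (total E2) (over E1 Y) F"
  by (simp_all add: glue_bundle_def Let_def)

lemma proj_G1: "v \<in> pts (total E1) \<Longrightarrow> proj G (j1 v) = i1 (proj E1 v)"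
  and proj_G2: "w \<in> pts (total E2) \<Longrightarrow> proj G (j2 w) = i2 (proj E2 w)"
proof -
  have eq: "proj G = glue_case (\<lambda>v. i1 (proj E1 v)) (\<lambda>w. i2 (proj E2 w))"
    by (simp add: glue_bundle_def Let_def glue_case_def fun_eq_iff)
  have u: "i1 (proj E1 v) = i2 (proj E2 (F v))" if "v \<in> over E1 Y" for v
    using that proj_F i1_Y by (auto simp: over_def)
  show "v \<in> pts (total E1) \<Longrightarrow> proj G (j1 v) = i1 (proj E1 v)"
    and "w \<in> pts (total E2) \<Longrightarrow> proj G (j2 w) = i2 (proj E2 w)"
    unfolding eq
    using glue_case_in1[OF over_subset F_image, where ?u1.0 = "\<lambda>v. i1 (proj E1 v)" and ?u2.0 = "\<lambda>w. i2 (proj E2 w)"]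
      glue_case_in2[OF over_subset F_image, where ?u1.0 = "\<lambda>v. i1 (proj E1 v)" and ?u2.0 = "\<lambda>w. i2 (proj E2 w)"] u
    by auto
qed

lemma i2_not_i1:
  assumes "x \<in> pts (base E2)"
  shows "i2 x \<notin> i1 ` (pts (base E1) - Y)"
proof
  assume "i2 x \<in> i1 ` (pts (base E1) - Y)"
  then obtain x1 where "x1 \<in> pts (base E1)" "x1 \<notin> Y" "i1 x1 = i2 x" by auto
  then show False using assms base_in12_iff by blast
qed

lemma inv_i1: "x \<in> pts (base E1) - Y \<Longrightarrow> inv_into (pts (base E1) - Y) i1 (i1 x) = x"
  by (rule inv_into_f_f) (auto intro: inj_on_subset[OF i1_inj])

lemma inv_i2: "x \<in> pts (base E2) \<Longrightarrow> inv_into (pts (base E2)) i2 (i2 x) = x"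
  by (rule inv_into_f_f) (auto intro!: inj_onI simp: base_in2_iff)

lemma fibre_G1: "x \<in> pts (base E1) - Y \<Longrightarrow> fibre G (i1 x) = transport j1 (fibre E1 x)"
  and fibre_G2: "x' \<in> pts (base E2) \<Longrightarrow> fibre G (i2 x') = transport j2 (fibre E2 x')"
  using i2_not_i1 by (auto simp: glue_bundle_def Let_def inv_i1 inv_i2)

end

text \<open>A gluing of pseudo-bundles with compatible families of forms.\<close>

locale bundle_gluing_setup =
  fixes E1 :: "('x1, 'v1) pbundle" and E2 :: "('x2, 'v2) pbundle"
    and Y :: "'x1 set" and f :: "'x1 \<Rightarrow> 'x2" and F :: "'v1 \<Rightarrow> 'v2"
    and g1 :: "'x1 \<Rightarrow> 'v1 \<Rightarrow> 'v1 \<Rightarrow> real" and g2 :: "'x2 \<Rightarrow> 'v2 \<Rightarrow> 'v2 \<Rightarrow> real"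
  assumes E1: "pseudo_bundle E1" and E2: "pseudo_bundle E2"
    and gluing: "bundle_gluing E1 E2 Y f F"
    and compatible: "metrics_compatible E1 Y f F g1 g2"

sublocale bundle_gluing_setup \<subseteq> fibred_gluing E1 E2 Y f F
proof
  show Y: "Y \<subseteq> pts (base E1)" using gluing by (simp add: bundle_gluing_def)
  have "bij_betw f (pts (base E1) \<inter> Y) (pts (base E2) \<inter> f ` Y)"
    using gluing by (simp add: bundle_gluing_def diffeo_def dsub_def)
  then show "inj_on f Y" using Y by (simp add: bij_betw_def Int_absorb1)
  show "F ` over E1 Y \<subseteq> pts (total E2)"
    using gluing by (auto simp: bundle_gluing_def dsmooth_def dsub_def over_def)
qed (use gluing in \<open>auto simp: bundle_gluing_def over_def\<close>)

context bundle_gluing_setup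
begin

abbreviation "g \<equiv> glue_metric E1 E2 Y f F g1 g2"

lemma F_linear: "y \<in> Y \<Longrightarrow> F \<in> module_hom class_ring (fibre E1 y) (fibre E2 (f y))"
  using gluing by (simp add: bundle_gluing_def)

lemma F_plot:
  assumes "plot (total E1) n U p" "\<And>u. u \<in> U \<Longrightarrow> p u \<in> over E1 Y"
  shows "plot (total E2) n U (F \<circ> p)"
proof -
  have "dsmooth (dsub (total E1) (over E1 Y)) (dsub (total E2) (over E2 (f ` Y))) F"
    using gluing by (simp add: bundle_gluing_def)
  then show ?thesis using assms by (auto simp: dsmooth_def dsub_def)
qed

lemma fibre1: "x \<in> pts (base E1) \<Longrightarrow> v \<in> carrier (fibre E1 x) \<longleftrightarrow> v \<in> pts (total E1) \<and> proj E1 v = x"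
  and fibre2: "x' \<in> pts (base E2) \<Longrightarrow> w \<in> carrier (fibre E2 x') \<longleftrightarrow> w \<in> pts (total E2) \<and> proj E2 w = x'"
  using pseudo_bundleD(5)[OF E1] pseudo_bundleD(5)[OF E2] by auto

lemma j1_inj: "x \<in> pts (base E1) - Y \<Longrightarrow> inj_on j1 (carrier (fibre E1 x))"
  by (rule inj_onI) (auto simp: fibre1 total_in1_iff, auto simp: over_def)

lemma j2_inj: "inj_on j2 (pts (total E2))"
  by (rule inj_onI) (simp add: total_in2_iff)

lemma j2_inj_fibre: "x \<in> pts (base E2) \<Longrightarrow> inj_on j2 (carrier (fibre E2 x))"
  by (rule inj_on_subset[OF j2_inj]) (auto simp: fibre2)

lemma closed_ops_G: "z \<in> pts (base G) \<Longrightarrow> closed_ops (fibre G z)"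
  unfolding base_G
  by (erule glue_pts_cases[OF Y_subset f_image])
    (auto simp: fibre_G1 fibre_G2 intro!: transport_closed_ops j1_inj j2_inj_fibre
      pseudo_bundleD(6)[OF E1] pseudo_bundleD(6)[OF E2])

lemma j2_linear: "x \<in> pts (base E2) \<Longrightarrow> j2 \<in> module_hom class_ring (fibre E2 x) (fibre G (i2 x))"
  by (simp add: fibre_G2 transport_module_hom[OF j2_inj_fibre])

text \<open>Over \<open>Y\<close> the fibre of the glued bundle is that of the second bundle, and \<open>j1\<close> factors through \<open>F\<close>.\<close>

lemma j1_linear:
  assumes x: "x \<in> pts (base E1)"
  shows "j1 \<in> module_hom class_ring (fibre E1 x) (fibre G (i1 x))"
proof (cases "x \<in> Y")
  case True
  then have fx: "f x \<in> pts (base E2)" using f_image by auto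
  have j1: "j1 v = j2 (F v)" if "v \<in> carrier (fibre E1 x)" for v
    using that x True by (intro j1_over) (simp add: fibre1 over_def)
  have ops: "closed_ops (fibre E1 x)" by (rule pseudo_bundleD(6)[OF E1 x])
  note j2 = j2_linear[OF fx] and F = F_linear[OF True]
  have Fc: "F v \<in> carrier (fibre E2 (f x))" if "v \<in> carrier (fibre E1 x)" for v
    using module_hom_closed[OF F] that by auto
  show ?thesis
    unfolding module_hom_def
    using ops module_hom_closed[OF j2] Fc module_hom_add[OF j2] module_hom_smult[OF j2]
      module_hom_add[OF F] module_hom_smult[OF F]
    by (auto simp: j1 i1_Y[OF True] closed_ops_def)
next
  case False
  then show ?thesis using x by (simp add: fibre_G1 transport_module_hom[OF j1_inj])
qed

lemma morphism1: "bundle_morphism E1 G i1 j1"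
  unfolding bundle_morphism_def base_G total_G
  using glue_in1_smooth[OF pseudo_bundleD(1)[OF E1] Y_subset f_image]
    glue_in1_smooth[OF pseudo_bundleD(2)[OF E1] over_subset F_image] proj_G1 j1_linear
  by blast

lemma morphism2: "bundle_morphism E2 G i2 j2"
  unfolding bundle_morphism_def base_G total_G
  using glue_in2_smooth[OF pseudo_bundleD(1)[OF E2] Y_subset f_image]
    glue_in2_smooth[OF pseudo_bundleD(2)[OF E2] over_subset F_image] proj_G2 j2_linear
  by blast

subsection \<open>Lifting plots of the glued bundle\<close>

text \<open>
  Over a plot of the base that comes from the second space, every plot of the glued bundle lifts to the
  second bundle: a lift to the first bundle lies over \<open>Y\<close>, and composing it with \<open>F\<close> moves it over.
\<close>

lemma lift2:
  assumes u: "u \<in> W" and b: "plot (base E2) n W b" and \<alpha>: "plot (total G) n W \<alpha>"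
    and proj: "\<And>w. w \<in> W \<Longrightarrow> proj G (\<alpha> w) = i2 (b w)"
  shows "\<exists>W'. openin (Euclidean_space n) W' \<and> u \<in> W' \<and> W' \<subseteq> W \<and>
        (\<exists>\<beta>. plot (total E2) n W' \<beta> \<and> (\<forall>w\<in>W'. proj E2 (\<beta> w) = b w \<and> j2 (\<beta> w) = \<alpha> w))"
proof -
  have bw: "b w \<in> pts (base E2)" if "w \<in> W" for w
    using diffeology_plot(2)[OF pseudo_bundleD(1)[OF E2] b that] .
  from \<alpha> u show ?thesis unfolding total_G
  proof (cases rule: glue_plotE)
    case (left W' q)
    have q: "q w \<in> pts (total E1)" if "w \<in> W'" for w
      using diffeology_plot(2)[OF pseudo_bundleD(2)[OF E1] left(4) that] .
    have Y: "proj E1 (q w) \<in> Y \<and> f (proj E1 (q w)) = b w" if "w \<in> W'" for w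
    proof -
      have "i1 (proj E1 (q w)) = i2 (b w)"
        using proj[of w] proj_G1[OF q[OF that]] left(3,5) that by auto
      then show ?thesis
        using base_in12_iff pseudo_bundleD(4)[OF E1 q[OF that]] bw that left(3) by auto
    qed
    then have over: "q w \<in> over E1 Y" if "w \<in> W'" for w
      using q that by (simp add: over_def)
    have "plot (total E2) n W' (F \<circ> q)" by (rule F_plot[OF left(4) over])
    moreover have "proj E2 ((F \<circ> q) w) = b w \<and> j2 ((F \<circ> q) w) = \<alpha> w" if "w \<in> W'" for w
      using that over Y left(5) by (simp add: proj_F j1_over)
    ultimately show ?thesis using left(1-3) by (intro exI[of _ W'] conjI exI[of _ "F \<circ> q"]) auto
  next
    case (right W' q)
    have "proj E2 (q w) = b w" if "w \<in> W'" for w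
    proof -
      have q: "q w \<in> pts (total E2)"
        using diffeology_plot(2)[OF pseudo_bundleD(2)[OF E2] right(4) that] .
      then have "i2 (proj E2 (q w)) = i2 (b w)"
        using proj[of w] proj_G2[OF q] right(3,5) that by auto
      then show ?thesis
        using base_in2_iff pseudo_bundleD(4)[OF E2 q] bw that right(3) by auto
    qed
    then show ?thesis using right by (intro exI[of _ W'] conjI exI[of _ q]) auto
  qed
qed

text \<open>
  If the plot of the base comes from the first space but nowhere around \<open>u\<close> from the second, then no plot
  over it lifts to the second bundle. A lift to the first bundle lies over the given plot \<open>b\<close> because
  \<open>i1\<close> is injective.
\<close>

lemma lift1:
  assumes u: "u \<in> W" and b: "plot (base E1) n W b" and \<alpha>: "plot (total G) n W \<alpha>"
    and proj: "\<And>w. w \<in> W \<Longrightarrow> proj G (\<alpha> w) = i1 (b w)"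
    and not2: "\<And>W' b'. openin (Euclidean_space n) W' \<Longrightarrow> u \<in> W' \<Longrightarrow> W' \<subseteq> W \<Longrightarrow> plot (base E2) n W' b' \<Longrightarrow>
      \<exists>w\<in>W'. i1 (b w) \<noteq> i2 (b' w)"
  shows "\<exists>W'. openin (Euclidean_space n) W' \<and> u \<in> W' \<and> W' \<subseteq> W \<and>
        (\<exists>\<beta>. plot (total E1) n W' \<beta> \<and> (\<forall>w\<in>W'. proj E1 (\<beta> w) = b w \<and> j1 (\<beta> w) = \<alpha> w))"
proof -
  have bw: "b w \<in> pts (base E1)" if "w \<in> W" for w
    using diffeology_plot(2)[OF pseudo_bundleD(1)[OF E1] b that] .
  from \<alpha> u show ?thesis unfolding total_G
  proof (cases rule: glue_plotE)
    case (left W' q)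
    have "proj E1 (q w) = b w" if "w \<in> W'" for w
    proof -
      have q: "q w \<in> pts (total E1)"
        using diffeology_plot(2)[OF pseudo_bundleD(2)[OF E1] left(4) that] .
      then have "i1 (proj E1 (q w)) = i1 (b w)"
        using proj[of w] proj_G1[OF q] left(3,5) that by auto
      then show ?thesis
        using inj_onD[OF i1_inj] pseudo_bundleD(4)[OF E1 q] bw that left(3) by blast
    qed
    then show ?thesis using left by (intro exI[of _ W'] conjI exI[of _ q]) auto
  next
    case (right W' q)
    have "i1 (b w) = i2 ((proj E2 \<circ> q) w)" if "w \<in> W'" for w
    proof -
      have q: "q w \<in> pts (total E2)"
        using diffeology_plot(2)[OF pseudo_bundleD(2)[OF E2] right(4) that] .
      then show ?thesis
        using proj[of w] proj_G2[OF q] right(3,5) that by auto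
    qed
    then show ?thesis using not2[OF right(1-3) pseudo_bundleD(3)[OF E2 right(4)]] by blast
  qed
qed

lemma tensor_algebra_glue_lift:
  assumes q: "plot (tensor_algebra_space G) n U q" and u: "u \<in> U"
  shows "\<exists>W. openin (Euclidean_space n) W \<and> u \<in> W \<and> W \<subseteq> U \<and>
    ((\<exists>t. plot (tensor_algebra_space E1) n W t \<and>
       (\<forall>w\<in>W. q w = (i1 (fst (t w)), tensor_map (fibre G (i1 (fst (t w)))) j1 (snd (t w))))) \<or>
     (\<exists>t. plot (tensor_algebra_space E2) n W t \<and>
       (\<forall>w\<in>W. q w = (i2 (fst (t w)), tensor_map (fibre G (i2 (fst (t w)))) j2 (snd (t w))))))"
proof -
  have near: "near_each n U (tensor_algebra_plot_data G n q)"
    and U: "openin (Euclidean_space n) U"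
    using q unfolding tensor_algebra_space_def by simp_all
  \<comment> \<open>The component of degree 0 provides the plot of the base near \<open>u\<close>.\<close>
  obtain W0 where W0: "openin (Euclidean_space n) W0" "u \<in> W0" "W0 \<subseteq> U"
    and "plot (tensor_power_space G 0) n W0 (\<lambda>u. (fst (q u), snd (q u) 0))"
    by (rule near_eachE[OF near u]) blast
  from this(4) have "near_each n W0 (tensor_plot_data G 0 n (\<lambda>u. (fst (q u), snd (q u) 0)))"
    unfolding tensor_power_space_plot_iff by blast
  then obtain W1 where W1: "openin (Euclidean_space n) W1" "u \<in> W1" "W1 \<subseteq> W0"
    and "plot (base G) n W1 (\<lambda>u. fst (q u))"
    by (elim near_eachE[OF _ W0(2)]) (auto simp: tensor_plot_data_def)
  note base_plot = this(4)[unfolded base_G]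
  have q_sub: "plot (tensor_algebra_space G) n W q" if "openin (Euclidean_space n) W" "W \<subseteq> W1" for W
    using that W1(3) W0(3) pseudo_bundle_restrict[OF E1] pseudo_bundle_restrict[OF E2]
    by (intro tensor_algebra_space_plot_subset[OF _ _ q]) (auto simp: base_G total_G intro: glue_plots_restrict)
  show ?thesis
  proof (cases "\<exists>W b. openin (Euclidean_space n) W \<and> u \<in> W \<and> W \<subseteq> W1 \<and> plot (base E2) n W b \<and>
      (\<forall>w\<in>W. fst (q w) = i2 (b w))")
    case True
    then obtain W b where W: "openin (Euclidean_space n) W" "u \<in> W" "W \<subseteq> W1"
      and b: "plot (base E2) n W b" "\<And>w. w \<in> W \<Longrightarrow> fst (q w) = i2 (b w)" by blast
    have "\<exists>W'. openin (Euclidean_space n) W' \<and> u \<in> W' \<and> W' \<subseteq> W \<and>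
      (\<exists>t. plot (tensor_algebra_space E2) n W' t \<and>
        (\<forall>w\<in>W'. q w = (i2 (fst (t w)), tensor_map (fibre G (i2 (fst (t w)))) j2 (snd (t w)))))"
    proof (rule tensor_algebra_space_lift[OF E2 closed_ops_G morphism2 q_sub[OF W(1,3)] W(2) b])
      fix V \<alpha>
      assume V: "openin (Euclidean_space n) V" "u \<in> V" "V \<subseteq> W" "plot (total G) n V \<alpha>"
        "\<And>w. w \<in> V \<Longrightarrow> proj G (\<alpha> w) = i2 (b w)"
      show "\<exists>W'. openin (Euclidean_space n) W' \<and> u \<in> W' \<and> W' \<subseteq> V \<and>
        (\<exists>\<beta>. plot (total E2) n W' \<beta> \<and> (\<forall>w\<in>W'. proj E2 (\<beta> w) = b w \<and> j2 (\<beta> w) = \<alpha> w))"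
        by (rule lift2[OF V(2) diffeology_plot_subset[OF pseudo_bundleD(1)[OF E2] b(1) V(1,3)] V(4,5)])
    qed
    then obtain W' where "openin (Euclidean_space n) W' \<and> u \<in> W' \<and> W' \<subseteq> W \<and>
      (\<exists>t. plot (tensor_algebra_space E2) n W' t \<and>
        (\<forall>w\<in>W'. q w = (i2 (fst (t w)), tensor_map (fibre G (i2 (fst (t w)))) j2 (snd (t w)))))"
      by (rule exE)
    then show ?thesis using W(3) W1(3) W0(3) by (intro exI[of _ W'] conjI disjI2) auto
  next
    case False
    from base_plot W1(2) show ?thesis
    proof (cases rule: glue_plotE)
      case (right W b)
      then have "\<exists>W b. openin (Euclidean_space n) W \<and> u \<in> W \<and> W \<subseteq> W1 \<and> plot (base E2) n W b \<and>
          (\<forall>w\<in>W. fst (q w) = i2 (b w))"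
        by (intro exI[of _ W] exI[of _ b] conjI ballI)
      with False show ?thesis by (rule notE)
    next
      case (left W b)
      have "\<exists>W'. openin (Euclidean_space n) W' \<and> u \<in> W' \<and> W' \<subseteq> W \<and>
        (\<exists>t. plot (tensor_algebra_space E1) n W' t \<and>
          (\<forall>w\<in>W'. q w = (i1 (fst (t w)), tensor_map (fibre G (i1 (fst (t w)))) j1 (snd (t w)))))"
      proof (rule tensor_algebra_space_lift[OF E1 closed_ops_G morphism1 q_sub[OF left(1,3)] left(2,4,5)])
        fix V \<alpha>
        assume V: "openin (Euclidean_space n) V" "u \<in> V" "V \<subseteq> W" "plot (total G) n V \<alpha>"
          "\<And>w. w \<in> V \<Longrightarrow> proj G (\<alpha> w) = i1 (b w)"
        show "\<exists>W'. openin (Euclidean_space n) W' \<and> u \<in> W' \<and> W' \<subseteq> V \<and>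
          (\<exists>\<beta>. plot (total E1) n W' \<beta> \<and> (\<forall>w\<in>W'. proj E1 (\<beta> w) = b w \<and> j1 (\<beta> w) = \<alpha> w))"
        proof (rule lift1[OF V(2) diffeology_plot_subset[OF pseudo_bundleD(1)[OF E1] left(4) V(1,3)] V(4,5)])
          fix W' b'
          assume W': "openin (Euclidean_space n) W'" "u \<in> W'" "W' \<subseteq> V" "plot (base E2) n W' b'"
          have "W' \<subseteq> W1" "W' \<subseteq> W" using W'(3) V(3) left(3) by auto
          show "\<exists>w\<in>W'. i1 (b w) \<noteq> i2 (b' w)"
          proof (rule ccontr)
            assume "\<not> (\<exists>w\<in>W'. i1 (b w) \<noteq> i2 (b' w))"
            then have "\<forall>w\<in>W'. fst (q w) = i2 (b' w)"
              using left(5) \<open>W' \<subseteq> W\<close> by auto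
            then have "\<exists>W b. openin (Euclidean_space n) W \<and> u \<in> W \<and> W \<subseteq> W1 \<and> plot (base E2) n W b \<and>
                (\<forall>w\<in>W. fst (q w) = i2 (b w))"
              using W' \<open>W' \<subseteq> W1\<close> by (intro exI[of _ W'] exI[of _ b'] conjI)
            with False show False by (rule notE)
          qed
        qed
      qed
      then obtain W' where "openin (Euclidean_space n) W' \<and> u \<in> W' \<and> W' \<subseteq> W \<and>
        (\<exists>t. plot (tensor_algebra_space E1) n W' t \<and>
          (\<forall>w\<in>W'. q w = (i1 (fst (t w)), tensor_map (fibre G (i1 (fst (t w)))) j1 (snd (t w)))))"
        by (rule exE)
      then show ?thesis using left(3) W1(3) W0(3) by (intro exI[of _ W'] conjI disjI1) auto
    qed
  qed
qed

end

section \<open>Clifford algebras under transport of structure\<close>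

lemma module_hom_comp:
  assumes "h \<in> module_hom class_ring M N" "k \<in> module_hom class_ring N P"
  shows "k \<circ> h \<in> module_hom class_ring M P"
  using assms by (auto simp: module_hom_def Pi_iff)

lemma transport_module_hom_left:
  assumes "inj_on h (carrier M)" "H \<circ> h \<in> module_hom class_ring M N"
  shows "H \<in> module_hom class_ring (transport h M) N"
  using assms(2) by (auto simp: module_hom_def transport_carrier[OF assms(1)] transport_add[OF assms(1)]
      transport_smult[OF assms(1)])

lemma transport_ring_hom_left:
  assumes "inj_on h (carrier M)" "H \<circ> h \<in> Ring.ring_hom M N"
  shows "H \<in> Ring.ring_hom (transport h M) N"
proof (rule ring_hom_memI)
  show "H \<one>\<^bsub>transport h M\<^esub> = \<one>\<^bsub>N\<^esub>"
    using ring_hom_one[OF assms(2)] by (simp add: transport_one[OF assms(1)])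
qed (use ring_hom_closed[OF assms(2)] ring_hom_mult[OF assms(2)] ring_hom_add[OF assms(2)] in
    \<open>auto simp: transport_carrier[OF assms(1)] transport_add[OF assms(1)] transport_mult[OF assms(1)]\<close>)

lemma clifford_closed:
  assumes W: "closed_ops W"
  shows "closed_ops (clifford_algebra W Q)"
    "x \<in> carrier (clifford_algebra W Q) \<Longrightarrow> y \<in> carrier (clifford_algebra W Q) \<Longrightarrow>
      x \<otimes>\<^bsub>clifford_algebra W Q\<^esub> y \<in> carrier (clifford_algebra W Q)"
    "\<one>\<^bsub>clifford_algebra W Q\<^esub> \<in> carrier (clifford_algebra W Q)"
  by (auto simp: closed_ops_def clifford_carrier_eq_proj[OF W] clifford_proj_add[OF W] clifford_proj_mult[OF W]
      clifford_proj_smult[OF W] clifford_proj_one[OF W] formal_sums_add formal_sums_smult conv_free_carrier)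

lemma module_hom_cong:
  assumes "closed_ops M" "h \<in> module_hom class_ring M N" "\<And>x. x \<in> carrier M \<Longrightarrow> h' x = h x"
  shows "h' \<in> module_hom class_ring M N"
  using assms by (auto simp: module_hom_def closed_ops_def Pi_iff)

lemma clifford_ring_hom_cong:
  assumes W: "closed_ops W" and h: "h \<in> Ring.ring_hom (clifford_algebra W Q) N"
    and eq: "\<And>x. x \<in> carrier (clifford_algebra W Q) \<Longrightarrow> h' x = h x"
  shows "h' \<in> Ring.ring_hom (clifford_algebra W Q) N"
  using clifford_closed[OF W, where Q = Q] ring_hom_closed[OF h] ring_hom_mult[OF h] ring_hom_add[OF h] ring_hom_one[OF h]
  by (intro ring_hom_memI) (auto simp: eq closed_ops_def)

lemma clifford_proj_ring_hom:
  "closed_ops W \<Longrightarrow> clifford_proj W Q \<in> Ring.ring_hom (free_algebra (carrier W)) (clifford_algebra W Q)"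
  by (rule ring_hom_memI)
    (simp_all add: free_algebra_def clifford_carrier_eq_proj clifford_proj_mult clifford_proj_add clifford_proj_one)

lemma clifford_proj_module_hom:
  "closed_ops W \<Longrightarrow> clifford_proj W Q \<in> module_hom class_ring (free_algebra (carrier W)) (clifford_algebra W Q)"
  by (auto simp: module_hom_def free_algebra_def clifford_carrier_eq_proj clifford_proj_add clifford_proj_smult)

lemma clifford_map_transport_bij:
  assumes h: "isometric_map W Q (transport h W) Q' h" and inj: "inj_on h (carrier W)"
  shows "bij_betw (clifford_map W Q (transport h W) Q' h)
    (carrier (clifford_algebra W Q)) (carrier (clifford_algebra (transport h W) Q'))"
proof (rule clifford_map_bij[OF h])
  show "isometric_map (transport h W) Q' W Q (inv_into (carrier W) h)"
    using h inj transport_inv_module_hom[OF inj]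
    by (auto simp: isometric_map_def transport_carrier[OF inj])
qed (use inj in \<open>auto simp: transport_carrier[OF inj]\<close>)

section \<open>Clifford pseudo-bundles\<close>

lemma clifford_bundle_simps [simp]:
  "base (clifford_bundle E g) = base E"
  "proj (clifford_bundle E g) = fst"
  "fibre (clifford_bundle E g) x = transport (Pair x) (clifford_algebra (fibre E x) (g x))"
  by (simp_all add: clifford_bundle_def)

lemma inj_on_Pair: "inj_on (Pair x) S"
  by (rule inj_onI) simp

lemma clifford_bundle_pts:
  assumes "\<And>x. x \<in> pts (base E) \<Longrightarrow> closed_ops (fibre E x)"
  shows "pts (total (clifford_bundle E g)) = (SIGMA x:pts (base E). carrier (clifford_algebra (fibre E x) (g x)))"
  using assms
  by (force simp: clifford_bundle_def pushforward_def tensor_algebra_space_def clifford_carrier)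

text \<open>The representation on \<open>W\<close> of a plot of the Clifford bundle: the classes of a plot of the tensor algebras.\<close>

abbreviation clifford_plot_data ::
  "('x, 'v) pbundle \<Rightarrow> ('x \<Rightarrow> 'v \<Rightarrow> 'v \<Rightarrow> real) \<Rightarrow> nat \<Rightarrow>
   ((nat \<Rightarrow> real) \<Rightarrow> 'x \<times> (nat \<Rightarrow> ('v list \<Rightarrow> real) set) set) \<Rightarrow> (nat \<Rightarrow> real) set \<Rightarrow> bool" where
  "clifford_plot_data E g n p W \<equiv> \<exists>q. plot (tensor_algebra_space E) n W q \<and>
     (\<forall>w\<in>W. p w = (fst (q w), clifford_class (fibre E (fst (q w))) (g (fst (q w))) (snd (q w))))"

lemma clifford_bundle_plot_iff:
  "plot (total (clifford_bundle E g)) n U p \<longleftrightarrow> openin (Euclidean_space n) U \<and>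
     near_each n U (clifford_plot_data E g n p)"
  by (simp add: clifford_bundle_def pushforward_def split_beta)

lemma tensor_algebra_space_plot_pts:
  assumes "plot (tensor_algebra_space E) n U q" "u \<in> U"
  shows "fst (q u) \<in> pts (base E)" "snd (q u) \<in> carrier (tensor_algebra (fibre E (fst (q u))))"
proof -
  have "q \<in> U \<rightarrow> (SIGMA x:pts (base E). carrier (tensor_algebra (fibre E x)))"
    using assms(1) by (simp add: tensor_algebra_space_def)
  then have "q u \<in> (SIGMA x:pts (base E). carrier (tensor_algebra (fibre E x)))" using assms(2) by blast
  then show "fst (q u) \<in> pts (base E)" "snd (q u) \<in> carrier (tensor_algebra (fibre E (fst (q u))))"
    by (auto simp: mem_Sigma_iff split_beta)
qed

lemma clifford_bundle_plot_pts:
  assumes "plot (total (clifford_bundle E g)) n U p" "u \<in> U"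
  shows "p u \<in> pts (total (clifford_bundle E g))"
proof -
  have near: "near_each n U (clifford_plot_data E g n p)"
    using assms(1) unfolding clifford_bundle_plot_iff by blast
  obtain W where "u \<in> W" and "\<exists>q. plot (tensor_algebra_space E) n W q \<and>
       (\<forall>w\<in>W. p w = (fst (q w), clifford_class (fibre E (fst (q w))) (g (fst (q w))) (snd (q w))))"
    by (rule near_eachE[OF near assms(2)])
  from this(2) obtain q where q: "plot (tensor_algebra_space E) n W q"
    and "\<forall>w\<in>W. p w = (fst (q w), clifford_class (fibre E (fst (q w))) (g (fst (q w))) (snd (q w)))"
    by (elim exE conjE)
  note p = bspec[OF this(2) \<open>u \<in> W\<close>]
  have "q u \<in> pts (tensor_algebra_space E)"
    using tensor_algebra_space_plot_pts[OF q \<open>u \<in> W\<close>]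
    by (cases "q u") (simp add: tensor_algebra_space_def)
  then show ?thesis
    unfolding p by (auto simp: clifford_bundle_def pushforward_def split_beta intro!: image_eqI[of _ _ "q u"])
qed

lemma clifford_bundle_plot_local:
  assumes U: "openin (Euclidean_space n) U"
    and local: "\<And>u. u \<in> U \<Longrightarrow> \<exists>W p'. openin (Euclidean_space n) W \<and> u \<in> W \<and> W \<subseteq> U \<and>
      plot (total (clifford_bundle E g)) n W p' \<and> (\<forall>w\<in>W. p w = p' w)"
  shows "plot (total (clifford_bundle E g)) n U p"
proof -
  have "near_each n U (\<lambda>W. \<exists>p'. plot (total (clifford_bundle E g)) n W p' \<and> (\<forall>w\<in>W. p w = p' w))"
    unfolding near_each_def
  proof
    fix u assume "u \<in> U"
    from local[OF this] obtain W p' where "openin (Euclidean_space n) W" "u \<in> W" "W \<subseteq> U"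
      "plot (total (clifford_bundle E g)) n W p'" "\<forall>w\<in>W. p w = p' w"
      by (elim exE conjE)
    then show "\<exists>W. openin (Euclidean_space n) W \<and> u \<in> W \<and> W \<subseteq> U \<and>
        (\<exists>p'. plot (total (clifford_bundle E g)) n W p' \<and> (\<forall>w\<in>W. p w = p' w))"
      by (intro exI[of _ W] exI[of _ p'] conjI)
  qed
  then have "near_each n U (clifford_plot_data E g n p)"
  proof (rule near_each_trans, elim exE conjE)
    fix W p' assume p': "plot (total (clifford_bundle E g)) n W p'" "\<forall>w\<in>W. p w = p' w"
    from p'(1) have "near_each n W (clifford_plot_data E g n p')"
      unfolding clifford_bundle_plot_iff by blast
    then show "near_each n W (clifford_plot_data E g n p)"
      by (rule near_each_mono) (use p'(2) in \<open>auto simp: subset_iff\<close>)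
  qed
  then show ?thesis using U unfolding clifford_bundle_plot_iff by blast
qed

text \<open>The Clifford algebra is functorial, smoothly, in morphisms of pseudo-bundles that respect the forms.\<close>

lemma clifford_bundle_push:
  assumes E: "pseudo_bundle E" and E': "\<And>x. x \<in> pts (base E') \<Longrightarrow> closed_ops (fibre E' x)"
    and ij: "bundle_morphism E E' i j"
    and iso: "\<And>x. x \<in> pts (base E) \<Longrightarrow> isometric_map (fibre E x) (g x) (fibre E' (i x)) (g' (i x)) j"
    and q: "plot (total (clifford_bundle E g)) n U q"
  shows "plot (total (clifford_bundle E' g')) n U (\<lambda>u. (i (fst (q u)),
    clifford_map (fibre E (fst (q u))) (g (fst (q u))) (fibre E' (i (fst (q u)))) (g' (i (fst (q u)))) j (snd (q u))))"
    (is "plot _ n U ?p")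
proof -
  have U: "openin (Euclidean_space n) U"
    and near: "near_each n U (clifford_plot_data E g n q)"
    using q unfolding clifford_bundle_plot_iff by blast+
  from near have "near_each n U (clifford_plot_data E' g' n ?p)"
  proof (rule near_each_mono, elim exE conjE)
    fix W t assume t: "plot (tensor_algebra_space E) n W t"
      "\<forall>w\<in>W. q w = (fst (t w), clifford_class (fibre E (fst (t w))) (g (fst (t w))) (snd (t w)))"
    let ?t' = "\<lambda>w. (i (fst (t w)), tensor_map (fibre E' (i (fst (t w)))) j (snd (t w)))"
    have "plot (tensor_algebra_space E') n W ?t'"
      by (rule tensor_algebra_space_push[OF E E' ij t(1)])
    moreover have "?p w = (fst (?t' w), clifford_class (fibre E' (fst (?t' w))) (g' (fst (?t' w))) (snd (?t' w)))"
      if w: "w \<in> W" for w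
    proof -
      note x = tensor_algebra_space_plot_pts[OF t(1) w]
      show ?thesis using t(2) w clifford_map_class[OF iso[OF x(1)] x(2)] by simp
    qed
    ultimately show "\<exists>t. plot (tensor_algebra_space E') n W t \<and>
       (\<forall>w\<in>W. ?p w = (fst (t w), clifford_class (fibre E' (fst (t w))) (g' (fst (t w))) (snd (t w))))"
      by (intro exI[of _ ?t']) blast
  qed
  then show ?thesis using U unfolding clifford_bundle_plot_iff by blast
qed

context bundle_gluing_setup
begin

abbreviation "C1 \<equiv> clifford_bundle E1 g1"
abbreviation "C2 \<equiv> clifford_bundle E2 g2"
abbreviation "CG \<equiv> clifford_bundle G g"
abbreviation "FC \<equiv> clifford_gluing_map E1 E2 Y f F g1 g2"
abbreviation "cl1 x \<equiv> clifford_algebra (fibre E1 x) (g1 x)"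
abbreviation "cl2 x \<equiv> clifford_algebra (fibre E2 x) (g2 x)"
abbreviation "clG z \<equiv> clifford_algebra (fibre G z) (g z)"

lemma glue_metric1:
  assumes x: "x \<in> pts (base E1) - Y" and v: "v \<in> carrier (fibre E1 x)" and w: "w \<in> carrier (fibre E1 x)"
  shows "g (i1 x) (j1 v) (j1 w) = g1 x v w"
proof -
  have inj: "inj_on j1 (pts (total E1) - over E1 Y)"
    by (rule inj_onI) (auto simp: total_in1_iff)
  have "inv_into (pts (total E1) - over E1 Y) j1 (j1 v) = v" if "v \<in> carrier (fibre E1 x)" for v
    using that x by (intro inv_into_f_f[OF inj]) (auto simp: fibre1 over_def)
  then show ?thesis using x v w by (simp add: glue_metric_def Let_def inv_i1)
qed

lemma glue_metric2:
  assumes x: "x \<in> pts (base E2)" and v: "v \<in> carrier (fibre E2 x)" and w: "w \<in> carrier (fibre E2 x)"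
  shows "g (i2 x) (j2 v) (j2 w) = g2 x v w"
proof -
  have "inv_into (pts (total E2)) j2 (j2 v) = v" if "v \<in> carrier (fibre E2 x)" for v
    using that x by (intro inv_into_f_f[OF j2_inj]) (auto simp: fibre2)
  then show ?thesis using x v w i2_not_i1[OF x] by (simp add: glue_metric_def Let_def inv_i2)
qed

lemma i_pts: "x \<in> pts (base E1) \<Longrightarrow> i1 x \<in> pts (base G)" "x' \<in> pts (base E2) \<Longrightarrow> i2 x' \<in> pts (base G)"
  by (auto simp: base_G glue_pts[OF Y_subset f_image])

lemma isoF: "y \<in> Y \<Longrightarrow> isometric_map (fibre E1 y) (g1 y) (fibre E2 (f y)) (g2 (f y)) F"
  using Y_subset f_image compatible F_linear pseudo_bundleD(6)[OF E1] pseudo_bundleD(6)[OF E2]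
  by (auto simp: isometric_map_def metrics_compatible_def)

lemma iso2: "x \<in> pts (base E2) \<Longrightarrow> isometric_map (fibre E2 x) (g2 x) (fibre G (i2 x)) (g (i2 x)) j2"
  using j2_linear glue_metric2 closed_ops_G i_pts pseudo_bundleD(6)[OF E2]
  by (auto simp: isometric_map_def)

text \<open>For base points in \<open>Y\<close> this is where the compatibility of the two families of forms enters.\<close>

lemma iso1:
  assumes x: "x \<in> pts (base E1)"
  shows "isometric_map (fibre E1 x) (g1 x) (fibre G (i1 x)) (g (i1 x)) j1"
proof -
  have "g (i1 x) (j1 v) (j1 w) = g1 x v w"
    if vw: "v \<in> carrier (fibre E1 x)" "w \<in> carrier (fibre E1 x)" for v w
  proof (cases "x \<in> Y")
    case True
    have fx: "f x \<in> pts (base E2)" using True f_image by auto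
    have j1: "j1 u = j2 (F u)" if "u \<in> carrier (fibre E1 x)" for u
      using that x True by (intro j1_over) (simp add: fibre1 over_def)
    have "F u \<in> carrier (fibre E2 (f x))" if "u \<in> carrier (fibre E1 x)" for u
      using module_hom_closed[OF F_linear[OF True]] that by auto
    then show ?thesis
      using vw glue_metric2[OF fx, of "F v" "F w"] isometric_mapD(4)[OF isoF[OF True] vw]
      by (simp add: i1_Y[OF True] j1)
  next
    case False
    then show ?thesis using glue_metric1 x vw by simp
  qed
  then show ?thesis using x j1_linear closed_ops_G i_pts pseudo_bundleD(6)[OF E1]
    by (auto simp: isometric_map_def)
qed

lemmas C1_pts = clifford_bundle_pts[OF pseudo_bundleD(6)[OF E1], where g = g1]
  and C2_pts = clifford_bundle_pts[OF pseudo_bundleD(6)[OF E2], where g = g2]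
  and CG_pts = clifford_bundle_pts[OF closed_ops_G, where g = g]

lemma over_C1: "over C1 Y = (SIGMA y:Y. carrier (cl1 y))"
  using Y_subset by (auto simp: over_def C1_pts)

subsection \<open>The gluing map of Clifford algebras\<close>

text \<open>
  The description of the gluing map by a universal property has a unique solution, namely the map that is
  induced by \<open>F\<close> on each fibre over \<open>Y\<close>.
\<close>

lemma FC_eq:
  assumes y: "y \<in> Y" and c: "c \<in> carrier (cl1 y)"
  shows "FC (y, c) = (f y, clifford_map (fibre E1 y) (g1 y) (fibre E2 (f y)) (g2 (f y)) F c)"
proof -
  let ?m = "\<lambda>y. clifford_map (fibre E1 y) (g1 y) (fibre E2 (f y)) (g2 (f y)) F"
  define H where "H = restrict (\<lambda>(y, c). (f y, ?m y c)) (over C1 Y)"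
  let ?P = "\<lambda>G. G \<in> extensional (over C1 Y) \<and>
       (\<forall>y\<in>Y. G \<in> Ring.ring_hom (fibre C1 y) (fibre C2 (f y)) \<and>
          G \<in> module_hom class_ring (fibre C1 y) (fibre C2 (f y)) \<and>
          (\<forall>v\<in>carrier (fibre E1 y). G (clifford_incl E1 g1 v) = clifford_incl E2 g2 (F v)))"
  have ops: "closed_ops (fibre E1 y)" "closed_ops (fibre E2 (f y))" if "y \<in> Y" for y
    using that isometric_mapD(1,2)[OF isoF] by auto
  have H_eq: "(H \<circ> Pair y) c = (Pair (f y) \<circ> ?m y) c" if "y \<in> Y" "c \<in> carrier (cl1 y)" for y c
    using that by (simp add: H_def over_C1)
  have H_ring: "H \<in> Ring.ring_hom (fibre C1 y) (fibre C2 (f y))" if "y \<in> Y" for y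
    unfolding clifford_bundle_simps
    by (rule transport_ring_hom_left[OF inj_on_Pair], rule clifford_ring_hom_cong[OF ops(1)[OF that]
          ring_hom_trans[OF clifford_map_ring_hom[OF isoF[OF that]] transport_ring_hom[OF inj_on_Pair]] H_eq[OF that]])
  have H_module: "H \<in> module_hom class_ring (fibre C1 y) (fibre C2 (f y))" if "y \<in> Y" for y
    unfolding clifford_bundle_simps
    by (rule transport_module_hom_left[OF inj_on_Pair], rule module_hom_cong[OF clifford_closed(1)[OF ops(1)[OF that]]
          module_hom_comp[OF clifford_map_module_hom[OF isoF[OF that]] transport_module_hom[OF inj_on_Pair]] H_eq[OF that]])
  have incl1: "clifford_incl E1 g1 v = (y, clifford_proj (fibre E1 y) (g1 y) (single [v]))"
    if "y \<in> Y" "v \<in> carrier (fibre E1 y)" for y v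
    using that Y_subset by (auto simp: clifford_incl_def Let_def fibre1 clifford_proj_def
        degree_one_eq_tensor_proj[OF ops(1)])
  have incl2: "clifford_incl E2 g2 (F v) = (f y, clifford_proj (fibre E2 (f y)) (g2 (f y)) (single [F v]))"
    if "y \<in> Y" "v \<in> carrier (fibre E1 y)" for y v
  proof -
    have "F v \<in> carrier (fibre E2 (f y))" using module_hom_closed[OF F_linear[OF that(1)]] that(2) by auto
    then have "proj E2 (F v) = f y" using that f_image fibre2[of "f y"] by auto
    then show ?thesis
      by (simp add: clifford_incl_def Let_def clifford_proj_def degree_one_eq_tensor_proj[OF ops(2)[OF that(1)]])
  qed
  have single_free: "single [v] \<in> free_carrier (fibre E1 y)" if "v \<in> carrier (fibre E1 y)" for v y
    using that by simp
  have H_incl: "H (clifford_incl E1 g1 v) = clifford_incl E2 g2 (F v)"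
    if "y \<in> Y" "v \<in> carrier (fibre E1 y)" for y v
  proof -
    have "clifford_proj (fibre E1 y) (g1 y) (single [v]) \<in> carrier (cl1 y)"
      using single_free[OF that(2)] clifford_carrier_eq_proj[OF ops(1)[OF that(1)]] by blast
    then show ?thesis
      using H_eq[OF that(1)] clifford_map_proj[OF isoF[OF that(1)] single_free[OF that(2)]]
      by (simp add: incl1[OF that] incl2[OF that])
  qed
  have "FC = H"
    unfolding clifford_gluing_map_def Let_def
  proof (rule the_equality)
    show "?P H" using H_ring H_module H_incl by (auto simp: H_def)
    fix G' assume G': "?P G'"
    show "G' = H"
    proof (rule extensionalityI)
      show "G' \<in> extensional (over C1 Y)" using G' by blast
      show "H \<in> extensional (over C1 Y)" by (simp add: H_def)
      fix z assume "z \<in> over C1 Y"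
      then obtain y c where z: "z = (y, c)" "y \<in> Y" "c \<in> carrier (cl1 y)" by (auto simp: over_C1)
      then obtain a where a: "a \<in> free_carrier (fibre E1 y)" "c = clifford_proj (fibre E1 y) (g1 y) a"
        by (auto simp: clifford_carrier_eq_proj[OF ops(1)])
      have G'y: "G' \<in> Ring.ring_hom (fibre C1 y) (fibre C2 (f y))"
        "G' \<in> module_hom class_ring (fibre C1 y) (fibre C2 (f y))"
        "\<And>v. v \<in> carrier (fibre E1 y) \<Longrightarrow> G' (clifford_incl E1 g1 v) = clifford_incl E2 g2 (F v)"
        using G' z(2) by auto
      let ?p = "Pair y \<circ> clifford_proj (fibre E1 y) (g1 y)"
      have "G' (?p a) = H (?p a)"
      proof (rule algebra_hom_unique[OF _ _ G'y(1,2) H_ring[OF z(2)] H_module[OF z(2)] _ a(1)])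
        show "?p \<in> Ring.ring_hom (free_algebra (carrier (fibre E1 y))) (fibre C1 y)"
          unfolding clifford_bundle_simps
          by (rule ring_hom_trans[OF clifford_proj_ring_hom[OF ops(1)[OF z(2)]] transport_ring_hom[OF inj_on_Pair]])
        show "?p \<in> module_hom class_ring (free_algebra (carrier (fibre E1 y))) (fibre C1 y)"
          unfolding clifford_bundle_simps
          by (rule module_hom_comp[OF clifford_proj_module_hom[OF ops(1)[OF z(2)]] transport_module_hom[OF inj_on_Pair]])
        fix v assume v: "v \<in> carrier (fibre E1 y)"
        show "G' (?p (single [v])) = H (?p (single [v]))"
          using G'y(3)[OF v] H_incl[OF z(2) v] by (simp add: incl1[OF z(2) v])
      qed
      then show "G' z = H z" by (simp add: z a)
    qed
  qed
  then show ?thesis using H_eq[OF y c] by simp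
qed

end

sublocale bundle_gluing_setup \<subseteq> C: fibred_gluing C1 C2 Y f FC
proof
  show "FC ` over C1 Y \<subseteq> pts (total C2)"
    using f_image module_hom_closed[OF clifford_map_module_hom[OF isoF]]
    by (fastforce simp: over_C1 FC_eq C2_pts)
qed (use Y_subset f_image f_inj in \<open>auto simp: over_C1 FC_eq\<close>)

context bundle_gluing_setup
begin

subsection \<open>The isomorphism\<close>

abbreviation "m1 x \<equiv> clifford_map (fibre E1 x) (g1 x) (fibre G (i1 x)) (g (i1 x)) j1"
abbreviation "m2 x \<equiv> clifford_map (fibre E2 x) (g2 x) (fibre G (i2 x)) (g (i2 x)) j2"

text \<open>
  On the Clifford algebra of either bundle the isomorphism is induced by the natural map of the fibres into
  those of the glued bundle.
\<close>

definition clifford_iso where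
  "clifford_iso = glue_case (\<lambda>(x, c). (i1 x, m1 x c)) (\<lambda>(x, c). (i2 x, m2 x c))"

lemma m1_closed: "x \<in> pts (base E1) \<Longrightarrow> c \<in> carrier (cl1 x) \<Longrightarrow> m1 x c \<in> carrier (clG (i1 x))"
  and m2_closed: "x' \<in> pts (base E2) \<Longrightarrow> c' \<in> carrier (cl2 x') \<Longrightarrow> m2 x' c' \<in> carrier (clG (i2 x'))"
  using module_hom_closed[OF clifford_map_module_hom[OF iso1]] module_hom_closed[OF clifford_map_module_hom[OF iso2]]
  by auto

text \<open>
  Off \<open>Y\<close>, and on the whole of the second base, the fibres of the glued bundle are transported copies of
  the given ones, so the induced maps are bijective.
\<close>

lemma m1_bij: "x \<in> pts (base E1) - Y \<Longrightarrow> bij_betw (m1 x) (carrier (cl1 x)) (carrier (clG (i1 x)))"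
  using clifford_map_transport_bij[OF _ j1_inj, of x "g1 x" "g (i1 x)"] iso1[of x] by (simp add: fibre_G1)

lemma m2_bij: "x \<in> pts (base E2) \<Longrightarrow> bij_betw (m2 x) (carrier (cl2 x)) (carrier (clG (i2 x)))"
  using clifford_map_transport_bij[OF _ j2_inj_fibre, of x "g2 x" "g (i2 x)"] iso2[of x] by (simp add: fibre_G2)

text \<open>
  The two halves agree on identified elements, by functoriality along the composite of \<open>F\<close> and \<open>j2\<close>,
  which is \<open>j1\<close>.
\<close>

lemma clifford_iso_compatible:
  assumes "z \<in> over C1 Y"
  shows "(case z of (x, c) \<Rightarrow> (i1 x, m1 x c)) = (case FC z of (x, c) \<Rightarrow> (i2 x, m2 x c))"
proof -
  obtain y c where z: "z = (y, c)" "y \<in> Y" "c \<in> carrier (cl1 y)" using assms by (auto simp: over_C1)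
  have y: "y \<in> pts (base E1)" and fy: "f y \<in> pts (base E2)" using z(2) Y_subset f_image by auto
  have "j2 (F v) = j1 v" if "v \<in> carrier (fibre E1 y)" for v
    using that y z(2) by (subst j1_over) (auto simp: fibre1 over_def)
  then show ?thesis
    using clifford_map_comp[OF isoF[OF z(2)] iso2[OF fy] iso1[OF y, unfolded i1_Y[OF z(2)]] _ z(3)]
    by (simp add: z FC_eq i1_Y)
qed

lemma clifford_iso1: "x \<in> pts (base E1) \<Longrightarrow> c \<in> carrier (cl1 x) \<Longrightarrow> clifford_iso (C.j1 (x, c)) = (i1 x, m1 x c)"
  and clifford_iso2: "x' \<in> pts (base E2) \<Longrightarrow> c' \<in> carrier (cl2 x') \<Longrightarrow> clifford_iso (C.j2 (x', c')) = (i2 x', m2 x' c')"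
proof -
  let ?u1 = "\<lambda>(x, c). (i1 x, m1 x c)" and ?u2 = "\<lambda>(x, c). (i2 x, m2 x c)"
  {
    assume "x \<in> pts (base E1)" "c \<in> carrier (cl1 x)"
    then have "(x, c) \<in> pts (total C1)" by (simp add: C1_pts)
    from glue_case_in1[OF C.over_subset C.F_image, where ?u1.0 = ?u1 and ?u2.0 = ?u2, OF clifford_iso_compatible this]
    show "clifford_iso (C.j1 (x, c)) = (i1 x, m1 x c)" by (simp add: clifford_iso_def)
  next
    assume "x' \<in> pts (base E2)" "c' \<in> carrier (cl2 x')"
    then have "(x', c') \<in> pts (total C2)" by (simp add: C2_pts)
    from glue_case_in2[OF C.over_subset C.F_image, where ?u1.0 = ?u1 and ?u2.0 = ?u2, OF clifford_iso_compatible this]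
    show "clifford_iso (C.j2 (x', c')) = (i2 x', m2 x' c')" by (simp add: clifford_iso_def)
  }
qed

lemma glued_pts_cases:
  assumes "z \<in> pts (total C.G)"
  obtains x c where "x \<in> pts (base E1) - Y" "c \<in> carrier (cl1 x)" "z = C.j1 (x, c)"
    | x c where "x \<in> pts (base E2)" "c \<in> carrier (cl2 x)" "z = C.j2 (x, c)"
  using assms unfolding C.total_G
  by (elim glue_pts_cases[OF C.over_subset C.F_image]) (auto simp: C1_pts C2_pts over_C1)

lemma clifford_iso_proj:
  assumes "z \<in> pts (total C.G)"
  shows "proj CG (clifford_iso z) = proj C.G z"
  using assms
proof (cases rule: glued_pts_cases)
  case (1 x c)
  then show ?thesis using C.proj_G1[of "(x, c)"] by (simp add: clifford_iso1 C1_pts)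
next
  case (2 x c)
  then show ?thesis using C.proj_G2[of "(x, c)"] by (simp add: clifford_iso2 C2_pts)
qed

lemma clifford_iso_closed: "z \<in> pts (total C.G) \<Longrightarrow> clifford_iso z \<in> pts (total CG)"
  by (erule glued_pts_cases) (auto simp: clifford_iso1 clifford_iso2 CG_pts i_pts m1_closed m2_closed)

lemma C_j_pts:
  "x \<in> pts (base E1) \<Longrightarrow> c \<in> carrier (cl1 x) \<Longrightarrow> C.j1 (x, c) \<in> pts (total C.G)"
  "x' \<in> pts (base E2) \<Longrightarrow> c' \<in> carrier (cl2 x') \<Longrightarrow> C.j2 (x', c') \<in> pts (total C.G)"
  by (auto simp: C.total_G glue_pts[OF C.over_subset C.F_image] C1_pts C2_pts)

lemma clifford_iso_bij: "bij_betw clifford_iso (pts (total C.G)) (pts (total CG))"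
proof (rule bij_betw_imageI)
  show "inj_on clifford_iso (pts (total C.G))"
  proof (rule inj_onI)
    fix z z' assume z: "z \<in> pts (total C.G)" "z' \<in> pts (total C.G)" and eq: "clifford_iso z = clifford_iso z'"
    show "z = z'"
      using z(1)
    proof (cases rule: glued_pts_cases)
      case (1 x c)
      show ?thesis using z(2)
      proof (cases rule: glued_pts_cases)
        case (1 x' c')
        with \<open>x \<in> pts (base E1) - Y\<close> \<open>c \<in> carrier (cl1 x)\<close> \<open>z = C.j1 (x, c)\<close> eq
        have "i1 x = i1 x'" "m1 x c = m1 x' c'" by (auto simp: clifford_iso1)
        moreover from this have "x = x'" using inj_onD[OF i1_inj] 1(1) \<open>x \<in> pts (base E1) - Y\<close> by blast
        ultimately show ?thesis
          using 1 \<open>c \<in> carrier (cl1 x)\<close> \<open>z = C.j1 (x, c)\<close> m1_bij[of x] by (auto simp: bij_betw_def dest: inj_onD)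
      next
        case (2 x' c')
        with \<open>x \<in> pts (base E1) - Y\<close> \<open>c \<in> carrier (cl1 x)\<close> \<open>z = C.j1 (x, c)\<close> eq
        have "i1 x = i2 x'" by (auto simp: clifford_iso1 clifford_iso2)
        then show ?thesis using i2_not_i1[OF 2(1)] \<open>x \<in> pts (base E1) - Y\<close> by (metis imageI)
      qed
    next
      case (2 x c)
      show ?thesis using z(2)
      proof (cases rule: glued_pts_cases)
        case (1 x' c')
        with \<open>x \<in> pts (base E2)\<close> \<open>c \<in> carrier (cl2 x)\<close> \<open>z = C.j2 (x, c)\<close> eq
        have "i1 x' = i2 x" by (auto simp: clifford_iso1 clifford_iso2)
        then show ?thesis using i2_not_i1[OF \<open>x \<in> pts (base E2)\<close>] 1(1) by (metis imageI)
      next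
        case (2 x' c')
        with \<open>x \<in> pts (base E2)\<close> \<open>c \<in> carrier (cl2 x)\<close> \<open>z = C.j2 (x, c)\<close> eq
        have "i2 x = i2 x'" "m2 x c = m2 x' c'" by (auto simp: clifford_iso2)
        moreover from this have "x = x'" using base_in2_iff 2(1) \<open>x \<in> pts (base E2)\<close> by blast
        ultimately show ?thesis
          using 2 \<open>c \<in> carrier (cl2 x)\<close> \<open>z = C.j2 (x, c)\<close> m2_bij[of x] by (auto simp: bij_betw_def dest: inj_onD)
      qed
    qed
  qed
  show "clifford_iso ` pts (total C.G) = pts (total CG)"
  proof
    show "clifford_iso ` pts (total C.G) \<subseteq> pts (total CG)" using clifford_iso_closed by blast
    show "pts (total CG) \<subseteq> clifford_iso ` pts (total C.G)"
    proof
      fix p assume "p \<in> pts (total CG)"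
      then obtain z c where p: "p = (z, c)" "z \<in> pts (base G)" "c \<in> carrier (clG z)" by (auto simp: CG_pts)
      from p(2) show "p \<in> clifford_iso ` pts (total C.G)" unfolding base_G
      proof (cases rule: glue_pts_cases[OF Y_subset f_image, consumes 1])
        case (1 x)
        have "c \<in> m1 x ` carrier (cl1 x)"
          using bij_betw_imp_surj_on[OF m1_bij[OF 1(1)]] p(3) 1(2) by simp
        then obtain c' where "c' \<in> carrier (cl1 x)" "m1 x c' = c" by (elim imageE) simp
        then show ?thesis using 1 p(1) clifford_iso1 C_j_pts(1) by (intro image_eqI[of _ _ "C.j1 (x, c')"]) auto
      next
        case (2 x)
        have "c \<in> m2 x ` carrier (cl2 x)"
          using bij_betw_imp_surj_on[OF m2_bij[OF 2(1)]] p(3) 2(2) by simp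
        then obtain c' where "c' \<in> carrier (cl2 x)" "m2 x c' = c" by (elim imageE) simp
        then show ?thesis using 2 p(1) clifford_iso2 C_j_pts(2) by (intro image_eqI[of _ _ "C.j2 (x, c')"]) auto
      qed
    qed
  qed
qed

lemma clifford_iso1_class:
  assumes "x \<in> pts (base E1)" "t \<in> carrier (tensor_algebra (fibre E1 x))"
  shows "clifford_iso (C.j1 (x, clifford_class (fibre E1 x) (g1 x) t)) =
    (i1 x, clifford_class (fibre G (i1 x)) (g (i1 x)) (tensor_map (fibre G (i1 x)) j1 t))"
  using assms clifford_map_class[OF iso1[OF assms(1)] assms(2)]
  by (simp add: clifford_iso1 clifford_carrier pseudo_bundleD(6)[OF E1])

lemma clifford_iso2_class:
  assumes "x \<in> pts (base E2)" "t \<in> carrier (tensor_algebra (fibre E2 x))"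
  shows "clifford_iso (C.j2 (x, clifford_class (fibre E2 x) (g2 x) t)) =
    (i2 x, clifford_class (fibre G (i2 x)) (g (i2 x)) (tensor_map (fibre G (i2 x)) j2 t))"
  using assms clifford_map_class[OF iso2[OF assms(1)] assms(2)]
  by (simp add: clifford_iso2 clifford_carrier pseudo_bundleD(6)[OF E2])

lemma clifford_iso_smooth: "dsmooth (total C.G) (total CG) clifford_iso"
  unfolding dsmooth_def
proof (intro conjI allI impI funcsetI clifford_iso_closed)
  fix n U p assume p: "plot (total C.G) n U p"
  have U: "openin (Euclidean_space n) U"
    using p unfolding C.total_G by (simp add: glue_def pushforward_def)
  show "plot (total CG) n U (clifford_iso \<circ> p)"
  proof (rule clifford_bundle_plot_local[OF U])
    fix u assume u: "u \<in> U"
    from p[unfolded C.total_G] u show "\<exists>W p'. openin (Euclidean_space n) W \<and> u \<in> W \<and> W \<subseteq> U \<and>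
      plot (total CG) n W p' \<and> (\<forall>w\<in>W. (clifford_iso \<circ> p) w = p' w)"
    proof (cases rule: glue_plotE)
      case (left W q)
      have "plot (total CG) n W (\<lambda>w. (i1 (fst (q w)), m1 (fst (q w)) (snd (q w))))"
        by (rule clifford_bundle_push[OF E1 closed_ops_G morphism1 iso1 left(4)])
      moreover have "(clifford_iso \<circ> p) w = (i1 (fst (q w)), m1 (fst (q w)) (snd (q w)))" if w: "w \<in> W" for w
        using clifford_bundle_plot_pts[OF left(4) w] left(5)[OF w] by (auto simp: C1_pts clifford_iso1)
      ultimately show ?thesis using left(1-3) by blast
    next
      case (right W q)
      have "plot (total CG) n W (\<lambda>w. (i2 (fst (q w)), m2 (fst (q w)) (snd (q w))))"
        by (rule clifford_bundle_push[OF E2 closed_ops_G morphism2 iso2 right(4)])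
      moreover have "(clifford_iso \<circ> p) w = (i2 (fst (q w)), m2 (fst (q w)) (snd (q w)))" if w: "w \<in> W" for w
        using clifford_bundle_plot_pts[OF right(4) w] right(5)[OF w] by (auto simp: C2_pts clifford_iso2)
      ultimately show ?thesis using right(1-3) by blast
    qed
  qed
qed

text \<open>
  A plot of the Clifford bundle of the glued bundle is the class of a plot of tensors; lifting the latter to
  one of the two bundles and taking classes there inverts \<open>clifford_iso\<close>.
\<close>

lemma clifford_iso_inv_smooth: "dsmooth (total CG) (total C.G) (inv_into (pts (total C.G)) clifford_iso)"
  unfolding dsmooth_def
proof (intro conjI allI impI funcsetI)
  let ?k = "inv_into (pts (total C.G)) clifford_iso"
  have k: "?k (clifford_iso z) = z" if "z \<in> pts (total C.G)" for z
    using clifford_iso_bij that by (simp add: bij_betw_def)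
  show "?k p \<in> pts (total C.G)" if "p \<in> pts (total CG)" for p
    using clifford_iso_bij that by (simp add: bij_betw_def inv_into_into)
  fix n U p assume p: "plot (total CG) n U p"
  then have U: "openin (Euclidean_space n) U" by (simp add: clifford_bundle_plot_iff)
  have "plot (glue (total C1) (total C2) (over C1 Y) FC) n U (?k \<circ> p)"
  proof (rule glue_plotI[OF U])
    fix u assume u: "u \<in> U"
    from p have "near_each n U (clifford_plot_data G g n p)"
      unfolding clifford_bundle_plot_iff by blast
    then obtain W where W: "openin (Euclidean_space n) W" "u \<in> W" "W \<subseteq> U"
      and "\<exists>q. plot (tensor_algebra_space G) n W q \<and>
       (\<forall>w\<in>W. p w = (fst (q w), clifford_class (fibre G (fst (q w))) (g (fst (q w))) (snd (q w))))"
      by (elim near_eachE[OF _ u])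
    from this(4) obtain q where q: "plot (tensor_algebra_space G) n W q"
      "\<And>w. w \<in> W \<Longrightarrow> p w = (fst (q w), clifford_class (fibre G (fst (q w))) (g (fst (q w))) (snd (q w)))"
      by (elim exE conjE) (rule that, assumption, blast)
    from tensor_algebra_glue_lift[OF q(1) W(2)] obtain W' where
      W': "openin (Euclidean_space n) W'" "u \<in> W'" "W' \<subseteq> W"
      and lifts: "(\<exists>t. plot (tensor_algebra_space E1) n W' t \<and>
         (\<forall>w\<in>W'. q w = (i1 (fst (t w)), tensor_map (fibre G (i1 (fst (t w)))) j1 (snd (t w))))) \<or>
       (\<exists>t. plot (tensor_algebra_space E2) n W' t \<and>
         (\<forall>w\<in>W'. q w = (i2 (fst (t w)), tensor_map (fibre G (i2 (fst (t w)))) j2 (snd (t w)))))"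
      by (elim exE conjE)
    from lifts have "(\<exists>q. plot (total C1) n W' q \<and> (\<forall>w\<in>W'. (?k \<circ> p) w = C.j1 (q w))) \<or>
       (\<exists>q. plot (total C2) n W' q \<and> (\<forall>w\<in>W'. (?k \<circ> p) w = C.j2 (q w)))"
    proof (elim disjE exE conjE)
      fix t assume t: "plot (tensor_algebra_space E1) n W' t"
        "\<forall>w\<in>W'. q w = (i1 (fst (t w)), tensor_map (fibre G (i1 (fst (t w)))) j1 (snd (t w)))"
      let ?c = "\<lambda>w. (fst (t w), clifford_class (fibre E1 (fst (t w))) (g1 (fst (t w))) (snd (t w)))"
      have "plot (total C1) n W' ?c"
        unfolding clifford_bundle_plot_iff using W'(1) t(1) by (auto intro!: near_each_self)
      moreover have "(?k \<circ> p) w = C.j1 (?c w)" if w: "w \<in> W'" for w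
      proof -
        note x = tensor_algebra_space_plot_pts[OF t(1) w]
        have "C.j1 (?c w) \<in> pts (total C.G)"
          using x by (intro C_j_pts) (auto simp: clifford_carrier pseudo_bundleD(6)[OF E1])
        moreover have "p w = clifford_iso (C.j1 (?c w))"
          using clifford_iso1_class[OF x] q(2)[of w] t(2) w W'(3) by auto
        ultimately show ?thesis by (simp add: k)
      qed
      ultimately show ?thesis by blast
    next
      fix t assume t: "plot (tensor_algebra_space E2) n W' t"
        "\<forall>w\<in>W'. q w = (i2 (fst (t w)), tensor_map (fibre G (i2 (fst (t w)))) j2 (snd (t w)))"
      let ?c = "\<lambda>w. (fst (t w), clifford_class (fibre E2 (fst (t w))) (g2 (fst (t w))) (snd (t w)))"
      have "plot (total C2) n W' ?c"
        unfolding clifford_bundle_plot_iff using W'(1) t(1) by (auto intro!: near_each_self)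
      moreover have "(?k \<circ> p) w = C.j2 (?c w)" if w: "w \<in> W'" for w
      proof -
        note x = tensor_algebra_space_plot_pts[OF t(1) w]
        have "C.j2 (?c w) \<in> pts (total C.G)"
          using x by (intro C_j_pts) (auto simp: clifford_carrier pseudo_bundleD(6)[OF E2])
        moreover have "p w = clifford_iso (C.j2 (?c w))"
          using clifford_iso2_class[OF x] q(2)[of w] t(2) w W'(3) by auto
        ultimately show ?thesis by (simp add: k)
      qed
      ultimately show ?thesis by blast
    qed
    then show "\<exists>W. openin (Euclidean_space n) W \<and> u \<in> W \<and> W \<subseteq> U \<and>
      ((\<exists>q. plot (total C1) n W q \<and> (\<forall>w\<in>W. (?k \<circ> p) w = C.j1 (q w))) \<or>
       (\<exists>q. plot (total C2) n W q \<and> (\<forall>w\<in>W. (?k \<circ> p) w = C.j2 (q w))))"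
      using W' W(3) by (intro exI[of _ W'] conjI) auto
  qed
  then show "plot (total C.G) n U (?k \<circ> p)" by (simp only: C.total_G)
qed

lemma clifford_iso_linear:
  assumes "z \<in> pts (base G)"
  shows "clifford_iso \<in> module_hom class_ring (fibre C.G z) (fibre CG z)"
  using assms unfolding base_G
proof (cases rule: glue_pts_cases[OF Y_subset f_image, consumes 1])
  case (1 x)
  then have x: "x \<in> pts (base E1)" and x': "x \<in> pts (base C1) - Y" by auto
  have inj: "inj_on C.j1 (carrier (fibre C1 x))"
    using 1 by (intro inj_onI) (auto simp: transport_carrier[OF inj_on_Pair] C.total_in1_iff C1_pts, auto simp: over_C1)
  have fibre: "fibre C.G z = transport C.j1 (transport (Pair x) (cl1 x))"
    using C.fibre_G1[OF x'] 1 by simp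
  have "clifford_iso \<circ> C.j1 \<circ> Pair x \<in> module_hom class_ring (cl1 x) (transport (Pair z) (clG z))"
    unfolding 1(2)
    by (rule module_hom_cong[OF clifford_closed(1)[OF pseudo_bundleD(6)[OF E1 x]]
          module_hom_comp[OF clifford_map_module_hom[OF iso1[OF x]] transport_module_hom[OF inj_on_Pair]]])
      (use x clifford_iso1 in auto)
  then show ?thesis
    unfolding fibre clifford_bundle_simps
    by (intro transport_module_hom_left[OF inj[simplified]] transport_module_hom_left[OF inj_on_Pair])
next
  case (2 x)
  then have x: "x \<in> pts (base E2)" and x': "x \<in> pts (base C2)" by auto
  have inj: "inj_on C.j2 (carrier (fibre C2 x))"
    using 2 by (intro inj_onI) (auto simp: transport_carrier[OF inj_on_Pair] C.total_in2_iff C2_pts)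
  have fibre: "fibre C.G z = transport C.j2 (transport (Pair x) (cl2 x))"
    using C.fibre_G2[OF x'] 2 by simp
  have "clifford_iso \<circ> C.j2 \<circ> Pair x \<in> module_hom class_ring (cl2 x) (transport (Pair z) (clG z))"
    unfolding 2(2)
    by (rule module_hom_cong[OF clifford_closed(1)[OF pseudo_bundleD(6)[OF E2 x]]
          module_hom_comp[OF clifford_map_module_hom[OF iso2[OF x]] transport_module_hom[OF inj_on_Pair]]])
      (use x clifford_iso2 in auto)
  then show ?thesis
    unfolding fibre clifford_bundle_simps
    by (intro transport_module_hom_left[OF inj[simplified]] transport_module_hom_left[OF inj_on_Pair])
qed

lemma clifford_iso_bundle_diffeo: "bundle_diffeo C.G CG clifford_iso"
proof -
  have base: "base C.G = base G" by (simp add: C.base_G base_G)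
  show ?thesis
    unfolding bundle_diffeo_def diffeo_def
    using clifford_iso_bij clifford_iso_smooth clifford_iso_inv_smooth clifford_iso_proj clifford_iso_linear by (simp add: base)
qed

end

theorem theorem5p6:
  fixes E1 :: "('x1, 'v1) pbundle" and E2 :: "('x2, 'v2) pbundle"
    and Y :: "'x1 set" and f :: "'x1 \<Rightarrow> 'x2" and F :: "'v1 \<Rightarrow> 'v2"
    and g1 :: "'x1 \<Rightarrow> 'v1 \<Rightarrow> 'v1 \<Rightarrow> real" and g2 :: "'x2 \<Rightarrow> 'v2 \<Rightarrow> 'v2 \<Rightarrow> real"
  assumes "pseudo_bundle E1" and "finite_dimensional E1"
    and "pseudo_bundle E2" and "finite_dimensional E2"
    and "bundle_gluing E1 E2 Y f F"
    and "pseudo_metric E1 g1" and "pseudo_metric E2 g2"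
    and "metrics_compatible E1 Y f F g1 g2"
  shows "\<exists>\<Phi>. bundle_diffeo
     (glue_bundle (clifford_bundle E1 g1) (clifford_bundle E2 g2) Y f
        (clifford_gluing_map E1 E2 Y f F g1 g2))
     (clifford_bundle (glue_bundle E1 E2 Y f F) (glue_metric E1 E2 Y f F g1 g2)) \<Phi>"
proof -
  interpret bundle_gluing_setup E1 E2 Y f F g1 g2
    by unfold_locales (fact assms)+
  show ?thesis using clifford_iso_bundle_diffeo by blast
qed

end
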